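(* Let $\theta=-27.963755\ldots$ be the smallest real root of $x^3+27x^2-93x-1847$, let $I_7=(\theta,-13)$, and for $t\in I_7$ put $\omega=\omega(t)=\sqrt{3(506+75t-t^3)}$ and $q=q(t)=2^{14}3^3(1+t)^{12}$. Then the septic normalized proper Zolotarev polynomials are parametrized by $t\in I_7$ (in the precise sense given in the context) as $$Z_{7,t}(x)=\sum_{k=0}^{7}b_{k,7}(t)x^k=\frac1q\Big((p_{01}+\omega p_{02})-\sqrt{p_{11}+\omega p_{12}}\,x+(p_{21}+\omega p_{22})x^2+\sqrt{p_{31}+\omega p_{32}}\,x^3+(p_{41}+\omega p_{42})x^4-\sqrt{p_{51}+\omega p_{52}}\,x^5+(p_{61}+\omega p_{62})x^6+\sqrt{p_{71}+\omega p_{72}}\,x^7\Big),$$ where the polynomials $p_{k1}=p_{k1}(t)$, $p_{k2}=p_{k2}(t)$, $0\le k\le 7$, are the following. \begin{align*} p_{01}=&-18763256064938069 - 14792872686537861 t - 4057867882494249 t^2 - 256473877330753 t^3 \\ &+ 85285038707343 t^4 + 17823637386255 t^5 + 692357704507 t^6 - 127085232717 t^7 \\ &- 14780540079 t^8 - 560972063 t^9 - 31101579 t^{10} - 2597811 t^{11} + 82613 t^{12} \\ &- 1323 t^{13} + 57 t^{14} + t^{15},\\ p_{02}=&-2(-11+t)(13+t)(-1674587596733 - 1209041071723 t - 302152954691 t^2 - 21722362269 t^3 \\ &+ 3705247230 t^4 + 789592530 t^5 + 56234874 t^6 + 3485670 t^7 + 365007 t^8 \\ &+ 23113 t^9 +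 953 t^{10} + 7 t^{11}); \end{align*} \begin{align*} p_{21}=&\,3(18693496205907553 + 14653197505814513 t + 3981810914612581 t^2 + 239053845556285 t^3 \\ &- 102939835099507 t^4 - 25328343306323 t^5 - 1853461246959 t^6 + 107242836249 t^7 \\ &+ 29544857619 t^8 + 2472362275 t^9 + 146645759 t^{10} + 4570855 t^{11} - 537665 t^{12} \\ &+ 13055 t^{13} + 715 t^{14} + 3 t^{15}),\\ p_{22}=&\,6(-11+t)(-21838212747157 - 17497718905404 t - 5120760089418 t^2 - 504642284812 t^3 \\ &+ 58729363461 t^4 + 20582639496 t^5 + 2601849972 t^6 + 260190216 t^7 + 24607269 t^8 \\ &+ 1916084 t^9 + 126006 t^{10} + 2820 t^{11} + 11 t^{12}); \end{align*} \begin{align*} p_{41}=&-55871225142758423 - 43540681750709607 t - 11717614079999475 t^2 - 665505935839675 t^3 \\ &+ 361155464423541 t^4 + 98101500744117 t^5 + 8901143308057 t^6 - 283763308671 t^7 \\ &- 131298459093 t^8 - 12236812901 t^9 - 634905225 t^{10} + 4984959 t^{11} + 5484599 t^{12} \\ &- 90153 t^{13} - 5469 t^{14} - 5 t^{15},\\ p_{42}=&\,2(-11+t)(65720348410115 + 52809871430820 t + 15313261582566 t^2 + 1273925478740 t^3 \\ &- 273249867411 t^4 - 81619243704 t^5 - 10990866156 t^6 - 1213822008 t^7 - 112375539 t^8 \\ &- 9007084 t^9 - 714138 t^{10} - 12060 t^{11} + 35 t^{12}); \end{align*} \begin{align*} p_{61}=&-(-11+t)^2(-153338781731665 - 146672852170183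 t - 57053827731174 t^2 - 10853963116498 t^3 \\ &- 364563173779 t^4 + 353504395539 t^5 + 100621371036 t^6 + 14639637108 t^7 + 1357232985 t^8 \\ &+ 82116623 t^9 + 2086442 t^{10} - 122370 t^{11} - 3157 t^{12} + 5 t^{13}),\\ p_{62}=&-2(-11+t)(21975348926173 + 17708836243740 t + 5088010797018 t^2 + 344542288492 t^3 \\ &- 123507628749 t^4 - 33841275336 t^5 - 4705962132 t^6 - 534799944 t^7 - 46784493 t^8 \\ &- 3924308 t^9 - 371622 t^{10} - 4644 t^{11} + 61 t^{12}); \end{align*} \begin{align*} p_{11}=&(-11+t)^2(13+t)(452216947186296794781508787221 + 777864295951362656514677949267 t \\ &+ 607534824156974545331687561835 t^2 + 288634496196055112144179788837 t^3 \\ &+ 94921610624381795338201698150 t^4 + 23398676158988289024635179242 t^5 \\ &+ 4516301732554082896075701906 t^6 + 670693737388662494219775918 t^7 \\ &+ 65114539902315732706516167 t^8 + 225857740971173605970001 t^9 \\ &- 1430942150712305946880479 t^{10} - 342406310658223828546833 t^{11} \\ &- 50591510405201802666684 t^{12} - 5031713916356520207588 t^{13} \\ &- 245445214348728475284 t^{14} + 18666155444026029204 t^{15} + 5518191822155449683 t^{16} \\ &+ 667345379819561157 t^{17} + 56579749561878525 t^{18} + 3879945477820083 t^{19} \\ &+ 222845520949494 t^{20} + 10128182363994 t^{21} + 372786923490 t^{22} + 14225061342 t^{23} \\ &+ 269308977 t^{24} + 2533431 t^{25} + 12183 t^{26} + 25 t^{27}),\\ p_{12}=&-4(-11+t)(13+t)(31914659841429719306288181169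 + 49622272083198674583533509976 t \\ &+ 34282407163818360892131872011 t^2 + 14089140494250744184954719632 t^3 \\ &+ 3939130934203140296373699118 t^4 + 816295770208132930522370528 t^5 \\ &+ 128243247492098759194165618 t^6 + 13314328240910465891671856 t^7 \\ &+ 128141672346772035888475 t^8 - 286794878594776251702280 t^9 \\ &- 69849141585341704716287 t^{10} - 10401588386734438049632 t^{11} \\ &- 1051853965102136706572 t^{12} - 44866622100154016896 t^{13} + 7156442882520008620 t^{14} \\ &+ 1751453046589473632 t^{15} + 198334297114129879 t^{16} + 15312353847501512 t^{17} \\ &+ 913407761253853 t^{18} + 43228054413008 t^{19} + 1867714065406 t^{20} + 77464313504 t^{21} \\ &+ 424793026 t^{22} + 97097840 t^{23} + 2479357 t^{24} + 20456 t^{25} + 55 t^{26}); \end{align*} \begin{align*} p_{31}=&(-11+t)^2(13+t)(4067505216555761454939774893653 + 6987837642353627260453914645459 t \\ &+ 5438613582037781367520396463019 t^2 + 2560707467679066258265342737957 t^3 \\ &+ 824972899826967571738685701350 t^4 + 195202779101501586572821066218 t^5 \\ &+ 35131305236199004729935240210 t^6 + 4678831943670682549788428718 t^7 \\ &+ 361836187431226939045737351 t^8 - 20164101539468052079040559 t^9 \\ &- 13174289998662412173304863 t^{10} - 2713002595179009782526225 t^{11} \\ &- 370593851448133729776060 t^{12} - 34447522144717830870756 t^{13} \\ &- 1447965995249043223956 t^{14} + 171750733434992851092 t^{15} + 44014595143625089299 t^{16} \\ &+ 5235351517006620741 t^{17} + 455693290860748989 t^{18} + 34604751969519795 t^{19}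 \\ &+ 2164988949830262 t^{20} + 86364631885914 t^{21} + 2806443018594 t^{22} + 191205136350 t^{23} \\ &+ 833140593 t^{24} - 18388809 t^{25} - 108585 t^{26} + 25 t^{27}),\\ p_{32}=&\,4(-11+t)(13+t)(-287083238187382918159834379953 - 445801161270188409230824278008 t \\ &- 306728192538886372185457889323 t^2 - 124540340456986580024209236752 t^3 \\ &- 33754019007714977189198810542 t^4 - 6551380444197468706377349664 t^5 \\ &- 918445270855125642258035890 t^6 - 75504009528614463821485232 t^7 \\ &+ 3790216746747400729507877 t^8 + 2726753925037134860883880 t^9 \\ &+ 554883207716411782569503 t^{10} + 72654419716931233973344 t^{11} \\ &+ 6402816324184929410828 t^{12} + 222919538823946521856 t^{13} - 45365822597641351468 t^{14} \\ &- 11428229964701074016 t^{15} - 1568015533264197079 t^{16} - 148747442138288168 t^{17} \\ &- 8894717908807357 t^{18} - 336458623759952 t^{19} - 23802738217342 t^{20} - 1386825048800 t^{21} \\ &+ 41898906878 t^{22} - 3064255472 t^{23} - 52362109 t^{24} - 143240 t^{25} + 425 t^{26}); \end{align*} \begin{align*} p_{51}=&\,9(-11+t)^2(13+t)(451683738573925104075654483397 + 775028304316495850519095857571 t \\ &+ 601098380398696980859206188475 t^2 + 280438400343985227860396599637 t^3 \\ &+ 88413801617548106639965501190 t^4 + 19995978992632195901029965642 t^5 \\ &+ 3311133099437108231552511346 t^6 + 381643355735517005395779022 t^7 \\ &+ 20320264324033151140865367 t^8 - 3195804458535397562311231 t^9 \\ &- 1143533730000698431197679 t^{10} - 199161415603964037521793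 t^{11} \\ &- 24372543185825459073788 t^{12} - 2046716710595960850596 t^{13} - 54372780278781597012 t^{14} \\ &+ 15828476336106803540 t^{15} + 2730101569863744803 t^{16} + 213625544957043957 t^{17} \\ &+ 16273483271374381 t^{18} + 2177665019822083 t^{19} + 170504391614358 t^{20} \\ &+ 1407379805882 t^{21} - 64033877566 t^{22} + 34948495614 t^{23} - 280552415 t^{24} \\ &- 2994617 t^{25} - 3033 t^{26} + 9 t^{27}),\\ p_{52}=&\,36(-11+t)(13+t)(-31880883382920453164668056673 - 49442138480111650024519040920 t \\ &- 33876857431725516714538231899 t^2 - 13586828819760368667536109968 t^3 \\ &- 3564076460496389044892230862 t^4 - 641364123356694605499355488 t^5 \\ &- 76820427126193234239727954 t^6 - 4024537857983776624054576 t^7 \\ &+ 721610167022215867925013 t^8 + 250695526123771611854152 t^9 \\ &+ 42150204570837646184719 t^{10} + 4607435727083778525024 t^{11} + 285829921804590641228 t^{12} \\ &- 1218353702615312512 t^{13} - 2310870292391561964 t^{14} - 479326657450856288 t^{15} \\ &- 99660901007536295 t^{16} - 11197664464328328 t^{17} - 270797298387469 t^{18} \\ &+ 23020663051568 t^{19} - 2954480013726 t^{20} - 221351668256 t^{21} + 23088702814 t^{22} \\ &- 709577328 t^{23} - 2352877 t^{24} + 17624 t^{25} + 57 t^{26}); \end{align*} \begin{align*} p_{71}=&(-11+t)^5(13+t)(-339168361039365519460069487 - 673770165671451476923579920 t \\ &- 624601585018296333977402028 t^2 - 361544324905454191834056976 t^3 \\ &- 147614051919387405233687790 t^4 - 45526903723214507531501616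 t^5 \\ &- 11086126516765664128988252 t^6 - 2197894018386795481276848 t^7 \\ &- 362820760120106657958897 t^8 - 50767332334243984565152 t^9 \\ &- 6127600928703138323160 t^{10} - 650077861901582788512 t^{11} - 61158225664029403460 t^{12} \\ &- 5020585598717657952 t^{13} - 364251213557808792 t^{14} - 29139030508404832 t^{15} \\ &- 3029017347965889 t^{16} - 254576059234128 t^{17} - 7598948126588 t^{18} + 550936914864 t^{19} \\ &+ 31892020818 t^{20} - 830153584 t^{21} + 4681716 t^{22} - 6384 t^{23} + t^{24}),\\ p_{72}=&\,4(-11+t)^4(13+t)(23939066421797920012252547 + 43604945745949888884259555 t \\ &+ 36595686922095182565230747 t^2 + 18937189808814759845550851 t^3 \\ &+ 6829585752660013948505437 t^4 + 1838774116182807709355117 t^5 \\ &+ 385867254213289689843597 t^6 + 64938062296917527124693 t^7 \\ &+ 8939182382326190698494 t^8 + 1017640859072593780990 t^9 + 95200006411552224398 t^{10} \\ &+ 7145677316358425566 t^{11} + 448416529340354362 t^{12} + 29699683025185562 t^{13} \\ &+ 1131537557463418 t^{14} - 300028277805366 t^{15} - 48306393782385 t^{16} + 333976819119 t^{17} \\ &+ 484360416551 t^{18} + 17604770671 t^{19} - 1059177895 t^{20} + 10971881 t^{21} \\ &- 30551 t^{22} + 17 t^{23}). \end{align*} Moreover, the limits of $Z_{7,t}$ at the endpoints of $I_7$ are $$\lim_{t\to-13}Z_{7,t}(x)=-T_6(x)=1-18x^2+48x^4-32x^6,$$ $$\lim_{t\to\theta}Z_{7,t}(x)=T_7(y)=-7y+56y^3-112y^5+64y^7\quad\text{with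 } y=(1+x)\cos^2\!\left(\tfrac{\pi}{14}\right)-1,$$ and the coefficients of the corresponding monic proper Zolotarev polynomial $\widetilde Z_{7,t}(x)=\sum_{k=0}^7 a_{k,7}(t)x^k$ are $a_{k,7}(t)=b_{k,7}(t)/b_{7,7}(t)$, $0\le k\le 7$.
   Context: All polynomials in $x$ have real coefficients, $\|\cdot\|_\infty$ is the uniform norm on $[-1,1]$, and $T_n$ is the $n$-th Chebyshev polynomial of the first kind ($T_n(\cos\phi)=\cos n\phi$). Zolotarev's first problem for degree $7$: for given $s\in\mathbb{R}$, minimize $\|P\|_\infty$ over all polynomials $P(x)=x^7-7s\,x^6+\sum_{k=0}^{5}a_kx^k$ with $(a_0,\dots,a_5)\in\mathbb{R}^6$. The minimum is denoted $L_7(s)$ and the (unique) minimizer $\widetilde Z^{*}_{7,s}$. For $s>\tan^2(\pi/14)$ the polynomial $\widetilde Z^{*}_{7,s}$ is called the monic proper Zolotarev polynomial of degree $7$ (for that $s$), and $Z^{*}_{7,s}=\widetilde Z^{*}_{7,s}/L_7(s)$, which has uniform norm $1$ on $[-1,1]$, is called the normalized proper Zolotarev polynomial of degree $7$. Meaning of "parametrized by $t\in I_7$": for every $t\in I_7$ the given expression $Z_{7,t}$ is well defined and has $b_{7,7}(t)\ne0$; setting $s(t)=-\,b_{6,7}(t)/(7\,b_{7,7}(t))$, the map $t\mapsto s(t)$ is a bijection from $I_7$ onto $(\tan^2(\pi/14),\infty)$; and $Z_{7,t}=Z^{*}_{7,s(t)}$ for every $t\in I_7$. Correspondingly $\widetilde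 Z_{7,t}=\widetilde Z^{*}_{7,s(t)}$ denotes the monic proper Zolotarev polynomial with parameter $t$, so that $Z_{7,t}=\widetilde Z_{7,t}/L_7(s(t))$. Square roots are nonnegative real square roots. The limits $t\to-13$ and $t\to\theta$ are taken with $t\in I_7$. *)

theory Defs
  imports "HOL-Analysis.Analysis" "HOL-Computational_Algebra.Polynomial"
begin

definition cheb :: "nat \<Rightarrow> real poly" where
  "cheb n = (THE p. \<forall>\<phi>::real. poly p (cos \<phi>) = cos (real n * \<phi>))"

lemma cheb_ex1: "\<exists>!p::real poly. \<forall>\<phi>. poly p (cos \<phi>) = cos (real n * \<phi>)"
proof (rule ex_ex1I)
  show "\<exists>p::real poly. \<forall>\<phi>. poly p (cos \<phi>) = cos (real n * \<phi>)"
  proof (induction n rule: less_induct)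
    case (less n)
    show ?case
    proof (cases "n < 2")
      case True
      then consider "n = 0" | "n = 1" by linarith
      then show ?thesis
      proof cases
        case 1
        then show ?thesis by (intro exI[of _ 1]) simp
      next
        case 2
        then show ?thesis by (intro exI[of _ "[:0, 1:]"]) simp
      qed
    next
      case False
      then obtain m where m: "n = m + 2" by (metis add.commute le_Suc_ex not_less)
      obtain p where p: "\<And>\<phi>::real. poly p (cos \<phi>) = cos (real m * \<phi>)"
        using less[of m] m by auto
      obtain r where r: "\<And>\<phi>::real. poly r (cos \<phi>) = cos (real (m + 1) * \<phi>)"
        using less[of "m + 1"] m by auto
      have step: "cos (real n * \<phi>) = 2 * cos \<phi> * cos (real (m + 1) * \<phi>) - cos (real m * \<phi>)" for \<phi> :: real
      proof -
        have "real n * \<phi> = real (m + 1) * \<phi> + \<phi>" "real m * \<phi> = real (m + 1) * \<phi> - \<phi>"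
          using m by (simp_all add: algebra_simps)
        then show ?thesis by (simp only: cos_add cos_diff) simp
      qed
      show ?thesis
        by (intro exI[of _ "[:0, 2:] * r - p"]) (simp add: step p r del: of_nat_add)
    qed
  qed
next
  fix p r :: "real poly"
  assume p: "\<forall>\<phi>. poly p (cos \<phi>) = cos (real n * \<phi>)" and r: "\<forall>\<phi>. poly r (cos \<phi>) = cos (real n * \<phi>)"
  have "poly (p - r) x = 0" if "x \<in> {-1..1}" for x
    using p[rule_format, of "arccos x"] r[rule_format, of "arccos x"] that by simp
  then have "{-1..1} \<subseteq> {x. poly (p - r) x = 0}" by auto
  moreover have "infinite {-1..1::real}" by (simp add: infinite_Icc)
  ultimately have "infinite {x. poly (p - r) x = 0}" using finite_subset by blast
  then have "p - r = 0" using poly_roots_finite by blast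
  then show "p = r" by simp
qed

definition unorm :: "real poly \<Rightarrow> real" where
  "unorm P = (SUP x\<in>{-1..1}. \<bar>poly P x\<bar>)"

definition zol_class :: "real \<Rightarrow> real poly set" where
  "zol_class s = {P. \<exists>a :: nat \<Rightarrow> real. P = monom 1 7 - monom (7 * s) 6 + (\<Sum>k\<le>5. monom (a k) k)}"

definition zol_min :: "real \<Rightarrow> real" where
  "zol_min s = (INF P\<in>zol_class s. unorm P)"

definition monic_zol :: "real \<Rightarrow> real poly" where
  "monic_zol s = (THE P. is_arg_min unorm (\<lambda>P. P \<in> zol_class s) P)"

definition normalized_zol :: "real \<Rightarrow> real poly" where
  "normalized_zol s = smult (1 / zol_min s) (monic_zol s)"

definition zol_theta :: real where
  "zol_theta = (LEAST x. x ^ 3 + 27 * x\<^sup>2 - 93 * x - 1847 = 0)"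

definition zol_I :: "real set" where
  "zol_I = {zol_theta<..<-13}"

definition zol_omega :: "real \<Rightarrow> real" where
  "zol_omega t = sqrt (3 * (506 + 75 * t - t ^ 3))"

definition zol_q :: "real \<Rightarrow> real" where
  "zol_q t = 2 ^ 14 * 3 ^ 3 * (1 + t) ^ 12"

definition p01 :: "real \<Rightarrow> real" where
  "p01 t =
     -18763256064938069 - 14792872686537861 * t - 4057867882494249 * t ^ 2
     - 256473877330753 * t ^ 3 + 85285038707343 * t ^ 4 + 17823637386255 * t ^ 5
     + 692357704507 * t ^ 6 - 127085232717 * t ^ 7 - 14780540079 * t ^ 8 - 560972063 * t ^ 9
     - 31101579 * t ^ 10 - 2597811 * t ^ 11 + 82613 * t ^ 12 - 1323 * t ^ 13 + 57 * t ^ 14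
     + t ^ 15"

definition p02 :: "real \<Rightarrow> real" where
  "p02 t =
     -2 * (-11 + t) * (13 + t) * (-1674587596733 - 1209041071723 * t - 302152954691 * t ^ 2
     - 21722362269 * t ^ 3 + 3705247230 * t ^ 4 + 789592530 * t ^ 5 + 56234874 * t ^ 6
     + 3485670 * t ^ 7 + 365007 * t ^ 8 + 23113 * t ^ 9 + 953 * t ^ 10 + 7 * t ^ 11)"

definition p11 :: "real \<Rightarrow> real" where
  "p11 t =
     (-11 + t) ^ 2 * (13 + t) * (452216947186296794781508787221
     + 777864295951362656514677949267 * t + 607534824156974545331687561835 * t ^ 2
     + 288634496196055112144179788837 * t ^ 3 + 94921610624381795338201698150 * t ^ 4
     + 23398676158988289024635179242 * t ^ 5 + 4516301732554082896075701906 * t ^ 6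
     + 670693737388662494219775918 * t ^ 7 + 65114539902315732706516167 * t ^ 8
     + 225857740971173605970001 * t ^ 9 - 1430942150712305946880479 * t ^ 10
     - 342406310658223828546833 * t ^ 11 - 50591510405201802666684 * t ^ 12
     - 5031713916356520207588 * t ^ 13 - 245445214348728475284 * t ^ 14
     + 18666155444026029204 * t ^ 15 + 5518191822155449683 * t ^ 16
     + 667345379819561157 * t ^ 17 + 56579749561878525 * t ^ 18 + 3879945477820083 * t ^ 19
     + 222845520949494 * t ^ 20 + 10128182363994 * t ^ 21 + 372786923490 * t ^ 22
     + 14225061342 * t ^ 23 + 269308977 * t ^ 24 + 2533431 * t ^ 25 + 12183 * t ^ 26
     + 25 * t ^ 27)"

definition p12 :: "real \<Rightarrow> real" where
  "p12 t =
     -4 * (-11 + t) * (13 + t) * (31914659841429719306288181169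
     + 49622272083198674583533509976 * t + 34282407163818360892131872011 * t ^ 2
     + 14089140494250744184954719632 * t ^ 3 + 3939130934203140296373699118 * t ^ 4
     + 816295770208132930522370528 * t ^ 5 + 128243247492098759194165618 * t ^ 6
     + 13314328240910465891671856 * t ^ 7 + 128141672346772035888475 * t ^ 8
     - 286794878594776251702280 * t ^ 9 - 69849141585341704716287 * t ^ 10
     - 10401588386734438049632 * t ^ 11 - 1051853965102136706572 * t ^ 12
     - 44866622100154016896 * t ^ 13 + 7156442882520008620 * t ^ 14
     + 1751453046589473632 * t ^ 15 + 198334297114129879 * t ^ 16
     + 15312353847501512 * t ^ 17 + 913407761253853 * t ^ 18 + 43228054413008 * t ^ 19
     + 1867714065406 * t ^ 20 + 77464313504 * t ^ 21 + 424793026 * t ^ 22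
     + 97097840 * t ^ 23 + 2479357 * t ^ 24 + 20456 * t ^ 25 + 55 * t ^ 26)"

definition p21 :: "real \<Rightarrow> real" where
  "p21 t =
     3 * (18693496205907553 + 14653197505814513 * t + 3981810914612581 * t ^ 2
     + 239053845556285 * t ^ 3 - 102939835099507 * t ^ 4 - 25328343306323 * t ^ 5
     - 1853461246959 * t ^ 6 + 107242836249 * t ^ 7 + 29544857619 * t ^ 8
     + 2472362275 * t ^ 9 + 146645759 * t ^ 10 + 4570855 * t ^ 11 - 537665 * t ^ 12
     + 13055 * t ^ 13 + 715 * t ^ 14 + 3 * t ^ 15)"

definition p22 :: "real \<Rightarrow> real" where
  "p22 t =
     6 * (-11 + t) * (-21838212747157 - 17497718905404 * t - 5120760089418 * t ^ 2
     - 504642284812 * t ^ 3 + 58729363461 * t ^ 4 + 20582639496 * t ^ 5 + 2601849972 * t ^ 6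
     + 260190216 * t ^ 7 + 24607269 * t ^ 8 + 1916084 * t ^ 9 + 126006 * t ^ 10
     + 2820 * t ^ 11 + 11 * t ^ 12)"

definition p31 :: "real \<Rightarrow> real" where
  "p31 t =
     (-11 + t) ^ 2 * (13 + t) * (4067505216555761454939774893653
     + 6987837642353627260453914645459 * t + 5438613582037781367520396463019 * t ^ 2
     + 2560707467679066258265342737957 * t ^ 3 + 824972899826967571738685701350 * t ^ 4
     + 195202779101501586572821066218 * t ^ 5 + 35131305236199004729935240210 * t ^ 6
     + 4678831943670682549788428718 * t ^ 7 + 361836187431226939045737351 * t ^ 8
     - 20164101539468052079040559 * t ^ 9 - 13174289998662412173304863 * t ^ 10
     - 2713002595179009782526225 * t ^ 11 - 370593851448133729776060 * t ^ 12
     - 34447522144717830870756 * t ^ 13 - 1447965995249043223956 * t ^ 14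
     + 171750733434992851092 * t ^ 15 + 44014595143625089299 * t ^ 16
     + 5235351517006620741 * t ^ 17 + 455693290860748989 * t ^ 18
     + 34604751969519795 * t ^ 19 + 2164988949830262 * t ^ 20 + 86364631885914 * t ^ 21
     + 2806443018594 * t ^ 22 + 191205136350 * t ^ 23 + 833140593 * t ^ 24
     - 18388809 * t ^ 25 - 108585 * t ^ 26 + 25 * t ^ 27)"

definition p32 :: "real \<Rightarrow> real" where
  "p32 t =
     4 * (-11 + t) * (13 + t) * (-287083238187382918159834379953
     - 445801161270188409230824278008 * t - 306728192538886372185457889323 * t ^ 2
     - 124540340456986580024209236752 * t ^ 3 - 33754019007714977189198810542 * t ^ 4
     - 6551380444197468706377349664 * t ^ 5 - 918445270855125642258035890 * t ^ 6
     - 75504009528614463821485232 * t ^ 7 + 3790216746747400729507877 * t ^ 8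
     + 2726753925037134860883880 * t ^ 9 + 554883207716411782569503 * t ^ 10
     + 72654419716931233973344 * t ^ 11 + 6402816324184929410828 * t ^ 12
     + 222919538823946521856 * t ^ 13 - 45365822597641351468 * t ^ 14
     - 11428229964701074016 * t ^ 15 - 1568015533264197079 * t ^ 16
     - 148747442138288168 * t ^ 17 - 8894717908807357 * t ^ 18 - 336458623759952 * t ^ 19
     - 23802738217342 * t ^ 20 - 1386825048800 * t ^ 21 + 41898906878 * t ^ 22
     - 3064255472 * t ^ 23 - 52362109 * t ^ 24 - 143240 * t ^ 25 + 425 * t ^ 26)"

definition p41 :: "real \<Rightarrow> real" where
  "p41 t =
     -55871225142758423 - 43540681750709607 * t - 11717614079999475 * t ^ 2
     - 665505935839675 * t ^ 3 + 361155464423541 * t ^ 4 + 98101500744117 * t ^ 5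
     + 8901143308057 * t ^ 6 - 283763308671 * t ^ 7 - 131298459093 * t ^ 8
     - 12236812901 * t ^ 9 - 634905225 * t ^ 10 + 4984959 * t ^ 11 + 5484599 * t ^ 12
     - 90153 * t ^ 13 - 5469 * t ^ 14 - 5 * t ^ 15"

definition p42 :: "real \<Rightarrow> real" where
  "p42 t =
     2 * (-11 + t) * (65720348410115 + 52809871430820 * t + 15313261582566 * t ^ 2
     + 1273925478740 * t ^ 3 - 273249867411 * t ^ 4 - 81619243704 * t ^ 5
     - 10990866156 * t ^ 6 - 1213822008 * t ^ 7 - 112375539 * t ^ 8 - 9007084 * t ^ 9
     - 714138 * t ^ 10 - 12060 * t ^ 11 + 35 * t ^ 12)"

definition p51 :: "real \<Rightarrow> real" where
  "p51 t =
     9 * (-11 + t) ^ 2 * (13 + t) * (451683738573925104075654483397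
     + 775028304316495850519095857571 * t + 601098380398696980859206188475 * t ^ 2
     + 280438400343985227860396599637 * t ^ 3 + 88413801617548106639965501190 * t ^ 4
     + 19995978992632195901029965642 * t ^ 5 + 3311133099437108231552511346 * t ^ 6
     + 381643355735517005395779022 * t ^ 7 + 20320264324033151140865367 * t ^ 8
     - 3195804458535397562311231 * t ^ 9 - 1143533730000698431197679 * t ^ 10
     - 199161415603964037521793 * t ^ 11 - 24372543185825459073788 * t ^ 12
     - 2046716710595960850596 * t ^ 13 - 54372780278781597012 * t ^ 14
     + 15828476336106803540 * t ^ 15 + 2730101569863744803 * t ^ 16
     + 213625544957043957 * t ^ 17 + 16273483271374381 * t ^ 18 + 2177665019822083 * t ^ 19
     + 170504391614358 * t ^ 20 + 1407379805882 * t ^ 21 - 64033877566 * t ^ 22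
     + 34948495614 * t ^ 23 - 280552415 * t ^ 24 - 2994617 * t ^ 25 - 3033 * t ^ 26
     + 9 * t ^ 27)"

definition p52 :: "real \<Rightarrow> real" where
  "p52 t =
     36 * (-11 + t) * (13 + t) * (-31880883382920453164668056673
     - 49442138480111650024519040920 * t - 33876857431725516714538231899 * t ^ 2
     - 13586828819760368667536109968 * t ^ 3 - 3564076460496389044892230862 * t ^ 4
     - 641364123356694605499355488 * t ^ 5 - 76820427126193234239727954 * t ^ 6
     - 4024537857983776624054576 * t ^ 7 + 721610167022215867925013 * t ^ 8
     + 250695526123771611854152 * t ^ 9 + 42150204570837646184719 * t ^ 10
     + 4607435727083778525024 * t ^ 11 + 285829921804590641228 * t ^ 12
     - 1218353702615312512 * t ^ 13 - 2310870292391561964 * t ^ 14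
     - 479326657450856288 * t ^ 15 - 99660901007536295 * t ^ 16 - 11197664464328328 * t ^ 17
     - 270797298387469 * t ^ 18 + 23020663051568 * t ^ 19 - 2954480013726 * t ^ 20
     - 221351668256 * t ^ 21 + 23088702814 * t ^ 22 - 709577328 * t ^ 23 - 2352877 * t ^ 24
     + 17624 * t ^ 25 + 57 * t ^ 26)"

definition p61 :: "real \<Rightarrow> real" where
  "p61 t =
     - ((-11 + t) ^ 2 * (-153338781731665 - 146672852170183 * t - 57053827731174 * t ^ 2
     - 10853963116498 * t ^ 3 - 364563173779 * t ^ 4 + 353504395539 * t ^ 5
     + 100621371036 * t ^ 6 + 14639637108 * t ^ 7 + 1357232985 * t ^ 8 + 82116623 * t ^ 9
     + 2086442 * t ^ 10 - 122370 * t ^ 11 - 3157 * t ^ 12 + 5 * t ^ 13))"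

definition p62 :: "real \<Rightarrow> real" where
  "p62 t =
     -2 * (-11 + t) * (21975348926173 + 17708836243740 * t + 5088010797018 * t ^ 2
     + 344542288492 * t ^ 3 - 123507628749 * t ^ 4 - 33841275336 * t ^ 5
     - 4705962132 * t ^ 6 - 534799944 * t ^ 7 - 46784493 * t ^ 8 - 3924308 * t ^ 9
     - 371622 * t ^ 10 - 4644 * t ^ 11 + 61 * t ^ 12)"

definition p71 :: "real \<Rightarrow> real" where
  "p71 t =
     (-11 + t) ^ 5 * (13 + t) * (-339168361039365519460069487
     - 673770165671451476923579920 * t - 624601585018296333977402028 * t ^ 2
     - 361544324905454191834056976 * t ^ 3 - 147614051919387405233687790 * t ^ 4
     - 45526903723214507531501616 * t ^ 5 - 11086126516765664128988252 * t ^ 6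
     - 2197894018386795481276848 * t ^ 7 - 362820760120106657958897 * t ^ 8
     - 50767332334243984565152 * t ^ 9 - 6127600928703138323160 * t ^ 10
     - 650077861901582788512 * t ^ 11 - 61158225664029403460 * t ^ 12
     - 5020585598717657952 * t ^ 13 - 364251213557808792 * t ^ 14
     - 29139030508404832 * t ^ 15 - 3029017347965889 * t ^ 16 - 254576059234128 * t ^ 17
     - 7598948126588 * t ^ 18 + 550936914864 * t ^ 19 + 31892020818 * t ^ 20
     - 830153584 * t ^ 21 + 4681716 * t ^ 22 - 6384 * t ^ 23 + t ^ 24)"

definition p72 :: "real \<Rightarrow> real" where
  "p72 t =
     4 * (-11 + t) ^ 4 * (13 + t) * (23939066421797920012252547
     + 43604945745949888884259555 * t + 36595686922095182565230747 * t ^ 2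
     + 18937189808814759845550851 * t ^ 3 + 6829585752660013948505437 * t ^ 4
     + 1838774116182807709355117 * t ^ 5 + 385867254213289689843597 * t ^ 6
     + 64938062296917527124693 * t ^ 7 + 8939182382326190698494 * t ^ 8
     + 1017640859072593780990 * t ^ 9 + 95200006411552224398 * t ^ 10
     + 7145677316358425566 * t ^ 11 + 448416529340354362 * t ^ 12
     + 29699683025185562 * t ^ 13 + 1131537557463418 * t ^ 14 - 300028277805366 * t ^ 15
     - 48306393782385 * t ^ 16 + 333976819119 * t ^ 17 + 484360416551 * t ^ 18
     + 17604770671 * t ^ 19 - 1059177895 * t ^ 20 + 10971881 * t ^ 21 - 30551 * t ^ 22
     + 17 * t ^ 23)"

definition zol_Z :: "real \<Rightarrow> real poly" where
  "zol_Z t = smult (1 / zol_q t)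
    [: p01 t + zol_omega t * p02 t,
       - sqrt (p11 t + zol_omega t * p12 t),
       p21 t + zol_omega t * p22 t,
       sqrt (p31 t + zol_omega t * p32 t),
       p41 t + zol_omega t * p42 t,
       - sqrt (p51 t + zol_omega t * p52 t),
       p61 t + zol_omega t * p62 t,
       sqrt (p71 t + zol_omega t * p72 t) :]"

definition zol_b :: "nat \<Rightarrow> real \<Rightarrow> real" where
  "zol_b k t = coeff (zol_Z t) k"

definition zol_s :: "real \<Rightarrow> real" where
  "zol_s t = - zol_b 6 t / (7 * zol_b 7 t)"

text \<open>
  In Isabelle/HOL, \<open>sqrt\<close> of a negative number is negative and division by zero gives zero, so
  that the expression for \<open>zol_Z t\<close> is meaningful has to be said explicitly.
\<close>

definition zol_well_defined :: "real \<Rightarrow> bool" where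
  "zol_well_defined t \<longleftrightarrow>
     0 \<le> 3 * (506 + 75 * t - t ^ 3) \<and>
     zol_q t \<noteq> 0 \<and>
     0 \<le> p11 t + zol_omega t * p12 t \<and>
     0 \<le> p31 t + zol_omega t * p32 t \<and>
     0 \<le> p51 t + zol_omega t * p52 t \<and>
     0 \<le> p71 t + zol_omega t * p72 t"

end

theory Submission
  imports Defs
begin

text \<open>
  With \<open>t = - 13 - 12 u\<close> and \<open>\<omega> = 36 y\<close> the parameter curve becomes
  \<open>y\<^sup>2 = 4 + 12 u + 13 u\<^sup>2 + 4 u\<^sup>3\<close>, the interval \<open>I\<^sub>7\<close> becomes \<open>0 < u < 2 cos (2 \<pi> / 7)\<close>, and \<open>Z = Z\<^sub>t\<close>
  satisfies \<open>Z + 1 = b (x\<^sup>2 - 1) (x - \<alpha>) F\<^sup>2\<close> and \<open>Z - 1 = b (x - \<beta>) G\<^sup>2\<close> with \<open>1 < \<alpha> < \<beta>\<close> and monic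
  \<open>F, G\<close> of degrees 2 and 3; these are identities in \<open>\<int>[u, y]\<close> once odd coefficients are divided by a
  common square root.  They give \<open>\<bar>Z\<bar> \<le> 1\<close> on \<open>[-1, 1]\<close>.  Comparing the two factorizations of \<open>Z'\<close>
  shows that the roots of \<open>G\<close> interlace those of \<open>F\<close> in \<open>(-1, 1)\<close>, so \<open>Z\<close> alternates at seven points and
  is optimal.  The numbers \<open>\<alpha>\<close> and \<open>\<beta>\<close> are determined by \<open>Z\<close>, hence by \<open>s(t)\<close>, and
  \<open>\<alpha> / (\<beta> - \<alpha>)\<close> decreases in \<open>u\<close>; so \<open>s\<close> is injective, and the limits at the endpoints make it a
  bijection.  At \<open>\<theta>\<close> one has \<open>\<alpha> = 1\<close>, and \<open>Z + 1\<close> becomes the factorization of \<open>T\<^sub>7 + 1\<close>.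
\<close>

subsection \<open>Computing in \<open>\<int>[u, y]\<close> modulo \<open>y\<^sup>2 = 4 + 12 u + 13 u\<^sup>2 + 4 u\<^sup>3\<close>\<close>

text \<open>The square roots in the formula come from a scaling. The numbers \<alpha>, \<beta> and
  the coefficients of F and G lie in Z[u, y] only after multiplication by powers of sqrt D, and in Z
  it is the odd coefficients that keep an odd power of sqrt D. Squaring removes it, which is why
  they are given as roots of polynomials in t and \<omega>. It also loses a sign, so the signs of
  N1, N3, N5, N7 need certificates of their own. The squared coefficients have degree up to 30 in t,
  so the identities are not left to rewriting of real terms: elements of Z[u, y] are pairs of
  integer lists, and an identity is a finite check on lists.

  All sign conditions but one hold on (0, 5/4], slightly more than the parameter range, where crude
  rounding suffices. The exception is \<alpha> > 1, which becomes an equality at the end of the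
  range and is decided by an exact norm. Seven alternation points are enough because two
  coefficients of each competitor are prescribed, so the difference of two competitors has degree at
  most 5.\<close>

primrec peval :: "int list \<Rightarrow> real \<Rightarrow> real" where
  "peval [] x = 0"
| "peval (c # cs) x = of_int c + x * peval cs x"

fun padd :: "int list \<Rightarrow> int list \<Rightarrow> int list" where
  "padd [] ys = ys"
| "padd xs [] = xs"
| "padd (x # xs) (y # ys) = (x + y) # padd xs ys"

primrec pmul :: "int list \<Rightarrow> int list \<Rightarrow> int list" where
  "pmul [] ys = []"
| "pmul (x # xs) ys = padd (map ((*) x) ys) (0 # pmul xs ys)"

primrec pcomp :: "int list \<Rightarrow> int list \<Rightarrow> int list" where
  "pcomp [] q = []"
| "pcomp (c # cs) q = padd [c] (pmul q (pcomp cs q))"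

lemma peval_padd [simp]: "peval (padd xs ys) u = peval xs u + peval ys u"
  by (induction xs ys rule: padd.induct) (auto simp: algebra_simps)

lemma peval_scale [simp]: "peval (map ((*) c) xs) u = of_int c * peval xs u"
  by (induction xs) (auto simp: algebra_simps)

lemma peval_pmul [simp]: "peval (pmul xs ys) u = peval xs u * peval ys u"
  by (induction xs) (auto simp: algebra_simps)

lemma peval_pcomp [simp]: "peval (pcomp xs ys) u = peval xs (peval ys u)"
  by (induction xs) (auto simp: algebra_simps)

lemma peval_zero: "list_all (\<lambda>c. c = 0) cs \<Longrightarrow> peval cs u = 0"
  by (induction cs) auto

definition ysq :: "int list" where "ysq = [4, 12, 13, 4]"

datatype ell = Ell (ell_a: "int list") (ell_b: "int list")

text \<open>Lists may carry trailing zeros, so \<open>ell\<close> is no ring: \<open>e - e\<close>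
  is in general different from \<open>0\<close>. The ring laws hold only after \<open>ev\<close>,
  and equality is tested through \<open>ell_zero\<close> of a difference.\<close>

instantiation ell :: "{plus, times, uminus, minus, zero, one}"
begin

definition "0 = Ell [] []"
definition "1 = Ell [1] []"
definition "e + f = Ell (padd (ell_a e) (ell_a f)) (padd (ell_b e) (ell_b f))"
definition "- e = Ell (map ((*) (-1)) (ell_a e)) (map ((*) (-1)) (ell_b e))"
definition "e - f = e + - (f :: ell)"
definition "e * f =
  Ell (padd (pmul (ell_a e) (ell_a f)) (pmul ysq (pmul (ell_b e) (ell_b f))))
      (padd (pmul (ell_a e) (ell_b f)) (pmul (ell_b e) (ell_a f)))"

instance ..

end

instance ell :: power ..

definition ell_zero :: "ell \<Rightarrow> bool" where
  "ell_zero e \<longleftrightarrow> list_all (\<lambda>c. c = 0) (ell_a e) \<and> list_all (\<lambda>c. c = 0) (ell_b e)"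

definition yval :: "real \<Rightarrow> real" where
  "yval u = sqrt (4 + 12 * u + 13 * u\<^sup>2 + 4 * u ^ 3)"

definition ev :: "ell \<Rightarrow> real \<Rightarrow> real" where
  "ev e u = peval (ell_a e) u + peval (ell_b e) u * yval u"

lemma yval_sq: "0 \<le> u \<Longrightarrow> yval u * yval u = peval ysq u"
  by (simp add: yval_def ysq_def algebra_simps power2_eq_square power3_eq_cube)

lemma ev_add [simp]: "ev (e + f) u = ev e u + ev f u"
  by (simp add: ev_def plus_ell_def algebra_simps)

lemma ev_neg [simp]: "ev (- e) u = - ev e u"
  by (simp add: ev_def uminus_ell_def algebra_simps)

lemma ev_diff [simp]: "ev (e - f) u = ev e u - ev f u"
  by (simp add: minus_ell_def)

lemma ev_mult [simp]: "0 \<le> u \<Longrightarrow> ev (e * f) u = ev e u * ev f u"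
proof -
  assume "0 \<le> u"
  then show ?thesis
    by (simp add: ev_def times_ell_def yval_sq[symmetric] algebra_simps)
qed

lemma ev_one [simp]: "ev 1 u = 1"
  by (simp add: ev_def one_ell_def)

lemma ev_power [simp]: "0 \<le> u \<Longrightarrow> ev (e ^ n) u = ev e u ^ n"
  by (induction n) auto

lemma ev_eqI: "ell_zero (e - f) \<Longrightarrow> ev e u = ev f u"
  using ev_diff[of e f u] by (simp add: ell_zero_def ev_def peval_zero)

definition ell_const :: "int \<Rightarrow> ell" where
  "ell_const c = Ell [c] []"

lemma ev_const [simp]: "ev (ell_const c) u = of_int c"
  by (simp add: ev_def ell_const_def)

text \<open>
  In the notation of the introduction, \<open>\<alpha> = W / \<surd>D\<close>, \<open>\<beta> = H / \<surd>D\<close>, \<open>F = x\<^sup>2 - (A / \<surd>D) x + B / D\<close>, and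
  \<open>G = x\<^sup>3 + (G2 / \<surd>D) x\<^sup>2 + (G1 / D) x + G0 / \<surd>D\<^sup>3\<close>.  The coefficient of \<open>x\<^sup>k\<close> in \<open>M Z\<close> is \<open>P\<^sub>k\<close> for even \<open>k\<close>,
  \<open>N\<^sub>k \<surd>D / u\<^sup>2\<close> for \<open>k = 1, 3\<close>, and \<open>N\<^sub>k \<surd>D\<close> for \<open>k = 5, 7\<close>.
\<close>

definition eW :: ell where
  "eW = Ell
    [4, 14, 16, 4, -1]
    [2, 4, 2]"

definition eD :: ell where
  "eD = Ell
    [0, 64, 352, 800, 952, 620, 212, 32, 1]
    [0, 32, 128, 192, 132, 40, 4]"

definition eA :: ell where
  "eA = Ell
    [0, -2, -7, -6, -2]
    [0, -1]"

definition eB :: ell where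
  "eB = Ell
    [0, -16, -80, -164, -172, -92, -19, 2, 1]
    [0, -8, -28, -36, -22, -5]"

definition eN7 :: ell where
  "eN7 = Ell
    [1024, 9216, 36864, 86144, 129920, 131776, 90768, 41792, 12268, 2074, 159, 2]
    [512, 3840, 12416, 22656, 25600, 18432, 8344, 2236, 304, 13]"

definition eN5 :: ell where
  "eN5 = Ell
    [-2048, -18304, -72640, -167872, -249088, -246784, -164496, -72384, -19888, -2958, -121, 18]
    [-1024, -7616, -24384, -44128, -49568, -35432, -15680, -3856, -352, 21]"

definition eN3 :: ell where
  "eN3 = Ell
    [-1280, -13440, -62848, -171872, -302992, -357280, -281984, -143168, -40752, -2368, 2460,
      814, 69, -10]
    [640, 5760, 23680, 58448, 95424, 107200, 83712, 44656, 15224, 2668, -16, -65]"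

definition eN1 :: ell where
  "eN1 = Ell
    [1280, 13440, 63872, 180960, 338768, 439008, 401152, 258176, 114480, 32960, 5160, 70, -107,
      -10]
    [-640, -5760, -23168, -54672, -83456, -85728, -59744, -27656, -7888, -1048, 64, 31]"

definition eP0 :: ell where
  "eP0 = Ell
    [512, 5888, 30976, 98496, 210560, 318528, 349776, 281712, 166256, 70880, 20960, 3812, 212,
      -84, -23, -2]
    [0, -128, -1216, -5184, -13088, -21936, -26032, -22672, -14528, -6560, -1868, -240, 18, 7]"

definition eP2 :: ell where
  "eP2 = Ell
    [-5120, -58112, -300288, -932032, -1928064, -2783296, -2842000, -2016448, -919072, -187600,
      57616, 56220, 18240, 2660, 65, -18]
    [-2048, -19840, -85568, -215616, -348832, -370992, -246752, -75616, 25024, 37960, 17604,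
      3772, 210, -33]"

definition eP4 :: ell where
  "eP4 = Ell
    [12288, 140288, 729088, 2275328, 4730112, 6852352, 6994624, 4905936, 2122736, 288576,
      -275744, -206372, -67580, -11340, -749, 10]
    [6144, 60928, 270080, 703616, 1188288, 1345120, 1003280, 438128, 43968, -70480, -45604,
      -12648, -1530, -35]"

definition eP6 :: ell where
  "eP6 = Ell
    [-8192, -94208, -493568, -1554432, -3266048, -4793088, -4975488, -3576704, -1623360,
      -284496, 163376, 140196, 48616, 8764, 707, 10]
    [-4096, -40960, -183296, -482816, -826368, -952192, -730496, -339840, -54464, 39080, 29868,
      9116, 1302, 61]"

definition eG2 :: ell where
  "eG2 = Ell
    [0, 2, 7, 8, 3]
    [0, 1]"

definition eG1 :: ell where
  "eG1 = Ell
    [0, -48, -256, -556, -612, -340, -76, 4, 3]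
    [0, -24, -92, -128, -76, -16]"

definition eG0 :: ell where
  "eG0 = Ell
    [0, 0, -128, -960, -3168, -5984, -7072, -5388, -2632, -786, -123, -4, 1]
    [0, 0, -64, -384, -976, -1352, -1100, -532, -144, -17]"

definition eU :: ell where "eU = Ell [0, 1] []"
text \<open>This is 512 (1 + u)^12, the denominator q of Z up to a numerical factor.\<close>

definition eM :: ell where "eM = Ell [512, 6144, 33792, 112640, 253440, 405504, 473088, 405504, 253440, 112640, 33792, 6144, 512] []"
text \<open>The added term is 2 u^3 (u + 2). It makes \<alpha> < \<beta> immediate and is the
  denominator in the ratio \<alpha> / (\<beta> - \<alpha>).\<close>

definition eH :: ell where "eH = eW + Ell [0, 0, 0, 4, 2] []"

text \<open>
  \<open>L\<^sub>k\<close> and \<open>R\<^sub>k\<close> are the coefficients of \<open>(X - W) (X\<^sup>2 - D) (X\<^sup>2 - A X + B)\<^sup>2\<close> and of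
  \<open>(X - H) (X\<^sup>3 + G2 X\<^sup>2 + G1 X + G0)\<^sup>2\<close>, where \<open>X = \<surd>D x\<close>.
\<close>

definition eL0 :: ell where
  "eL0 = eW * (eD * (eB * eB))"

definition eL1 :: ell where
  "eL1 = - (eD * (eB * eB)) - (eA * eB + eA * eB) * (eW * eD)"

definition eL2 :: ell where
  "eL2 = (eA * eB + eA * eB) * eD + eW * eD * (eA * eA + (eB + eB)) - eW * (eB * eB)"

definition eL3 :: ell where
  "eL3 = eB * eB + (eA * eB + eA * eB) * eW - eD * (eA * eA + (eB + eB)) - (eA + eA) * (eW * eD)"

definition eL4 :: ell where
  "eL4 = eD * (eA + eA) + eW * eD - (eA * eB + eA * eB) - eW * (eA * eA + (eB + eB))"

definition eL5 :: ell where
  "eL5 = eA * eA + (eB + eB) + (eA + eA) * eW - eD"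

definition eL6 :: ell where
  "eL6 = - (eA + eA) - eW"

definition eR0 :: ell where
  "eR0 = - (eH * (eG0 * eG0))"

definition eR1 :: ell where
  "eR1 = eG0 * eG0 - eH * (eG1 * eG0 + eG1 * eG0)"

definition eR2 :: ell where
  "eR2 = (eG1 * eG0 + eG1 * eG0) - eH * (eG1 * eG1 + (eG2 * eG0 + eG2 * eG0))"

definition eR3 :: ell where
  "eR3 = eG1 * eG1 + (eG2 * eG0 + eG2 * eG0) - eH * ((eG0 + eG0) + (eG2 * eG1 + eG2 * eG1))"

definition eR4 :: ell where
  "eR4 = (eG0 + eG0) + (eG2 * eG1 + eG2 * eG1) - eH * (eG2 * eG2 + (eG1 + eG1))"

definition eR5 :: ell where
  "eR5 = eG2 * eG2 + (eG1 + eG1) - eH * (eG2 + eG2)"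

definition eR6 :: ell where
  "eR6 = (eG2 + eG2) - eH"

section \<open>The identities behind the two factorizations\<close>

lemma LR1: "ell_zero (eL1 - eR1)"
  by code_simp

lemma LR2: "ell_zero (eL2 - eR2)"
  by code_simp

lemma LR3: "ell_zero (eL3 - eR3)"
  by code_simp

lemma LR4: "ell_zero (eL4 - eR4)"
  by code_simp

lemma LR5: "ell_zero (eL5 - eR5)"
  by code_simp

lemma LR6: "ell_zero (eL6 - eR6)"
  by code_simp

text \<open>By \<open>LR1\<close> to \<open>LR6\<close> the two products differ only in the constant
  term. Multiplied by the leading coefficient of Z, that difference has to be (Z + 1) - (Z - 1) = 2;
  clearing denominators produces M + M and the power of D.\<close>

lemma LR0: "ell_zero (eN7 * (eL0 - eR0) - (eM + eM) * eD ^ 3)"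
  by code_simp

text \<open>The identities \<open>PL6\<close> to \<open>PL0\<close> compare the coefficients of M (Z
  + 1) with those of the product. Returning from X to x costs powers of D, the convention for N1 and
  N3 costs u^2, and the 1 in Z + 1 turns P0 into P0 + M.\<close>

lemma PL6: "ell_zero (eP6 - eN7 * eL6)"
  by code_simp

lemma PL5: "ell_zero (eN5 * eD - eN7 * eL5)"
  by code_simp

lemma PL4: "ell_zero (eP4 * eD - eN7 * eL4)"
  by code_simp

lemma PL3: "ell_zero (eN3 * eD ^ 2 - eN7 * eL3 * eU ^ 2)"
  by code_simp

lemma PL2: "ell_zero (eP2 * eD ^ 2 - eN7 * eL2)"
  by code_simp

lemma PL1: "ell_zero (eN1 * eD ^ 3 - eN7 * eL1 * eU ^ 2)"
  by code_simp

lemma PL0: "ell_zero ((eP0 + eM) * eD ^ 3 - eN7 * eL0)"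
  by code_simp

section \<open>The given coefficient polynomials as integer lists\<close>

primrec pwsum :: "nat \<Rightarrow> int list \<Rightarrow> real \<Rightarrow> real" where
  "pwsum k [] x = 0"
| "pwsum k (c # cs) x = of_int c * x ^ k + pwsum (k + 1) cs x"

lemma pwsum_eq: "pwsum k cs x = x ^ k * peval cs x"
  by (induction cs arbitrary: k) (auto simp: algebra_simps)

text \<open>Unfolding \<open>pwsum\<close> yields the very sum of monomials in which the
  coefficients are defined, so the large polynomials are matched term by term and never put into a
  normal form. For this the Horner equations of \<open>peval\<close> are switched off below.\<close>

lemma peval_pwsum: "peval cs x = pwsum 0 cs x"
  by (simp add: pwsum_eq)

definition cp01 :: "int list" where
  "cp01 =
    [-18763256064938069, -14792872686537861, -4057867882494249, -256473877330753,
      85285038707343, 17823637386255, 692357704507, -127085232717, -14780540079, -560972063,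
      -31101579, -2597811, 82613, -1323, 57, 1]"

lemma p01_eq: "p01 t = peval cp01 t"
  by (simp add: p01_def cp01_def peval_pwsum del: peval.simps One_nat_def)

definition cp02 :: "int list" where
  "cp02 =
    pmul [13, 1] (pmul [-11, 1] (pmul [-2] ([-1674587596733, -1209041071723, -302152954691,
      -21722362269, 3705247230, 789592530, 56234874, 3485670, 365007, 23113, 953, 7])))"

lemma p02_eq: "p02 t = peval cp02 t"
proof -
  have inner: "      -1674587596733 - 1209041071723 * t - 302152954691 * t ^ 2 - 21722362269 * t ^ 3 +
        3705247230 * t ^ 4 + 789592530 * t ^ 5 + 56234874 * t ^ 6 + 3485670 * t ^ 7 + 365007 * t
        ^ 8 + 23113 * t ^ 9 + 953 * t ^ 10 + 7 * t ^ 11 =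
      peval
        [-1674587596733, -1209041071723, -302152954691, -21722362269, 3705247230, 789592530,
          56234874, 3485670, 365007, 23113, 953, 7] t"
    by (simp add: peval_pwsum del: peval.simps One_nat_def)
  \<comment> \<open>The large factor is abstracted to X, so that \<open>algebra_simps\<close> sees
    only the small prefactors.\<close>
  have pre: "-2 * (-11 + t) * (13 + t) * X = peval [13, 1] t * (peval [-11, 1] t * (peval [-2] t * (X)))" for X
    by (simp add: eval_nat_numeral algebra_simps)
  show ?thesis
    unfolding p02_def inner cp02_def peval_pmul by (rule pre)
qed

definition cp11 :: "int list" where
  "cp11 =
    pmul [13, 1] (pmul [-11, 1] (pmul [-11, 1] ([452216947186296794781508787221,
      777864295951362656514677949267, 607534824156974545331687561835,
      288634496196055112144179788837, 94921610624381795338201698150,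
      23398676158988289024635179242, 4516301732554082896075701906, 670693737388662494219775918,
      65114539902315732706516167, 225857740971173605970001, -1430942150712305946880479,
      -342406310658223828546833, -50591510405201802666684, -5031713916356520207588,
      -245445214348728475284, 18666155444026029204, 5518191822155449683, 667345379819561157,
      56579749561878525, 3879945477820083, 222845520949494, 10128182363994, 372786923490,
      14225061342, 269308977, 2533431, 12183, 25])))"

lemma p11_eq: "p11 t = peval cp11 t"
proof -
  have inner: "      452216947186296794781508787221 + 777864295951362656514677949267 * t +
        607534824156974545331687561835 * t ^ 2 + 288634496196055112144179788837 * t ^ 3 +
        94921610624381795338201698150 * t ^ 4 + 23398676158988289024635179242 * t ^ 5 +
        4516301732554082896075701906 * t ^ 6 + 670693737388662494219775918 * t ^ 7 +
        65114539902315732706516167 * t ^ 8 + 225857740971173605970001 * t ^ 9 -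
        1430942150712305946880479 * t ^ 10 - 342406310658223828546833 * t ^ 11 -
        50591510405201802666684 * t ^ 12 - 5031713916356520207588 * t ^ 13 -
        245445214348728475284 * t ^ 14 + 18666155444026029204 * t ^ 15 + 5518191822155449683 * t
        ^ 16 + 667345379819561157 * t ^ 17 + 56579749561878525 * t ^ 18 + 3879945477820083 * t ^
        19 + 222845520949494 * t ^ 20 + 10128182363994 * t ^ 21 + 372786923490 * t ^ 22 +
        14225061342 * t ^ 23 + 269308977 * t ^ 24 + 2533431 * t ^ 25 + 12183 * t ^ 26 + 25 * t ^
        27 =
      peval
        [452216947186296794781508787221, 777864295951362656514677949267,
          607534824156974545331687561835, 288634496196055112144179788837,
          94921610624381795338201698150, 23398676158988289024635179242,
          4516301732554082896075701906, 670693737388662494219775918, 65114539902315732706516167,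
          225857740971173605970001, -1430942150712305946880479, -342406310658223828546833,
          -50591510405201802666684, -5031713916356520207588, -245445214348728475284,
          18666155444026029204, 5518191822155449683, 667345379819561157, 56579749561878525,
          3879945477820083, 222845520949494, 10128182363994, 372786923490, 14225061342,
          269308977, 2533431, 12183, 25] t"
    by (simp add: peval_pwsum del: peval.simps One_nat_def)
  have pre: "(-11 + t) ^ 2 * (13 + t) * X = peval [13, 1] t * (peval [-11, 1] t * (peval [-11, 1] t * (X)))" for X
    by (simp add: eval_nat_numeral algebra_simps)
  show ?thesis
    unfolding p11_def inner cp11_def peval_pmul by (rule pre)
qed

definition cp12 :: "int list" where
  "cp12 =
    pmul [13, 1] (pmul [-11, 1] (pmul [-4] ([31914659841429719306288181169,
      49622272083198674583533509976, 34282407163818360892131872011,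
      14089140494250744184954719632, 3939130934203140296373699118, 816295770208132930522370528,
      128243247492098759194165618, 13314328240910465891671856, 128141672346772035888475,
      -286794878594776251702280, -69849141585341704716287, -10401588386734438049632,
      -1051853965102136706572, -44866622100154016896, 7156442882520008620, 1751453046589473632,
      198334297114129879, 15312353847501512, 913407761253853, 43228054413008, 1867714065406,
      77464313504, 424793026, 97097840, 2479357, 20456, 55])))"

lemma p12_eq: "p12 t = peval cp12 t"
proof -
  have inner: "      31914659841429719306288181169 + 49622272083198674583533509976 * t +
        34282407163818360892131872011 * t ^ 2 + 14089140494250744184954719632 * t ^ 3 +
        3939130934203140296373699118 * t ^ 4 + 816295770208132930522370528 * t ^ 5 +
        128243247492098759194165618 * t ^ 6 + 13314328240910465891671856 * t ^ 7 +
        128141672346772035888475 * t ^ 8 - 286794878594776251702280 * t ^ 9 -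
        69849141585341704716287 * t ^ 10 - 10401588386734438049632 * t ^ 11 -
        1051853965102136706572 * t ^ 12 - 44866622100154016896 * t ^ 13 + 7156442882520008620 *
        t ^ 14 + 1751453046589473632 * t ^ 15 + 198334297114129879 * t ^ 16 + 15312353847501512
        * t ^ 17 + 913407761253853 * t ^ 18 + 43228054413008 * t ^ 19 + 1867714065406 * t ^ 20 +
        77464313504 * t ^ 21 + 424793026 * t ^ 22 + 97097840 * t ^ 23 + 2479357 * t ^ 24 + 20456
        * t ^ 25 + 55 * t ^ 26 =
      peval
        [31914659841429719306288181169, 49622272083198674583533509976,
          34282407163818360892131872011, 14089140494250744184954719632,
          3939130934203140296373699118, 816295770208132930522370528,
          128243247492098759194165618, 13314328240910465891671856, 128141672346772035888475,
          -286794878594776251702280, -69849141585341704716287, -10401588386734438049632,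
          -1051853965102136706572, -44866622100154016896, 7156442882520008620,
          1751453046589473632, 198334297114129879, 15312353847501512, 913407761253853,
          43228054413008, 1867714065406, 77464313504, 424793026, 97097840, 2479357, 20456, 55] t"
    by (simp add: peval_pwsum del: peval.simps One_nat_def)
  have pre: "-4 * (-11 + t) * (13 + t) * X = peval [13, 1] t * (peval [-11, 1] t * (peval [-4] t * (X)))" for X
    by (simp add: eval_nat_numeral algebra_simps)
  show ?thesis
    unfolding p12_def inner cp12_def peval_pmul by (rule pre)
qed

definition cp21 :: "int list" where
  "cp21 =
    pmul [3] ([18693496205907553, 14653197505814513, 3981810914612581, 239053845556285,
      -102939835099507, -25328343306323, -1853461246959, 107242836249, 29544857619, 2472362275,
      146645759, 4570855, -537665, 13055, 715, 3])"

lemma p21_eq: "p21 t = peval cp21 t"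
proof -
  have inner: "      18693496205907553 + 14653197505814513 * t + 3981810914612581 * t ^ 2 + 239053845556285 * t
        ^ 3 - 102939835099507 * t ^ 4 - 25328343306323 * t ^ 5 - 1853461246959 * t ^ 6 +
        107242836249 * t ^ 7 + 29544857619 * t ^ 8 + 2472362275 * t ^ 9 + 146645759 * t ^ 10 +
        4570855 * t ^ 11 - 537665 * t ^ 12 + 13055 * t ^ 13 + 715 * t ^ 14 + 3 * t ^ 15 =
      peval
        [18693496205907553, 14653197505814513, 3981810914612581, 239053845556285,
          -102939835099507, -25328343306323, -1853461246959, 107242836249, 29544857619,
          2472362275, 146645759, 4570855, -537665, 13055, 715, 3] t"
    by (simp add: peval_pwsum del: peval.simps One_nat_def)
  have pre: "3 * X = peval [3] t * (X)" for X
    by (simp add: eval_nat_numeral algebra_simps)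
  show ?thesis
    unfolding p21_def inner cp21_def peval_pmul by (rule pre)
qed

definition cp22 :: "int list" where
  "cp22 =
    pmul [-11, 1] (pmul [6] ([-21838212747157, -17497718905404, -5120760089418, -504642284812,
      58729363461, 20582639496, 2601849972, 260190216, 24607269, 1916084, 126006, 2820, 11]))"

lemma p22_eq: "p22 t = peval cp22 t"
proof -
  have inner: "      -21838212747157 - 17497718905404 * t - 5120760089418 * t ^ 2 - 504642284812 * t ^ 3 +
        58729363461 * t ^ 4 + 20582639496 * t ^ 5 + 2601849972 * t ^ 6 + 260190216 * t ^ 7 +
        24607269 * t ^ 8 + 1916084 * t ^ 9 + 126006 * t ^ 10 + 2820 * t ^ 11 + 11 * t ^ 12 =
      peval
        [-21838212747157, -17497718905404, -5120760089418, -504642284812, 58729363461,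
          20582639496, 2601849972, 260190216, 24607269, 1916084, 126006, 2820, 11] t"
    by (simp add: peval_pwsum del: peval.simps One_nat_def)
  have pre: "6 * (-11 + t) * X = peval [-11, 1] t * (peval [6] t * (X))" for X
    by (simp add: eval_nat_numeral algebra_simps)
  show ?thesis
    unfolding p22_def inner cp22_def peval_pmul by (rule pre)
qed

definition cp31 :: "int list" where
  "cp31 =
    pmul [13, 1] (pmul [-11, 1] (pmul [-11, 1] ([4067505216555761454939774893653,
      6987837642353627260453914645459, 5438613582037781367520396463019,
      2560707467679066258265342737957, 824972899826967571738685701350,
      195202779101501586572821066218, 35131305236199004729935240210,
      4678831943670682549788428718, 361836187431226939045737351, -20164101539468052079040559,
      -13174289998662412173304863, -2713002595179009782526225, -370593851448133729776060,
      -34447522144717830870756, -1447965995249043223956, 171750733434992851092,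
      44014595143625089299, 5235351517006620741, 455693290860748989, 34604751969519795,
      2164988949830262, 86364631885914, 2806443018594, 191205136350, 833140593, -18388809,
      -108585, 25])))"

lemma p31_eq: "p31 t = peval cp31 t"
proof -
  have inner: "      4067505216555761454939774893653 + 6987837642353627260453914645459 * t +
        5438613582037781367520396463019 * t ^ 2 + 2560707467679066258265342737957 * t ^ 3 +
        824972899826967571738685701350 * t ^ 4 + 195202779101501586572821066218 * t ^ 5 +
        35131305236199004729935240210 * t ^ 6 + 4678831943670682549788428718 * t ^ 7 +
        361836187431226939045737351 * t ^ 8 - 20164101539468052079040559 * t ^ 9 -
        13174289998662412173304863 * t ^ 10 - 2713002595179009782526225 * t ^ 11 -
        370593851448133729776060 * t ^ 12 - 34447522144717830870756 * t ^ 13 -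
        1447965995249043223956 * t ^ 14 + 171750733434992851092 * t ^ 15 + 44014595143625089299
        * t ^ 16 + 5235351517006620741 * t ^ 17 + 455693290860748989 * t ^ 18 +
        34604751969519795 * t ^ 19 + 2164988949830262 * t ^ 20 + 86364631885914 * t ^ 21 +
        2806443018594 * t ^ 22 + 191205136350 * t ^ 23 + 833140593 * t ^ 24 - 18388809 * t ^ 25
        - 108585 * t ^ 26 + 25 * t ^ 27 =
      peval
        [4067505216555761454939774893653, 6987837642353627260453914645459,
          5438613582037781367520396463019, 2560707467679066258265342737957,
          824972899826967571738685701350, 195202779101501586572821066218,
          35131305236199004729935240210, 4678831943670682549788428718,
          361836187431226939045737351, -20164101539468052079040559, -13174289998662412173304863,
          -2713002595179009782526225, -370593851448133729776060, -34447522144717830870756,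
          -1447965995249043223956, 171750733434992851092, 44014595143625089299,
          5235351517006620741, 455693290860748989, 34604751969519795, 2164988949830262,
          86364631885914, 2806443018594, 191205136350, 833140593, -18388809, -108585, 25] t"
    by (simp add: peval_pwsum del: peval.simps One_nat_def)
  have pre: "(-11 + t) ^ 2 * (13 + t) * X = peval [13, 1] t * (peval [-11, 1] t * (peval [-11, 1] t * (X)))" for X
    by (simp add: eval_nat_numeral algebra_simps)
  show ?thesis
    unfolding p31_def inner cp31_def peval_pmul by (rule pre)
qed

definition cp32 :: "int list" where
  "cp32 =
    pmul [13, 1] (pmul [-11, 1] (pmul [4] ([-287083238187382918159834379953,
      -445801161270188409230824278008, -306728192538886372185457889323,
      -124540340456986580024209236752, -33754019007714977189198810542,
      -6551380444197468706377349664, -918445270855125642258035890, -75504009528614463821485232,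
      3790216746747400729507877, 2726753925037134860883880, 554883207716411782569503,
      72654419716931233973344, 6402816324184929410828, 222919538823946521856,
      -45365822597641351468, -11428229964701074016, -1568015533264197079, -148747442138288168,
      -8894717908807357, -336458623759952, -23802738217342, -1386825048800, 41898906878,
      -3064255472, -52362109, -143240, 425])))"

lemma p32_eq: "p32 t = peval cp32 t"
proof -
  have inner: "      -287083238187382918159834379953 - 445801161270188409230824278008 * t -
        306728192538886372185457889323 * t ^ 2 - 124540340456986580024209236752 * t ^ 3 -
        33754019007714977189198810542 * t ^ 4 - 6551380444197468706377349664 * t ^ 5 -
        918445270855125642258035890 * t ^ 6 - 75504009528614463821485232 * t ^ 7 +
        3790216746747400729507877 * t ^ 8 + 2726753925037134860883880 * t ^ 9 +
        554883207716411782569503 * t ^ 10 + 72654419716931233973344 * t ^ 11 +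
        6402816324184929410828 * t ^ 12 + 222919538823946521856 * t ^ 13 - 45365822597641351468
        * t ^ 14 - 11428229964701074016 * t ^ 15 - 1568015533264197079 * t ^ 16 -
        148747442138288168 * t ^ 17 - 8894717908807357 * t ^ 18 - 336458623759952 * t ^ 19 -
        23802738217342 * t ^ 20 - 1386825048800 * t ^ 21 + 41898906878 * t ^ 22 - 3064255472 * t
        ^ 23 - 52362109 * t ^ 24 - 143240 * t ^ 25 + 425 * t ^ 26 =
      peval
        [-287083238187382918159834379953, -445801161270188409230824278008,
          -306728192538886372185457889323, -124540340456986580024209236752,
          -33754019007714977189198810542, -6551380444197468706377349664,
          -918445270855125642258035890, -75504009528614463821485232, 3790216746747400729507877,
          2726753925037134860883880, 554883207716411782569503, 72654419716931233973344,
          6402816324184929410828, 222919538823946521856, -45365822597641351468,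
          -11428229964701074016, -1568015533264197079, -148747442138288168, -8894717908807357,
          -336458623759952, -23802738217342, -1386825048800, 41898906878, -3064255472,
          -52362109, -143240, 425] t"
    by (simp add: peval_pwsum del: peval.simps One_nat_def)
  have pre: "4 * (-11 + t) * (13 + t) * X = peval [13, 1] t * (peval [-11, 1] t * (peval [4] t * (X)))" for X
    by (simp add: eval_nat_numeral algebra_simps)
  show ?thesis
    unfolding p32_def inner cp32_def peval_pmul by (rule pre)
qed

definition cp41 :: "int list" where
  "cp41 =
    [-55871225142758423, -43540681750709607, -11717614079999475, -665505935839675,
      361155464423541, 98101500744117, 8901143308057, -283763308671, -131298459093,
      -12236812901, -634905225, 4984959, 5484599, -90153, -5469, -5]"

lemma p41_eq: "p41 t = peval cp41 t"
  by (simp add: p41_def cp41_def peval_pwsum del: peval.simps One_nat_def)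

definition cp42 :: "int list" where
  "cp42 =
    pmul [-11, 1] (pmul [2] ([65720348410115, 52809871430820, 15313261582566, 1273925478740,
      -273249867411, -81619243704, -10990866156, -1213822008, -112375539, -9007084, -714138,
      -12060, 35]))"

lemma p42_eq: "p42 t = peval cp42 t"
proof -
  have inner: "      65720348410115 + 52809871430820 * t + 15313261582566 * t ^ 2 + 1273925478740 * t ^ 3 -
        273249867411 * t ^ 4 - 81619243704 * t ^ 5 - 10990866156 * t ^ 6 - 1213822008 * t ^ 7 -
        112375539 * t ^ 8 - 9007084 * t ^ 9 - 714138 * t ^ 10 - 12060 * t ^ 11 + 35 * t ^ 12 =
      peval
        [65720348410115, 52809871430820, 15313261582566, 1273925478740, -273249867411,
          -81619243704, -10990866156, -1213822008, -112375539, -9007084, -714138, -12060, 35] t"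
    by (simp add: peval_pwsum del: peval.simps One_nat_def)
  have pre: "2 * (-11 + t) * X = peval [-11, 1] t * (peval [2] t * (X))" for X
    by (simp add: eval_nat_numeral algebra_simps)
  show ?thesis
    unfolding p42_def inner cp42_def peval_pmul by (rule pre)
qed

definition cp51 :: "int list" where
  "cp51 =
    pmul [13, 1] (pmul [-11, 1] (pmul [-11, 1] (pmul [9] ([451683738573925104075654483397,
      775028304316495850519095857571, 601098380398696980859206188475,
      280438400343985227860396599637, 88413801617548106639965501190,
      19995978992632195901029965642, 3311133099437108231552511346, 381643355735517005395779022,
      20320264324033151140865367, -3195804458535397562311231, -1143533730000698431197679,
      -199161415603964037521793, -24372543185825459073788, -2046716710595960850596,
      -54372780278781597012, 15828476336106803540, 2730101569863744803, 213625544957043957,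
      16273483271374381, 2177665019822083, 170504391614358, 1407379805882, -64033877566,
      34948495614, -280552415, -2994617, -3033, 9]))))"

lemma p51_eq: "p51 t = peval cp51 t"
proof -
  have inner: "      451683738573925104075654483397 + 775028304316495850519095857571 * t +
        601098380398696980859206188475 * t ^ 2 + 280438400343985227860396599637 * t ^ 3 +
        88413801617548106639965501190 * t ^ 4 + 19995978992632195901029965642 * t ^ 5 +
        3311133099437108231552511346 * t ^ 6 + 381643355735517005395779022 * t ^ 7 +
        20320264324033151140865367 * t ^ 8 - 3195804458535397562311231 * t ^ 9 -
        1143533730000698431197679 * t ^ 10 - 199161415603964037521793 * t ^ 11 -
        24372543185825459073788 * t ^ 12 - 2046716710595960850596 * t ^ 13 -
        54372780278781597012 * t ^ 14 + 15828476336106803540 * t ^ 15 + 2730101569863744803 * t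
        ^ 16 + 213625544957043957 * t ^ 17 + 16273483271374381 * t ^ 18 + 2177665019822083 * t ^
        19 + 170504391614358 * t ^ 20 + 1407379805882 * t ^ 21 - 64033877566 * t ^ 22 +
        34948495614 * t ^ 23 - 280552415 * t ^ 24 - 2994617 * t ^ 25 - 3033 * t ^ 26 + 9 * t ^
        27 =
      peval
        [451683738573925104075654483397, 775028304316495850519095857571,
          601098380398696980859206188475, 280438400343985227860396599637,
          88413801617548106639965501190, 19995978992632195901029965642,
          3311133099437108231552511346, 381643355735517005395779022, 20320264324033151140865367,
          -3195804458535397562311231, -1143533730000698431197679, -199161415603964037521793,
          -24372543185825459073788, -2046716710595960850596, -54372780278781597012,
          15828476336106803540, 2730101569863744803, 213625544957043957, 16273483271374381,
          2177665019822083, 170504391614358, 1407379805882, -64033877566, 34948495614,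
          -280552415, -2994617, -3033, 9] t"
    by (simp add: peval_pwsum del: peval.simps One_nat_def)
  have pre: "9 * (-11 + t) ^ 2 * (13 + t) * X = peval [13, 1] t * (peval [-11, 1] t * (peval [-11, 1] t * (peval [9] t * (X))))" for X
    by (simp add: eval_nat_numeral algebra_simps)
  show ?thesis
    unfolding p51_def inner cp51_def peval_pmul by (rule pre)
qed

definition cp52 :: "int list" where
  "cp52 =
    pmul [13, 1] (pmul [-11, 1] (pmul [36] ([-31880883382920453164668056673,
      -49442138480111650024519040920, -33876857431725516714538231899,
      -13586828819760368667536109968, -3564076460496389044892230862,
      -641364123356694605499355488, -76820427126193234239727954, -4024537857983776624054576,
      721610167022215867925013, 250695526123771611854152, 42150204570837646184719,
      4607435727083778525024, 285829921804590641228, -1218353702615312512, -2310870292391561964,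
      -479326657450856288, -99660901007536295, -11197664464328328, -270797298387469,
      23020663051568, -2954480013726, -221351668256, 23088702814, -709577328, -2352877, 17624,
      57])))"

lemma p52_eq: "p52 t = peval cp52 t"
proof -
  have inner: "      -31880883382920453164668056673 - 49442138480111650024519040920 * t -
        33876857431725516714538231899 * t ^ 2 - 13586828819760368667536109968 * t ^ 3 -
        3564076460496389044892230862 * t ^ 4 - 641364123356694605499355488 * t ^ 5 -
        76820427126193234239727954 * t ^ 6 - 4024537857983776624054576 * t ^ 7 +
        721610167022215867925013 * t ^ 8 + 250695526123771611854152 * t ^ 9 +
        42150204570837646184719 * t ^ 10 + 4607435727083778525024 * t ^ 11 +
        285829921804590641228 * t ^ 12 - 1218353702615312512 * t ^ 13 - 2310870292391561964 * t
        ^ 14 - 479326657450856288 * t ^ 15 - 99660901007536295 * t ^ 16 - 11197664464328328 * t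
        ^ 17 - 270797298387469 * t ^ 18 + 23020663051568 * t ^ 19 - 2954480013726 * t ^ 20 -
        221351668256 * t ^ 21 + 23088702814 * t ^ 22 - 709577328 * t ^ 23 - 2352877 * t ^ 24 +
        17624 * t ^ 25 + 57 * t ^ 26 =
      peval
        [-31880883382920453164668056673, -49442138480111650024519040920,
          -33876857431725516714538231899, -13586828819760368667536109968,
          -3564076460496389044892230862, -641364123356694605499355488,
          -76820427126193234239727954, -4024537857983776624054576, 721610167022215867925013,
          250695526123771611854152, 42150204570837646184719, 4607435727083778525024,
          285829921804590641228, -1218353702615312512, -2310870292391561964,
          -479326657450856288, -99660901007536295, -11197664464328328, -270797298387469,
          23020663051568, -2954480013726, -221351668256, 23088702814, -709577328, -2352877,
          17624, 57] t"
    by (simp add: peval_pwsum del: peval.simps One_nat_def)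
  have pre: "36 * (-11 + t) * (13 + t) * X = peval [13, 1] t * (peval [-11, 1] t * (peval [36] t * (X)))" for X
    by (simp add: eval_nat_numeral algebra_simps)
  show ?thesis
    unfolding p52_def inner cp52_def peval_pmul by (rule pre)
qed

definition cp61 :: "int list" where
  "cp61 =
    pmul [-11, 1] (pmul [-11, 1] (pmul [-1] ([-153338781731665, -146672852170183,
      -57053827731174, -10853963116498, -364563173779, 353504395539, 100621371036, 14639637108,
      1357232985, 82116623, 2086442, -122370, -3157, 5])))"

lemma p61_eq: "p61 t = peval cp61 t"
proof -
  have inner: "      -153338781731665 - 146672852170183 * t - 57053827731174 * t ^ 2 - 10853963116498 * t ^ 3 -
        364563173779 * t ^ 4 + 353504395539 * t ^ 5 + 100621371036 * t ^ 6 + 14639637108 * t ^ 7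
        + 1357232985 * t ^ 8 + 82116623 * t ^ 9 + 2086442 * t ^ 10 - 122370 * t ^ 11 - 3157 * t
        ^ 12 + 5 * t ^ 13 =
      peval
        [-153338781731665, -146672852170183, -57053827731174, -10853963116498, -364563173779,
          353504395539, 100621371036, 14639637108, 1357232985, 82116623, 2086442, -122370,
          -3157, 5] t"
    by (simp add: peval_pwsum del: peval.simps One_nat_def)
  have pre: "- ((-11 + t) ^ 2 * X) = peval [-11, 1] t * (peval [-11, 1] t * (peval [-1] t * (X)))" for X
    by (simp add: eval_nat_numeral algebra_simps)
  show ?thesis
    unfolding p61_def inner cp61_def peval_pmul by (rule pre)
qed

definition cp62 :: "int list" where
  "cp62 =
    pmul [-11, 1] (pmul [-2] ([21975348926173, 17708836243740, 5088010797018, 344542288492,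
      -123507628749, -33841275336, -4705962132, -534799944, -46784493, -3924308, -371622, -4644,
      61]))"

lemma p62_eq: "p62 t = peval cp62 t"
proof -
  have inner: "      21975348926173 + 17708836243740 * t + 5088010797018 * t ^ 2 + 344542288492 * t ^ 3 -
        123507628749 * t ^ 4 - 33841275336 * t ^ 5 - 4705962132 * t ^ 6 - 534799944 * t ^ 7 -
        46784493 * t ^ 8 - 3924308 * t ^ 9 - 371622 * t ^ 10 - 4644 * t ^ 11 + 61 * t ^ 12 =
      peval
        [21975348926173, 17708836243740, 5088010797018, 344542288492, -123507628749,
          -33841275336, -4705962132, -534799944, -46784493, -3924308, -371622, -4644, 61] t"
    by (simp add: peval_pwsum del: peval.simps One_nat_def)
  have pre: "-2 * (-11 + t) * X = peval [-11, 1] t * (peval [-2] t * (X))" for X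
    by (simp add: eval_nat_numeral algebra_simps)
  show ?thesis
    unfolding p62_def inner cp62_def peval_pmul by (rule pre)
qed

definition cp71 :: "int list" where
  "cp71 =
    pmul [13, 1] (pmul [-11, 1] (pmul [-11, 1] (pmul [-11, 1] (pmul [-11, 1] (pmul [-11, 1]
      ([-339168361039365519460069487, -673770165671451476923579920,
      -624601585018296333977402028, -361544324905454191834056976, -147614051919387405233687790,
      -45526903723214507531501616, -11086126516765664128988252, -2197894018386795481276848,
      -362820760120106657958897, -50767332334243984565152, -6127600928703138323160,
      -650077861901582788512, -61158225664029403460, -5020585598717657952, -364251213557808792,
      -29139030508404832, -3029017347965889, -254576059234128, -7598948126588, 550936914864,
      31892020818, -830153584, 4681716, -6384, 1]))))))"

lemma p71_eq: "p71 t = peval cp71 t"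
proof -
  have inner: "      -339168361039365519460069487 - 673770165671451476923579920 * t -
        624601585018296333977402028 * t ^ 2 - 361544324905454191834056976 * t ^ 3 -
        147614051919387405233687790 * t ^ 4 - 45526903723214507531501616 * t ^ 5 -
        11086126516765664128988252 * t ^ 6 - 2197894018386795481276848 * t ^ 7 -
        362820760120106657958897 * t ^ 8 - 50767332334243984565152 * t ^ 9 -
        6127600928703138323160 * t ^ 10 - 650077861901582788512 * t ^ 11 - 61158225664029403460
        * t ^ 12 - 5020585598717657952 * t ^ 13 - 364251213557808792 * t ^ 14 -
        29139030508404832 * t ^ 15 - 3029017347965889 * t ^ 16 - 254576059234128 * t ^ 17 -
        7598948126588 * t ^ 18 + 550936914864 * t ^ 19 + 31892020818 * t ^ 20 - 830153584 * t ^
        21 + 4681716 * t ^ 22 - 6384 * t ^ 23 + t ^ 24 =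
      peval
        [-339168361039365519460069487, -673770165671451476923579920,
          -624601585018296333977402028, -361544324905454191834056976,
          -147614051919387405233687790, -45526903723214507531501616,
          -11086126516765664128988252, -2197894018386795481276848, -362820760120106657958897,
          -50767332334243984565152, -6127600928703138323160, -650077861901582788512,
          -61158225664029403460, -5020585598717657952, -364251213557808792, -29139030508404832,
          -3029017347965889, -254576059234128, -7598948126588, 550936914864, 31892020818,
          -830153584, 4681716, -6384, 1] t"
    by (simp add: peval_pwsum del: peval.simps One_nat_def)
  have pre: "(-11 + t) ^ 5 * (13 + t) * X = peval [13, 1] t * (peval [-11, 1] t * (peval [-11, 1] t * (peval [-11, 1] t * (peval [-11, 1] t * (peval [-11, 1] t * (X))))))" for X
    by (simp add: eval_nat_numeral algebra_simps)
  show ?thesis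
    unfolding p71_def inner cp71_def peval_pmul by (rule pre)
qed

definition cp72 :: "int list" where
  "cp72 =
    pmul [13, 1] (pmul [-11, 1] (pmul [-11, 1] (pmul [-11, 1] (pmul [-11, 1] (pmul [4]
      ([23939066421797920012252547, 43604945745949888884259555, 36595686922095182565230747,
      18937189808814759845550851, 6829585752660013948505437, 1838774116182807709355117,
      385867254213289689843597, 64938062296917527124693, 8939182382326190698494,
      1017640859072593780990, 95200006411552224398, 7145677316358425566, 448416529340354362,
      29699683025185562, 1131537557463418, -300028277805366, -48306393782385, 333976819119,
      484360416551, 17604770671, -1059177895, 10971881, -30551, 17]))))))"

lemma p72_eq: "p72 t = peval cp72 t"
proof -
  have inner: "      23939066421797920012252547 + 43604945745949888884259555 * t + 36595686922095182565230747 *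
        t ^ 2 + 18937189808814759845550851 * t ^ 3 + 6829585752660013948505437 * t ^ 4 +
        1838774116182807709355117 * t ^ 5 + 385867254213289689843597 * t ^ 6 +
        64938062296917527124693 * t ^ 7 + 8939182382326190698494 * t ^ 8 +
        1017640859072593780990 * t ^ 9 + 95200006411552224398 * t ^ 10 + 7145677316358425566 * t
        ^ 11 + 448416529340354362 * t ^ 12 + 29699683025185562 * t ^ 13 + 1131537557463418 * t ^
        14 - 300028277805366 * t ^ 15 - 48306393782385 * t ^ 16 + 333976819119 * t ^ 17 +
        484360416551 * t ^ 18 + 17604770671 * t ^ 19 - 1059177895 * t ^ 20 + 10971881 * t ^ 21 -
        30551 * t ^ 22 + 17 * t ^ 23 =
      peval
        [23939066421797920012252547, 43604945745949888884259555, 36595686922095182565230747,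
          18937189808814759845550851, 6829585752660013948505437, 1838774116182807709355117,
          385867254213289689843597, 64938062296917527124693, 8939182382326190698494,
          1017640859072593780990, 95200006411552224398, 7145677316358425566, 448416529340354362,
          29699683025185562, 1131537557463418, -300028277805366, -48306393782385, 333976819119,
          484360416551, 17604770671, -1059177895, 10971881, -30551, 17] t"
    by (simp add: peval_pwsum del: peval.simps One_nat_def)
  have pre: "4 * (-11 + t) ^ 4 * (13 + t) * X = peval [13, 1] t * (peval [-11, 1] t * (peval [-11, 1] t * (peval [-11, 1] t * (peval [-11, 1] t * (peval [4] t * (X))))))" for X
    by (simp add: eval_nat_numeral algebra_simps)
  show ?thesis
    unfolding p72_def inner cp72_def peval_pmul by (rule pre)
qed

section \<open>The substitution t = -13 - 12 u\<close>

definition tsub :: "int list" where "tsub = [-13, -12]"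

definition pell :: "int list \<Rightarrow> int list \<Rightarrow> ell" where
  "pell c d = Ell (pcomp c tsub) (map ((*) 36) (pcomp d tsub))"

lemma ev_pell: "ev (pell c d) u = peval c (-13 - 12 * u) + 36 * yval u * peval d (-13 - 12 * u)"
  by (simp add: ev_def pell_def tsub_def algebra_simps)

text \<open>The constant is 2^29 3^15, the quotient q / M: since 1 + t = -12 (1 + u), the factor
  2^14 3^3 of q is joined by 12^12, and M absorbs 512.\<close>

lemma pP0: "ell_zero (pell cp01 cp02 - ell_const 7703510787293184 * eP0)"
  by code_simp

lemma pP2: "ell_zero (pell cp21 cp22 - ell_const 7703510787293184 * eP2)"
  by code_simp

lemma pP4: "ell_zero (pell cp41 cp42 - ell_const 7703510787293184 * eP4)"
  by code_simp

lemma pP6: "ell_zero (pell cp61 cp62 - ell_const 7703510787293184 * eP6)"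
  by code_simp

text \<open>Odd coefficients can be compared only after squaring, which leaves a single factor D.
  For N1 and N3 the denominator u^2 is squared too; it is written \<open>(eU ^ 2) ^ 2\<close> to fit
  the shape p k^2 of \<open>sqrt_odd\<close>.\<close>

lemma pN1: "ell_zero (pell cp11 cp12 * (eU ^ 2) ^ 2 - ell_const 7703510787293184 ^ 2 * (eN1 ^ 2 * eD))"
  by code_simp

lemma pN3: "ell_zero (pell cp31 cp32 * (eU ^ 2) ^ 2 - ell_const 7703510787293184 ^ 2 * (eN3 ^ 2 * eD))"
  by code_simp

lemma pN5: "ell_zero (pell cp51 cp52 - ell_const 7703510787293184 ^ 2 * (eN5 ^ 2 * eD))"
  by code_simp

lemma pN7: "ell_zero (pell cp71 cp72 - ell_const 7703510787293184 ^ 2 * (eN7 ^ 2 * eD))"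
  by code_simp
subsection \<open>Alternation and optimality\<close>

text \<open>Lagrange interpolation at the n + 1 nodes expresses the coefficient of degree n, which
  is 0, as the sum of \<open>poly d (x i) / w i\<close>. The weights \<open>w i\<close> alternate in
  sign as the values do, so all summands have one sign and each must vanish. Since only weak
  inequalities are assumed, counting sign changes would have to deal with multiple zeros; the
  weighted sum does not.\<close>

lemma alternation_imp_zero:
  fixes d :: "real poly" and x :: "nat \<Rightarrow> real"
  assumes deg: "degree d < n"
    and mono: "\<And>i j. i < j \<Longrightarrow> j \<le> n \<Longrightarrow> x i < x j"
    and alt: "\<And>i. i \<le> n \<Longrightarrow> 0 \<le> (-1) ^ i * poly d (x i)"
  shows "d = 0"
proof -
  define w where "w i = (\<Prod>j\<in>{..n}-{i}. x i - x j)" for i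
  define l where "l i = (\<Prod>j\<in>{..n}-{i}. [:- x j, 1:])" for i
  define c where "c i = poly d (x i) / w i" for i
  define L where "L = (\<Sum>i\<le>n. smult (c i) (l i))"
  have inj: "inj_on x {..n}"
    by (rule inj_onI) (metis atMost_iff less_irrefl linorder_neqE_nat mono)
  have deg_l: "degree (l i) = n" "lead_coeff (l i) = 1" if "i \<le> n" for i
  proof -
    have "degree (l i) = (\<Sum>j\<in>{..n}-{i}. degree [:- x j, 1:])"
      unfolding l_def by (rule degree_prod_eq_sum_degree) auto
    then show "degree (l i) = n" using that by simp
    show "lead_coeff (l i) = 1" unfolding l_def by (simp add: lead_coeff_prod)
  qed
  have w_sign: "0 < (-1) ^ (n - i) * w i" if "i \<le> n" for i
  proof -
    have split: "{..n} - {i} = {..<i} \<union> {i<..n}" using that by auto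
    have "w i = (\<Prod>j\<in>{..<i}. x i - x j) * (\<Prod>j\<in>{i<..n}. x i - x j)"
      unfolding w_def split by (rule prod.union_disjoint) auto
    also have "(\<Prod>j\<in>{i<..n}. x i - x j) = (\<Prod>j\<in>{i<..n}. (-1) * (x j - x i))"
      by (rule prod.cong) auto
    also have "\<dots> = (-1) ^ (n - i) * (\<Prod>j\<in>{i<..n}. x j - x i)"
      by (subst prod.distrib) simp
    finally have "(-1) ^ (n - i) * w i
        = ((-1) ^ (n - i) * (-1) ^ (n - i)) * ((\<Prod>j\<in>{..<i}. x i - x j) * (\<Prod>j\<in>{i<..n}. x j - x i))"
      by simp
    also have "((-1) ^ (n - i) * (-1) ^ (n - i) :: real) = 1"
      by (simp flip: power_mult_distrib)
    also have "0 < 1 * ((\<Prod>j\<in>{..<i}. x i - x j) * (\<Prod>j\<in>{i<..n}. x j - x i))"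
      using mono that by (auto intro!: mult_pos_pos prod_pos)
    finally show ?thesis .
  qed
  have w_nz: "w i \<noteq> 0" if "i \<le> n" for i
    using w_sign[OF that] by (intro notI) simp
  have eval: "poly (l k) (x i) = (if k = i then w i else 0)" if "i \<le> n" "k \<le> n" for i k
    using that by (auto simp: l_def w_def poly_prod intro!: prod.cong)
  have L_eval: "poly L (x i) = poly d (x i)" if "i \<le> n" for i
  proof -
    have "poly L (x i) = (\<Sum>k\<le>n. if k = i then c k * w i else 0)"
      unfolding L_def poly_sum poly_smult by (rule sum.cong) (auto simp: eval that)
    also have "\<dots> = c i * w i" using that by simp
    also have "\<dots> = poly d (x i)" using w_sign[OF that] by (auto simp: c_def)
    finally show ?thesis .
  qed
  have deg_L: "degree L \<le> n"
    unfolding L_def by (rule degree_sum_le) (auto intro: order_trans[OF degree_smult_le] simp: deg_l)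
  have few_roots: "p = 0" if "degree p \<le> n" "\<And>i. i \<le> n \<Longrightarrow> poly p (x i) = 0" for p :: "real poly"
  proof (rule ccontr)
    assume "p \<noteq> 0"
    have "card (x ` {..n}) \<le> card {r. poly p r = 0}"
      using that(2) by (intro card_mono poly_roots_finite \<open>p \<noteq> 0\<close>) auto
    also have "\<dots> \<le> n" using card_poly_roots_bound[OF \<open>p \<noteq> 0\<close>] that(1) by linarith
    finally show False by (simp add: card_image[OF inj])
  qed
  have "d - L = 0"
    using L_eval deg_L deg by (intro few_roots order_trans[OF degree_diff_le_max]) auto
  then have "d = L" by simp
  moreover have "coeff d n = 0" using deg by (rule coeff_eq_0)
  ultimately have "0 = coeff L n" by simp
  also have "\<dots> = (\<Sum>i\<le>n. c i)"
    unfolding L_def coeff_sum coeff_smult by (rule sum.cong) (use deg_l in auto)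
  finally have "(\<Sum>i\<le>n. (-1) ^ n * c i) = 0" by (simp flip: sum_distrib_left)
  moreover have "0 \<le> (-1) ^ n * c i" if "i \<le> n" for i
  proof -
    have "(-1) ^ n * c i = ((-1) ^ i * poly d (x i)) / ((-1) ^ (n - i) * w i)"
    proof -
      have "(-1 :: real) ^ n = (-1) ^ i * (-1) ^ (n - i)"
        using that by (simp flip: power_add)
      moreover have "(-1 :: real) ^ (n - i) = 1 / (-1) ^ (n - i)"
        by (simp add: power_one_over[symmetric])
      ultimately have "(-1) ^ n * c i = ((-1) ^ i * (1 / (-1) ^ (n - i))) * (poly d (x i) / w i)"
        unfolding c_def by metis
      then show ?thesis by simp
    qed
    then show ?thesis using alt[OF that] w_sign[OF that] by simp
  qed
  ultimately have "(-1) ^ n * c i = 0" if "i \<le> n" for i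
    using that by (subst (asm) sum_nonneg_eq_0_iff) auto
  then have "poly d (x i) = 0" if "i \<le> n" for i
    using that w_nz[OF that] by (auto simp: c_def)
  then show ?thesis using deg by (intro few_roots) auto
qed

section \<open>The uniform norm and the class of competitors\<close>

lemma bdd_above_abs_poly: "bdd_above ((\<lambda>x. \<bar>poly P x\<bar>) ` {-1..1::real})"
  by (intro bounded_imp_bdd_above compact_imp_bounded compact_continuous_image continuous_intros) auto

lemma abs_poly_le_unorm: "x \<in> {-1..1} \<Longrightarrow> \<bar>poly P x\<bar> \<le> unorm P"
  unfolding unorm_def by (rule cSUP_upper[OF _ bdd_above_abs_poly])

lemma unorm_le: "(\<And>x. x \<in> {-1..1} \<Longrightarrow> \<bar>poly P x\<bar> \<le> E) \<Longrightarrow> unorm P \<le> E"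
  unfolding unorm_def by (rule cSUP_least) auto

lemma coeff_sum_monom: "coeff (\<Sum>i\<le>n. monom (a i) i) k = (if k \<le> n then a k else 0)"
  by (simp add: coeff_sum if_distrib cong: if_cong)

lemma zol_class_iff:
  "P \<in> zol_class s \<longleftrightarrow> degree P \<le> 7 \<and> coeff P 7 = 1 \<and> coeff P 6 = - 7 * s"
proof
  assume "P \<in> zol_class s"
  then obtain a where P: "P = monom 1 7 - monom (7 * s) 6 + (\<Sum>k\<le>5. monom (a k) k)"
    by (auto simp: zol_class_def)
  have "coeff P k = 0" if "k > 7" for k
    using that by (simp add: P coeff_sum_monom)
  then have "degree P \<le> 7" by (intro degree_le) auto
  then show "degree P \<le> 7 \<and> coeff P 7 = 1 \<and> coeff P 6 = - 7 * s"
    by (simp add: P coeff_sum_monom)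
next
  assume asm: "degree P \<le> 7 \<and> coeff P 7 = 1 \<and> coeff P 6 = - 7 * s"
  have "coeff P k = coeff (monom 1 7 - monom (7 * s) 6 + (\<Sum>k\<le>5. monom (coeff P k) k)) k" for k
  proof -
    consider "k \<le> 5" | "k = 6" | "k = 7" | "k > 7" by linarith
    then show ?thesis
      using asm by cases (auto simp: coeff_sum_monom coeff_eq_0)
  qed
  then have "P = monom 1 7 - monom (7 * s) 6 + (\<Sum>k\<le>5. monom (coeff P k) k)"
    by (rule poly_eqI)
  then show "P \<in> zol_class s" unfolding zol_class_def by blast
qed

text \<open>Everything follows from one claim: a competitor of norm at most E equals P. It has two
  prescribed coefficients in common with P, so the difference has degree below 6, and at the seven
  points its sign is forced to alternate weakly.\<close>

lemma alternation_optimal: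
  assumes P: "P \<in> zol_class s"
    and bound: "\<And>x. x \<in> {-1..1} \<Longrightarrow> \<bar>poly P x\<bar> \<le> E"
    and mono: "\<And>i j. i < j \<Longrightarrow> j \<le> 6 \<Longrightarrow> x i < x j"
    and x: "\<And>i. i \<le> 6 \<Longrightarrow> x i \<in> {-1..1}"
    and alt: "\<And>i. i \<le> 6 \<Longrightarrow> poly P (x i) = - ((-1) ^ i) * E"
  shows "zol_min s = E" "monic_zol s = P"
proof -
  have unique: "Q = P" if Q: "Q \<in> zol_class s" and le: "unorm Q \<le> E" for Q
  proof -
    have "degree (Q - P) < 6"
    proof -
      have "coeff (Q - P) k = 0" if "k \<ge> 6" for k
      proof -
        from that consider "k = 6" | "k = 7" | "k > 7" by linarith
        then show ?thesis using P Q by cases (auto simp: zol_class_iff coeff_eq_0)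
      qed
      then have "degree (Q - P) \<le> 5" by (intro degree_le) auto
      then show ?thesis by simp
    qed
    moreover have "0 \<le> (-1) ^ i * poly (Q - P) (x i)" if "i \<le> 6" for i
    proof -
      have "\<bar>poly Q (x i)\<bar> \<le> E"
        using abs_poly_le_unorm[OF x[OF that], of Q] le by linarith
      then show ?thesis
        by (cases "even i") (auto simp: alt[OF that])
    qed
    ultimately have "Q - P = 0" by (intro alternation_imp_zero[of _ 6 x] mono)
    then show ?thesis by simp
  qed
  have unorm_P: "unorm P = E"
  proof (rule antisym)
    show "unorm P \<le> E" using bound by (rule unorm_le)
    have "\<bar>poly P (x 0)\<bar> \<le> E" using x[of 0] by (intro bound) auto
    then have "0 \<le> E" by linarith
    then show "E \<le> unorm P" using abs_poly_le_unorm[OF x[of 0], of P] alt[of 0] by simp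
  qed
  have lower: "E \<le> unorm Q" if "Q \<in> zol_class s" for Q
    using unique[OF that] unorm_P by (cases "unorm Q \<le> E") auto
  have "zol_min s = unorm P"
    unfolding zol_min_def
    by (rule cInf_eq_minimum) (use P lower unorm_P in auto)
  then show "zol_min s = E" by (simp add: unorm_P)
  show "monic_zol s = P"
    unfolding monic_zol_def
  proof (rule the_equality)
    show "is_arg_min unorm (\<lambda>P. P \<in> zol_class s) P"
      using P lower unorm_P by (auto simp: is_arg_min_def not_less)
    show "Q = P" if "is_arg_min unorm (\<lambda>P. P \<in> zol_class s) Q" for Q
      using that P unorm_P by (intro unique) (auto simp: is_arg_min_def not_less)
  qed
qed

subsection \<open>Polynomials of Zolotarev type\<close>

text \<open>Both Z + 1 and Z - 1 have this form, so F and G each divide the derivative of Z, with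
  explicit cofactors.\<close>

lemma pderiv_smult_mult_square:
  fixes f q :: "real poly"
  shows "pderiv (smult b (q * f ^ 2)) = f * smult b (pderiv q * f + smult 2 (q * pderiv f))"
  by (simp add: poly_eq_poly_eq_iff[symmetric] fun_eq_iff power2_eq_square pderiv_smult pderiv_mult
      algebra_simps)

text \<open>The three sign conditions place the roots of F on either side of 0 inside (-1, 1). The
  position of the roots of G is deduced from them.\<close>

locale zolotarev_poly =
  fixes Z F G :: "real poly" and b \<alpha> \<beta> f0 f1 g0 g1 g2 :: real
  assumes b: "0 < b" and \<alpha>: "1 < \<alpha>" and \<alpha>\<beta>: "\<alpha> < \<beta>"
    and F: "F = [:f0, f1, 1:]" and G: "G = [:g0, g1, g2, 1:]"
    and plus: "Z + 1 = smult b ([:-1, 0, 1:] * [:- \<alpha>, 1:] * F ^ 2)"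
    and minus: "Z - 1 = smult b ([:- \<beta>, 1:] * G ^ 2)"
    and F_0: "poly F 0 < 0" and F_1: "0 < poly F 1" and F_m1: "0 < poly F (-1)"
begin

lemma Z_plus: "poly Z x + 1 = b * ((x\<^sup>2 - 1) * (x - \<alpha>) * (poly F x)\<^sup>2)"
  using arg_cong[OF plus, of "\<lambda>p. poly p x"] by (simp add: power2_eq_square algebra_simps)

lemma Z_minus: "poly Z x - 1 = b * ((x - \<beta>) * (poly G x)\<^sup>2)"
  using arg_cong[OF minus, of "\<lambda>p. poly p x"] by (simp add: power2_eq_square algebra_simps)

lemma Z_bound: "x \<in> {-1..1} \<Longrightarrow> \<bar>poly Z x\<bar> \<le> 1"
proof -
  assume x: "x \<in> {-1..1}"
  then have "x\<^sup>2 \<le> 1" by (auto simp: abs_square_le_1)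
  then have "0 \<le> (x\<^sup>2 - 1) * (x - \<alpha>)"
    using \<alpha> x by (intro mult_nonpos_nonpos) auto
  then have "0 \<le> poly Z x + 1" unfolding Z_plus using b by simp
  moreover have "(x - \<beta>) * (poly G x)\<^sup>2 \<le> 0"
    using \<alpha> \<alpha>\<beta> x by (intro mult_nonpos_nonneg) auto
  then have "poly Z x - 1 \<le> 0" unfolding Z_minus using b by (simp add: mult_nonneg_nonpos)
  ultimately show ?thesis by linarith
qed

lemma F_roots:
  obtains z3 z5 where "-1 < z3" "z3 < z5" "z5 < 1" "F = [:- z3, 1:] * [:- z5, 1:]"
proof -
  obtain z3 where z3: "-1 < z3" "z3 < 0" "poly F z3 = 0"
    using poly_IVT_neg[of "-1" 0 F] F_0 F_m1 by auto
  obtain z5 where z5: "0 < z5" "z5 < 1" "poly F z5 = 0"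
    using poly_IVT_pos[of 0 1 F] F_0 F_1 by auto
  have e: "f0 + z3 * (f1 + z3) = 0" "f0 + z5 * (f1 + z5) = 0"
    using z3 z5 by (simp_all add: F)
  have "(z5 - z3) * (f1 + z3 + z5) = 0" using e by (simp add: algebra_simps)
  then have "f1 = - z3 - z5" using z3 z5 by auto
  moreover from this have "f0 = z3 * z5" using e by (simp add: algebra_simps)
  ultimately have "F = [:- z3, 1:] * [:- z5, 1:]" by (simp add: F)
  moreover have "z3 < z5" using z3 z5 by linarith
  ultimately show ?thesis using that[of z3 z5] z3 z5 by blast
qed

lemma F_pos: "1 \<le> x \<Longrightarrow> 0 < poly F x"
proof (rule F_roots)
  fix z3 z5 assume z: "-1 < z3" "z3 < z5" "z5 < 1" and F: "F = [:- z3, 1:] * [:- z5, 1:]" and "1 \<le> x"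
  then have "0 < (x - z3) * (x - z5)" by simp
  then show ?thesis by (simp add: F algebra_simps)
qed

text \<open>The critical points of \<open>Z\<close> are the roots of \<open>F\<close> and \<open>G\<close> and one more, which Rolle's theorem
  places in \<open>(1, \<alpha>)\<close>.\<close>

lemma pderiv_Z:
  obtains \<gamma> where "1 < \<gamma>" "\<gamma> < \<alpha>" "pderiv Z = smult (7 * b) (F * G * [:- \<gamma>, 1:])"
proof -
  define q where "q = [:-1, 0, 1:] * [:- \<alpha>, 1:]"
  define K where "K = smult b (G + smult 2 ([:- \<beta>, 1:] * pderiv G))"
  have dF: "pderiv Z = F * smult b (pderiv q * F + smult 2 (q * pderiv F))"
  proof -
    have "pderiv Z = pderiv (Z + 1)" by (simp add: pderiv_add)
    also have "\<dots> = F * smult b (pderiv q * F + smult 2 (q * pderiv F))"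
      unfolding plus q_def[symmetric] by (rule pderiv_smult_mult_square)
    finally show ?thesis .
  qed
  have dG: "pderiv Z = G * K"
  proof -
    have "pderiv Z = pderiv (Z - 1)" by (simp add: pderiv_diff)
    also have "\<dots> = G * K"
      unfolding minus pderiv_smult_mult_square K_def by (simp add: pderiv_pCons)
    finally show ?thesis .
  qed
  obtain z3 z5 where z: "z3 < z5" and Fz: "F = [:- z3, 1:] * [:- z5, 1:]"
    by (rule F_roots)
  \<comment> \<open>F and G have no common root, because Z is -1 at roots of F and 1 at roots of G.
    Hence F divides the cofactor K of G, and a degree count leaves one linear factor.\<close>
  have K_root: "poly K z = 0" if "poly F z = 0" for z
  proof -
    have "poly G z \<noteq> 0" using Z_plus[of z] Z_minus[of z] that by auto
    moreover have "poly (G * K) z = 0" unfolding dG[symmetric] dF by (simp add: that)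
    ultimately show ?thesis by simp
  qed
  obtain l' where l': "K = [:- z3, 1:] * l'"
    using K_root[of z3] by (auto simp: Fz poly_eq_0_iff_dvd)
  then have "poly l' z5 = 0" using K_root[of z5] z by (simp add: Fz)
  then obtain l where "l' = [:- z5, 1:] * l" unfolding poly_eq_0_iff_dvd by (elim dvdE)
  then have l: "K = F * l" by (simp only: Fz l' mult.assoc)
  have K: "K = [:b * (g0 - 2 * \<beta> * g1), b * (3 * g1 - 4 * \<beta> * g2), b * (5 * g2 - 6 * \<beta>), 7 * b:]"
    by (simp add: K_def G pderiv_pCons algebra_simps)
  have "K \<noteq> 0" "F \<noteq> 0" using K b F by auto
  then have "l \<noteq> 0" "degree K = degree F + degree l" using l by (auto simp: degree_mult_eq)
  then have "degree l = 1" using K b by (simp add: F)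
  moreover have "lead_coeff K = lead_coeff F * lead_coeff l" by (simp only: l lead_coeff_mult)
  then have "lead_coeff l = 7 * b" using b by (simp add: K F)
  ultimately have l0: "l = [:coeff l 0, 7 * b:]"
    by (intro poly_eqI) (auto simp: coeff_pCons coeff_eq_0 split: nat.split)
  define \<gamma>' where "\<gamma>' = - coeff l 0 / (7 * b)"
  have Z': "pderiv Z = smult (7 * b) (F * G * [:- \<gamma>', 1:])"
  proof -
    have "l = smult (7 * b) [:- \<gamma>', 1:]" using b by (subst l0) (simp add: \<gamma>'_def)
    then have "G * (F * l) = smult (7 * b) (G * (F * [:- \<gamma>', 1:]))"
      by (simp only: mult_smult_right)
    then show ?thesis by (simp only: dG l mult.assoc mult.left_commute[of G F])
  qed
  have "poly Z 1 = poly Z \<alpha>" using Z_plus[of 1] Z_plus[of \<alpha>] by simp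
  then obtain \<gamma> where \<gamma>: "1 < \<gamma>" "\<gamma> < \<alpha>" "poly (pderiv Z) \<gamma> = 0"
    using poly_MVT[OF \<alpha>, of Z] \<alpha> by auto
  \<comment> \<open>The critical point from Rolle's theorem has to be the root of the linear factor:
    Z \<le> -1 there excludes roots of G, and F is positive to the right of 1.\<close>
  have "0 \<le> \<gamma>\<^sup>2 - 1" using \<gamma> by (simp add: one_le_power)
  then have "poly Z \<gamma> + 1 \<le> 0"
    unfolding Z_plus using \<gamma> b by (simp add: mult_nonneg_nonpos mult_nonpos_nonneg)
  then have "poly G \<gamma> \<noteq> 0" using Z_minus[of \<gamma>] by auto
  moreover have "poly F \<gamma> \<noteq> 0" using F_pos[of \<gamma>] \<gamma> by auto
  ultimately have "\<gamma>' = \<gamma>" using \<gamma>(3) b by (simp add: Z')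
  then show ?thesis using that \<gamma> Z' by blast
qed

text \<open>Cancelling F in the two expressions for the derivative gives H = 7 G (x - \<gamma>). On
  [-1, 1] the last factor is negative, so G has the sign opposite to H. The signs of H at -1, z3,
  z5, 1 can be read off from the other factorization; they are +, -, +, -, and G changes sign three
  times.\<close>

lemma alternation_points:
  obtains z2 z3 z4 z5 z6 where
    "-1 < z2" "z2 < z3" "z3 < z4" "z4 < z5" "z5 < z6" "z6 < 1"
    "poly F z3 = 0" "poly F z5 = 0" "poly G z2 = 0" "poly G z4 = 0" "poly G z6 = 0"
proof -
  obtain z3 z5 where z: "-1 < z3" "z3 < z5" "z5 < 1" and Fz: "F = [:- z3, 1:] * [:- z5, 1:]"
    by (rule F_roots)
  obtain \<gamma> where \<gamma>: "1 < \<gamma>" "\<gamma> < \<alpha>" and Z': "pderiv Z = smult (7 * b) (F * G * [:- \<gamma>, 1:])"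
    by (rule pderiv_Z)
  define q where "q = [:-1, 0, 1:] * [:- \<alpha>, 1:]"
  define H where "H = pderiv q * F + smult 2 (q * pderiv F)"
  have "pderiv Z = pderiv (Z + 1)" by (simp add: pderiv_add)
  also have "\<dots> = F * smult b H"
    unfolding plus q_def[symmetric] H_def by (rule pderiv_smult_mult_square)
  finally have "F * smult b H = F * smult (7 * b) (G * [:- \<gamma>, 1:])"
    using Z' by (simp add: algebra_simps)
  moreover have "F \<noteq> 0" by (simp add: F)
  ultimately have "smult b H = smult (7 * b) (G * [:- \<gamma>, 1:])" by (metis mult_left_cancel)
  then have "poly (smult b H) x = poly (smult (7 * b) (G * [:- \<gamma>, 1:])) x" for x by simp
  then have "b * poly H x = b * (7 * poly G x * (x - \<gamma>))" for x
    by (simp add: algebra_simps)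
  then have H_eq: "poly H x = 7 * poly G x * (x - \<gamma>)" for x
    using b by simp
  have H_val: "poly H x = (2 * x * (x - \<alpha>) + (x\<^sup>2 - 1)) * poly F x
      + 2 * ((x\<^sup>2 - 1) * (x - \<alpha>)) * (2 * x - z3 - z5)" for x
    by (simp add: H_def q_def Fz pderiv_mult pderiv_pCons algebra_simps power2_eq_square)
  have neg: "poly G x < 0" if "0 < poly H x" "x \<le> 1" for x
    using that \<gamma> mult_nonneg_nonpos[of "7 * poly G x" "x - \<gamma>"] H_eq[of x] by force
  have pos: "0 < poly G x" if "poly H x < 0" "x \<le> 1" for x
    using that \<gamma> mult_nonpos_nonpos[of "7 * poly G x" "x - \<gamma>"] H_eq[of x] by force
  have Hm1: "0 < poly H (-1)"
    unfolding H_val using F_m1 \<alpha> by simp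
  have H1: "poly H 1 < 0"
    unfolding H_val using F_1 \<alpha> by (simp add: mult_neg_pos)
  have qpos: "0 < (x\<^sup>2 - 1) * (x - \<alpha>)" if "-1 < x" "x < 1" for x
    using that \<alpha> by (intro mult_neg_neg) (auto simp: abs_square_less_1)
  have H3: "poly H z3 < 0"
    unfolding H_val using qpos[of z3] z by (simp add: Fz mult_pos_neg)
  have H5: "0 < poly H z5"
    unfolding H_val using qpos[of z5] z by (simp add: Fz)
  obtain z2 where "-1 < z2" "z2 < z3" "poly G z2 = 0"
    using poly_IVT_pos[of "-1" z3 G] neg[OF Hm1] pos[OF H3] z by auto
  moreover obtain z4 where "z3 < z4" "z4 < z5" "poly G z4 = 0"
    using poly_IVT_neg[of z3 z5 G] neg[OF H5] pos[OF H3] z by auto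
  moreover obtain z6 where "z5 < z6" "z6 < 1" "poly G z6 = 0"
    using poly_IVT_pos[of z5 1 G] neg[OF H5] pos[OF H1] z by auto
  ultimately show ?thesis using that z by (simp add: Fz)
qed

text \<open>The cubic G already has three roots in (-1, 1).\<close>

lemma G_nonzero: "1 \<le> x \<Longrightarrow> poly G x \<noteq> 0"
proof
  assume x: "1 \<le> x" and "poly G x = 0"
  obtain z2 z3 z4 z5 z6 where z: "-1 < z2" "z2 < z3" "z3 < z4" "z4 < z5" "z5 < z6" "z6 < 1"
    "poly F z3 = 0" "poly F z5 = 0" "poly G z2 = 0" "poly G z4 = 0" "poly G z6 = 0"
    by (rule alternation_points)
  have "G \<noteq> 0" by (simp add: G)
  have "card {z2, z4, z6, x} \<le> card {r. poly G r = 0}"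
    using z \<open>poly G x = 0\<close> by (intro card_mono poly_roots_finite \<open>G \<noteq> 0\<close>) auto
  also have "\<dots> \<le> 3" using card_poly_roots_bound[OF \<open>G \<noteq> 0\<close>] by (simp add: G)
  finally show False using z x by simp
qed

text \<open>This and \<open>\<beta>_iff\<close> recover \<alpha> and \<beta> from the values of Z
  alone, which is what injectivity of the parametrization rests on.\<close>

lemma \<alpha>_iff: "1 < x \<Longrightarrow> 0 < poly Z x + 1 \<longleftrightarrow> \<alpha> < x"
proof -
  assume x: "1 < x"
  define c where "c = b * (x\<^sup>2 - 1) * (poly F x)\<^sup>2"
  have "1 < x\<^sup>2" using x by (simp add: one_less_power)
  then have "0 < c" unfolding c_def using b F_pos[of x] x by (intro mult_pos_pos) auto
  moreover have "poly Z x + 1 = c * (x - \<alpha>)" by (simp add: Z_plus c_def)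
  ultimately show ?thesis by (simp add: zero_less_mult_iff)
qed

lemma \<beta>_iff: "1 < x \<Longrightarrow> 0 < poly Z x - 1 \<longleftrightarrow> \<beta> < x"
  unfolding Z_minus using b G_nonzero[of x] by (simp add: zero_less_mult_iff)

lemma degree_Z: "degree Z = 7" and coeff_Z_7: "coeff Z 7 = b"
proof -
  have *: "Z = smult b ([:-1, 0, 1:] * [:- \<alpha>, 1:] * F ^ 2) - 1"
    using plus by (metis add_diff_cancel_right')
  have "F ^ 2 = [:f0 * f0, 2 * f0 * f1, 2 * f0 + f1 * f1, 2 * f1, 1:]"
    by (simp add: F power2_eq_square)
  then have "\<exists>c0 c1 c2 c3 c4 c5 c6. Z = [:c0, c1, c2, c3, c4, c5, c6, b:]"
    unfolding * by (simp add: one_pCons)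
  then obtain c0 c1 c2 c3 c4 c5 c6 where "Z = [:c0, c1, c2, c3, c4, c5, c6, b:]" by blast
  then show "degree Z = 7" "coeff Z 7 = b"
    using b by (simp_all add: eval_nat_numeral)
qed

lemma optimal:
  defines "s \<equiv> - coeff Z 6 / (7 * b)"
  shows "zol_min s = 1 / b" "monic_zol s = smult (1 / b) Z" "normalized_zol s = Z"
proof -
  obtain z2 z3 z4 z5 z6 where z: "-1 < z2" "z2 < z3" "z3 < z4" "z4 < z5" "z5 < z6" "z6 < 1"
    "poly F z3 = 0" "poly F z5 = 0" "poly G z2 = 0" "poly G z4 = 0" "poly G z6 = 0"
    by (rule alternation_points)
  \<comment> \<open>The values of Z here are -1, 1, -1, 1, -1, 1, -1: the endpoints and the roots of
    F give -1, the roots of G give 1.\<close>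
  define xs where "xs = [-1, z2, z3, z4, z5, z6, 1]"
  have Zm: "poly Z x = -1" if "x = 1 \<or> x = -1 \<or> poly F x = 0" for x
    using Z_plus[of x] that by auto
  have Zp: "poly Z x = 1" if "poly G x = 0" for x
    using Z_minus[of x] that by auto
  have i_cases: "i = 0 \<or> i = 1 \<or> i = 2 \<or> i = 3 \<or> i = 4 \<or> i = 5 \<or> i = 6" if "i \<le> 6" for i :: nat
    using that by linarith
  have sorted: "sorted_wrt (<) xs" using z by (auto simp: xs_def)
  have cls: "smult (1 / b) Z \<in> zol_class s"
    using b by (simp add: zol_class_iff degree_Z coeff_Z_7 s_def)
  have bound: "\<bar>poly (smult (1 / b) Z) x\<bar> \<le> 1 / b" if "x \<in> {-1..1}" for x
    using Z_bound[OF that] b by (simp add: abs_mult divide_right_mono)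
  have mono: "xs ! i < xs ! j" if "i < j" "j \<le> 6" for i j
    using sorted_wrt_nth_less[OF sorted that(1)] that by (simp add: xs_def)
  have mem: "xs ! i \<in> {-1..1}" if "i \<le> 6" for i
    using i_cases[OF that] z by (auto simp: xs_def)
  have alt: "poly (smult (1 / b) Z) (xs ! i) = - ((-1) ^ i) * (1 / b)" if "i \<le> 6" for i
    using i_cases[OF that] z by (auto simp: xs_def Zm Zp)
  show "zol_min s = 1 / b" "monic_zol s = smult (1 / b) Z"
    by (rule alternation_optimal[of _ s "1 / b" "\<lambda>i. xs ! i", OF cls bound mono mem alt]; assumption)+
  then show "normalized_zol s = Z" using b by (simp add: normalized_zol_def)
qed

end
subsection \<open>Signs on the parameter interval\<close>

text \<open>A lower bound for the values on \<open>[0, 5/4]\<close>, by Horner evaluation with rounding.\<close>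

primrec plb :: "int list \<Rightarrow> int" where
  "plb [] = 0"
| "plb (c # cs) = c + (if 0 \<le> plb cs then 0 else (5 * plb cs) div 4)"

text \<open>Zeros at the head of the list are skipped because many of the elements vanish at u = 0,
  while positivity is wanted only for u > 0.\<close>

primrec ppos :: "int list \<Rightarrow> bool" where
  "ppos [] \<longleftrightarrow> False"
| "ppos (c # cs) \<longleftrightarrow> (if c = 0 then ppos cs else 0 < plb (c # cs))"

lemma plb_le: "0 \<le> u \<Longrightarrow> u \<le> 5 / 4 \<Longrightarrow> of_int (plb cs) \<le> peval cs u"
proof (induction cs)
  case (Cons c cs)
  then have IH: "of_int (plb cs) \<le> peval cs u" by simp
  show ?case
  proof (cases "0 \<le> plb cs")
    case True
    then have "0 \<le> peval cs u" using IH by linarith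
    then show ?thesis using True Cons.prems by simp
  next
    case False
    have "real_of_int ((5 * plb cs) div 4) \<le> 5 / 4 * of_int (plb cs)"
      using real_of_int_div4[of "5 * plb cs" 4] by simp
    also have "\<dots> \<le> u * of_int (plb cs)"
      using False Cons.prems by (intro mult_right_mono_neg) auto
    also have "\<dots> \<le> u * peval cs u" using IH Cons.prems by (intro mult_left_mono)
    finally show ?thesis using False by simp
  qed
qed auto

lemma ppos_imp_pos: "ppos cs \<Longrightarrow> 0 < u \<Longrightarrow> u \<le> 5 / 4 \<Longrightarrow> 0 < peval cs u"
proof (induction cs)
  case (Cons c cs)
  show ?case
  proof (cases "c = 0")
    case False
    then have "0 < plb (c # cs)" using Cons.prems by simp
    moreover have "of_int (plb (c # cs)) \<le> peval (c # cs) u"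
      using Cons.prems by (intro plb_le) auto
    ultimately show ?thesis by linarith
  qed (use Cons in auto)
qed auto

lemma yval_pos: "0 < u \<Longrightarrow> 0 < yval u"
  by (simp add: yval_def add_pos_pos)

text \<open>The expansion of y at 0 begins 2 + 3 u + u^2, which is too large for u > 0. Lowering the
  last coefficient to 7/10 gives a bound that holds up to 5/4.\<close>

lemma yval_ge: "0 < u \<Longrightarrow> u \<le> 5 / 4 \<Longrightarrow> 2 + 3 * u + 7 / 10 * u\<^sup>2 \<le> yval u"
proof -
  assume u: "0 < u" "u \<le> 5 / 4"
  have "(4 + 12 * u + 13 * u\<^sup>2 + 4 * u ^ 3) - (2 + 3 * u + 7 / 10 * u\<^sup>2)\<^sup>2
      = u\<^sup>2 * peval [120, -20, -49] u / 100"
    by (simp add: field_simps power2_eq_square power3_eq_cube)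
  moreover have "0 < peval [120, -20, -49] u"
    using u by (intro ppos_imp_pos) simp_all
  ultimately have "(2 + 3 * u + 7 / 10 * u\<^sup>2)\<^sup>2 \<le> 4 + 12 * u + 13 * u\<^sup>2 + 4 * u ^ 3"
    by (smt (verit) divide_nonneg_nonneg mult_nonneg_nonneg zero_le_power2)
  then show ?thesis unfolding yval_def by (rule real_le_rsqrt)
qed

definition ell_pos :: "ell \<Rightarrow> bool" where
  "ell_pos e \<longleftrightarrow> ppos (ell_a e) \<and> 0 \<le> plb (ell_b e)"

text \<open>The variant of \<open>ell_pos\<close> for elements whose leading terms cancel at \<open>u = 0\<close>, where \<open>y = 2\<close>;
  \<open>[20, 30, 7]\<close> is ten times the lower bound of \<open>yval_ge\<close>.\<close>

definition ell_pos' :: "ell \<Rightarrow> bool" where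
  "ell_pos' e \<longleftrightarrow> ppos (padd (map ((*) 10) (ell_a e)) (pmul [20, 30, 7] (ell_b e))) \<and> 0 \<le> plb (ell_b e)"

lemma ell_pos_imp: "ell_pos e \<Longrightarrow> 0 < u \<Longrightarrow> u \<le> 5 / 4 \<Longrightarrow> 0 < ev e u"
  unfolding ell_pos_def ev_def
  using ppos_imp_pos[of "ell_a e" u] plb_le[of u "ell_b e"] yval_pos[of u]
  by (intro add_pos_nonneg mult_nonneg_nonneg) auto

lemma ell_pos'_imp: "ell_pos' e \<Longrightarrow> 0 < u \<Longrightarrow> u \<le> 5 / 4 \<Longrightarrow> 0 < ev e u"
proof -
  assume e: "ell_pos' e" and u: "0 < u" "u \<le> 5 / 4"
  have "0 < peval (padd (map ((*) 10) (ell_a e)) (pmul [20, 30, 7] (ell_b e))) u"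
    using e u by (intro ppos_imp_pos) (auto simp: ell_pos'_def)
  then have "0 < peval (ell_a e) u + peval (ell_b e) u * (2 + 3 * u + 7 / 10 * u\<^sup>2)"
    by (simp add: algebra_simps power2_eq_square)
  moreover have "0 \<le> peval (ell_b e) u"
    using e u plb_le[of u "ell_b e"] by (simp add: ell_pos'_def)
  then have "peval (ell_b e) u * (2 + 3 * u + 7 / 10 * u\<^sup>2) \<le> peval (ell_b e) u * yval u"
    using yval_ge[OF u] by (rule mult_left_mono[rotated])
  ultimately show ?thesis by (simp add: ev_def)
qed

section \<open>Sign certificates\<close>

lemma pos_eD: "ell_pos eD" by code_simp
lemma pos_eW: "ell_pos eW" by code_simp
lemma pos_eN7: "ell_pos eN7" by code_simp
lemma neg_eN5: "ell_pos (- eN5)" by code_simp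
lemma pos_eN3: "ell_pos' eN3" by code_simp
lemma neg_eN1: "ell_pos' (- eN1)" by code_simp
lemma neg_eB: "ell_pos (- eB)" by code_simp
text \<open>Together with \<open>pos_eF\<close> this yields \<bar>A\<bar> sqrt D < D + B, that is, F
  > 0 at 1 and at -1. The inequality is squared to stay inside Z[u, y].\<close>

lemma pos_eDB: "ell_pos (eD + eB)" by code_simp
lemma pos_eF: "ell_pos ((eD + eB) ^ 2 - eA ^ 2 * eD)" by code_simp

lemma norm_eWD:
  "list_all (\<lambda>c. c = 0) (let e = eW ^ 2 - eD in
     padd (padd (pmul (ell_a e) (ell_a e)) (pmul [-1] (pmul ysq (pmul (ell_b e) (ell_b e)))))
       (pmul [256] (pmul [0, 0, 0, 0, 1] (pmul [-1, -2, 1, 1] [1, 8, 28, 56, 70, 56, 28, 8, 1]))))"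
  by code_simp

lemma pos_eWD_a: "0 < plb (ell_a (eW ^ 2 - eD))" by code_simp

lemma u_bound:
  fixes u :: real
  assumes "u ^ 3 + u\<^sup>2 - 2 * u - 1 \<le> 0" "0 < u"
  shows "u \<le> 5 / 4"
proof (rule ccontr)
  assume "\<not> u \<le> 5 / 4"
  \<comment> \<open>The cubic takes the value 1/64 at 5/4; the quadratic is the quotient.\<close>
  then have "0 < (u - 5 / 4) * (u\<^sup>2 + 9 / 4 * u + 13 / 16)"
    using assms by (intro mult_pos_pos) (auto simp: add_pos_pos)
  also have "\<dots> = u ^ 3 + u\<^sup>2 - 2 * u - 1 - 1 / 64"
    by (simp add: field_simps power2_eq_square power3_eq_cube)
  finally show False using assms by linarith
qed

text \<open>Serves where rounded bounds fail because the value reaches 0 inside (0, 5/4]. The norm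
  factors exactly, so its sign can be decided right up to that zero.\<close>

lemma pos_of_norm_pos:
  fixes a b y :: real
  assumes "0 < a" "b * b * (y * y) < a * a"
  shows "0 < a + b * y"
proof -
  have "(b * y)\<^sup>2 < a\<^sup>2" using assms(2) by (simp add: power2_eq_square mult_ac)
  then have "\<bar>b * y\<bar> < a" using assms(1) abs_le_square_iff[of a "b * y"] by linarith
  then show ?thesis by linarith
qed

text \<open>The norm of \<open>W\<^sup>2 - D\<close> is \<open>- 256 u\<^sup>4 (1 + u)\<^sup>8 (u\<^sup>3 + u\<^sup>2 - 2 u - 1)\<close>: the condition
  \<open>\<alpha> > 1\<close> is what fixes the end \<open>\<theta>\<close> of the parameter interval.\<close>

lemma pos_eWD:
  assumes u0: "0 < u" and cub: "u ^ 3 + u\<^sup>2 - 2 * u - 1 < 0"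
  shows "ev eD u < (ev eW u)\<^sup>2"
proof -
  have u: "u \<le> 5 / 4" using u_bound[OF less_imp_le[OF cub] u0] .
  have nn: "0 \<le> u" using u0 by (rule less_imp_le)
  obtain a b U where a: "a = peval (ell_a (eW ^ 2 - eD)) u" and b: "b = peval (ell_b (eW ^ 2 - eD)) u"
    and U: "U = peval [1, 8, 28, 56, 70, 56, 28, 8, 1] u" by blast
  have apos: "0 < a"
    unfolding a
    by (rule less_le_trans[OF _ plb_le[OF nn u]]) (use pos_eWD_a in \<open>simp only: of_int_0_less_iff\<close>)
  have Upos: "0 < U" unfolding U by (rule ppos_imp_pos[OF _ u0 u]) simp
  have "a * a + (peval [-1] u * (peval ysq u * (b * b))
      + 0) + peval [256] u * (peval [0, 0, 0, 0, 1] u * (peval [-1, -2, 1, 1] u * U)) = 0"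
    using peval_zero[OF norm_eWD, of u]
    by (simp only: Let_def peval_padd peval_pmul a b U add_0_right)
  moreover have "peval [-1] u = -1" "peval [256] u = 256" "peval [0, 0, 0, 0, 1] u = u ^ 4"
    "peval [-1, -2, 1, 1] u = u ^ 3 + u\<^sup>2 - 2 * u - 1"
    by (simp_all add: eval_nat_numeral algebra_simps)
  moreover have "u ^ 4 * ((u ^ 3 + u\<^sup>2 - 2 * u - 1) * U) < 0"
    by (rule mult_pos_neg[OF zero_less_power[OF u0] mult_neg_pos[OF cub Upos]])
  ultimately have "b * b * (yval u * yval u) < a * a"
    unfolding yval_sq[OF nn] by (simp only: mult_minus1 mult.commute[of "b * b"])
  from pos_of_norm_pos[OF apos this] have "0 < ev (eW ^ 2 - eD) u"
    by (simp only: ev_def a b)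
  then show ?thesis by (simp only: ev_diff ev_power[OF nn] diff_gt_0_iff_gt)
qed

subsection \<open>The family in the parameter \<open>u = - (t + 13) / 12\<close>\<close>

lemma omega_u: "zol_omega (-13 - 12 * u) = 36 * yval u"
proof -
  have eq: "3 * (506 + 75 * (-13 - 12 * u) - (-13 - 12 * u) ^ 3) = 36\<^sup>2 * (4 + 12 * u + 13 * u\<^sup>2 + 4 * u ^ 3)"
    by (simp add: power2_eq_square power3_eq_cube algebra_simps)
  show ?thesis
    unfolding zol_omega_def yval_def eq real_sqrt_mult real_sqrt_abs abs_numeral ..
qed

lemma eM_power: "ell_zero (eM - ell_const 512 * (1 + eU) ^ 12)"
  by code_simp

lemma eM_u: "0 \<le> u \<Longrightarrow> ev eM u = 512 * (1 + u) ^ 12"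
  using ev_eqI[OF eM_power, of u] by (simp add: eU_def ev_def[of "Ell _ _"])

text \<open>The range of the certificates. It contains the endpoint \<open>u_end\<close>, so the
  factorization of Z can also be used at \<theta>.\<close>

definition u_ok :: "real \<Rightarrow> bool" where
  "u_ok u \<longleftrightarrow> 0 < u \<and> u \<le> 5 / 4"

lemma eM_pos: "u_ok u \<Longrightarrow> 0 < ev eM u"
  by (simp add: eM_u u_ok_def)

definition pscale :: real where "pscale = 2 ^ 29 * 3 ^ 15"

lemma ev_pscale: "ev (ell_const 7703510787293184) u = pscale"
  by (simp add: pscale_def)

lemma pscale_pos: "0 < pscale"
  by (simp add: pscale_def)

lemma q_u:
  assumes "0 \<le> u"
  shows "zol_q (-13 - 12 * u) = pscale * ev eM u"
proof -
  have "(1 + (-13 - 12 * u)) ^ 12 = (- 12 * (1 + u)) ^ 12" by (simp add: algebra_simps)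
  then show ?thesis
    unfolding zol_q_def eM_u[OF assms] power_mult_distrib pscale_def by simp
qed

lemmas p_eqs = p01_eq p02_eq p11_eq p12_eq p21_eq p22_eq p31_eq p32_eq p41_eq p42_eq
  p51_eq p52_eq p61_eq p62_eq p71_eq p72_eq

lemma ev_eU: "ev eU u = u"
  by (simp add: eU_def ev_def)

lemma ev_pell_t:
  assumes "t = -13 - 12 * u"
  shows "ev (pell c d) u = peval c t + zol_omega t * peval d t"
  unfolding assms ev_pell omega_u ..

lemma p_even_u:
  assumes u: "0 \<le> u" and t: "t = -13 - 12 * u"
  shows "p01 t + zol_omega t * p02 t = pscale * ev eP0 u"
    "p21 t + zol_omega t * p22 t = pscale * ev eP2 u"
    "p41 t + zol_omega t * p42 t = pscale * ev eP4 u"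
    "p61 t + zol_omega t * p62 t = pscale * ev eP6 u"
  unfolding p_eqs ev_pell_t[OF t, symmetric]
    ev_eqI[OF pP0] ev_eqI[OF pP2] ev_eqI[OF pP4] ev_eqI[OF pP6] ev_mult[OF u] ev_pscale
  by (rule refl)+

text \<open>The factor \<open>1\<^sup>2\<close> in the last two equations lets
  \<open>sqrt_odd\<close> treat all four alike.\<close>

lemma p_odd_u:
  assumes u: "0 \<le> u" and t: "t = -13 - 12 * u"
  shows "(p11 t + zol_omega t * p12 t) * (u\<^sup>2)\<^sup>2 = pscale\<^sup>2 * ((ev eN1 u)\<^sup>2 * ev eD u)"
    "(p31 t + zol_omega t * p32 t) * (u\<^sup>2)\<^sup>2 = pscale\<^sup>2 * ((ev eN3 u)\<^sup>2 * ev eD u)"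
    "(p51 t + zol_omega t * p52 t) * 1\<^sup>2 = pscale\<^sup>2 * ((ev eN5 u)\<^sup>2 * ev eD u)"
    "(p71 t + zol_omega t * p72 t) * 1\<^sup>2 = pscale\<^sup>2 * ((ev eN7 u)\<^sup>2 * ev eD u)"
  using ev_eqI[OF pN1, of u] ev_eqI[OF pN3, of u] ev_eqI[OF pN5, of u] ev_eqI[OF pN7, of u]
  unfolding p_eqs ev_mult[OF u] ev_power[OF u] ev_pscale ev_eU ev_pell_t[OF t] power_one mult_1_right
  by blast+

text \<open>The radicand is exhibited as a square, which shows both that it is nonnegative and what
  its root is. Only the sign of N remains open.\<close>

lemma sqrt_odd:
  fixes p N D k c :: real
  assumes "p * k\<^sup>2 = c\<^sup>2 * (N\<^sup>2 * D)" "0 < k" "0 \<le> D" "0 < c"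
  shows "0 \<le> p" "sqrt p = c * (\<bar>N\<bar> / k * sqrt D)"
proof -
  have "p = c\<^sup>2 * (N\<^sup>2 * D) / k\<^sup>2" using assms by (simp add: eq_divide_eq)
  also have "\<dots> = (c * (\<bar>N\<bar> / k * sqrt D))\<^sup>2"
    using assms by (simp add: power_mult_distrib power_divide)
  finally have p: "p = (c * (\<bar>N\<bar> / k * sqrt D))\<^sup>2" .
  then show "0 \<le> p" by simp
  have "0 \<le> c * (\<bar>N\<bar> / k * sqrt D)" using assms by simp
  then show "sqrt p = c * (\<bar>N\<bar> / k * sqrt D)"
    unfolding p by (rule real_sqrt_unique[OF refl])
qed

lemma sqrt_odd_u:
  assumes u: "0 < u" "u \<le> 5 / 4" and t: "t = -13 - 12 * u"
  defines "r \<equiv> sqrt (ev eD u)"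
  shows
    "0 \<le> p11 t + zol_omega t * p12 t"
    "0 \<le> p31 t + zol_omega t * p32 t"
    "0 \<le> p51 t + zol_omega t * p52 t"
    "0 \<le> p71 t + zol_omega t * p72 t"
    "sqrt (p11 t + zol_omega t * p12 t) = pscale * - (ev eN1 u / u\<^sup>2 * r)"
    "sqrt (p31 t + zol_omega t * p32 t) = pscale * (ev eN3 u / u\<^sup>2 * r)"
    "sqrt (p51 t + zol_omega t * p52 t) = pscale * - (ev eN5 u * r)"
    "sqrt (p71 t + zol_omega t * p72 t) = pscale * (ev eN7 u * r)"
proof -
  have nn: "0 \<le> u" and u2: "0 < u\<^sup>2" using u by simp_all
  have D: "0 \<le> ev eD u" using ell_pos_imp[OF pos_eD u] by simp
  have signs: "\<bar>ev eN1 u\<bar> = - ev eN1 u" "\<bar>ev eN3 u\<bar> = ev eN3 u" "\<bar>ev eN5 u\<bar> = - ev eN5 u"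
    "\<bar>ev eN7 u\<bar> = ev eN7 u"
    using ell_pos'_imp[OF neg_eN1 u] ell_pos'_imp[OF pos_eN3 u] ell_pos_imp[OF neg_eN5 u]
      ell_pos_imp[OF pos_eN7 u] by simp_all
  note 1 = sqrt_odd[OF p_odd_u(1)[OF nn t] u2 D pscale_pos]
  note 3 = sqrt_odd[OF p_odd_u(2)[OF nn t] u2 D pscale_pos]
  note 5 = sqrt_odd[OF p_odd_u(3)[OF nn t] zero_less_one D pscale_pos]
  note 7 = sqrt_odd[OF p_odd_u(4)[OF nn t] zero_less_one D pscale_pos]
  show
    "0 \<le> p11 t + zol_omega t * p12 t"
    "0 \<le> p31 t + zol_omega t * p32 t"
    "0 \<le> p51 t + zol_omega t * p52 t"
    "0 \<le> p71 t + zol_omega t * p72 t"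
    by (rule 1 3 5 7)+
  show
    "sqrt (p11 t + zol_omega t * p12 t) = pscale * - (ev eN1 u / u\<^sup>2 * r)"
    "sqrt (p31 t + zol_omega t * p32 t) = pscale * (ev eN3 u / u\<^sup>2 * r)"
    "sqrt (p51 t + zol_omega t * p52 t) = pscale * - (ev eN5 u * r)"
    "sqrt (p71 t + zol_omega t * p72 t) = pscale * (ev eN7 u * r)"
    unfolding 1 3 5 7 signs r_def by simp_all
qed

lemma well_defined_u:
  assumes "u_ok u" "t = -13 - 12 * u"
  shows "zol_well_defined t"
proof -
  have u: "0 < u" "u \<le> 5 / 4" using assms by (auto simp: u_ok_def)
  have "3 * (506 + 75 * t - t ^ 3) = 36\<^sup>2 * (4 + 12 * u + 13 * u\<^sup>2 + 4 * u ^ 3)"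
    unfolding assms by (simp add: power2_eq_square power3_eq_cube algebra_simps)
  moreover have "0 \<le> 36\<^sup>2 * (4 + 12 * u + 13 * u\<^sup>2 + 4 * u ^ 3)" using u by simp
  ultimately have "0 \<le> 3 * (506 + 75 * t - t ^ 3)" by linarith
  moreover have "zol_q t \<noteq> 0"
    using eM_pos[OF assms(1)] u pscale_pos by (simp add: assms(2) q_u)
  ultimately show ?thesis
    unfolding zol_well_defined_def using sqrt_odd_u[OF u assms(2)] by blast
qed

text \<open>The minus signs before the roots at x and x^5 cancel against N1, N5 < 0, so all odd
  coefficients take the uniform shape with N_k.\<close>

lemma zol_Z_u:
  assumes "u_ok u" "t = -13 - 12 * u"
  defines "r \<equiv> sqrt (ev eD u)"
  shows "zol_Z t = smult (1 / ev eM u) [:ev eP0 u, ev eN1 u / u\<^sup>2 * r, ev eP2 u, ev eN3 u / u\<^sup>2 * r,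
    ev eP4 u, ev eN5 u * r, ev eP6 u, ev eN7 u * r:]"
proof -
  have u: "0 < u" "u \<le> 5 / 4" using assms by (auto simp: u_ok_def)
  have "zol_q t \<noteq> 0" using eM_pos[OF assms(1)] u pscale_pos by (simp add: assms(2) q_u)
  then show ?thesis
    unfolding zol_Z_def sqrt_odd_u(5-8)[OF u assms(2)] p_even_u[OF less_imp_le[OF u(1)] assms(2)] r_def
    using eM_pos[OF assms(1)] u pscale_pos by (simp add: assms(2) q_u)
qed

definition zol_\<alpha> :: "real \<Rightarrow> real" where "zol_\<alpha> u = ev eW u / sqrt (ev eD u)"
definition zol_\<beta> :: "real \<Rightarrow> real" where "zol_\<beta> u = ev eH u / sqrt (ev eD u)"

text \<open>Each list identity is homogeneous in r = sqrt D, so dividing by a power of r turns it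
  into an identity between coefficients of polynomials in x. No use is made of \<alpha> > 1, hence
  the factorizations persist at \<open>u_end\<close>.\<close>

lemma zol_Z_factor:
  assumes ok: "u_ok u" and t: "t = -13 - 12 * u"
  defines "r \<equiv> sqrt (ev eD u)"
  defines "n \<equiv> ev eN7 u * r / ev eM u"
  shows "zol_Z t + 1 = smult n ([:- 1, 0, 1:] * [:- zol_\<alpha> u, 1:] * [:ev eB u / r\<^sup>2, - (ev eA u / r), 1:] ^ 2)"
    and "zol_Z t - 1 = smult n ([:- zol_\<beta> u, 1:] * [:ev eG0 u / r ^ 3, ev eG1 u / r\<^sup>2, ev eG2 u / r, 1:] ^ 2)"
proof -
  have u: "0 < u" "u \<le> 5 / 4" using ok by (auto simp: u_ok_def)
  have D: "0 < ev eD u" using pos_eD u by (rule ell_pos_imp)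
  then have r: "0 < r" and rr: "ev eD u = r\<^sup>2" by (simp_all add: r_def)
  define M w h a b g0 g1 g2 where defs: "M = ev eM u" "w = ev eW u / r" "h = ev eH u / r"
    "a = ev eA u / r" "b = ev eB u / r\<^sup>2" "g0 = ev eG0 u / r ^ 3" "g1 = ev eG1 u / r\<^sup>2" "g2 = ev eG2 u / r"
  have ev: "ev eW u = w * r" "ev eH u = h * r" "ev eA u = a * r" "ev eB u = b * r\<^sup>2"
    "ev eG0 u = g0 * r ^ 3" "ev eG1 u = g1 * r\<^sup>2" "ev eG2 u = g2 * r"
    using r by (simp_all add: defs)
  have M: "0 < M" using eM_pos[OF ok] by (simp add: defs)
  have U: "ev eU u = u" by (simp add: eU_def ev_def)
  have n_def: "n = ev eN7 u * r / M" by (simp add: n_def defs)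
  \<comment> \<open>The coefficients of (x - w) (x^2 - 1) (x^2 - a x + b)^2, with L_k = l_k r^(7 -
    k).\<close>
  define l6 l5 l4 l3 l2 l1 l0 where l:
    "l6 = - (2 * a) - w" "l5 = a * a + 2 * b + 2 * a * w - 1" "l4 = 2 * a + w - 2 * a * b - w * (a * a + 2 * b)"
    "l3 = b * b + 2 * a * b * w - (a * a + 2 * b) - 2 * a * w" "l2 = 2 * a * b + w * (a * a + 2 * b) - w * (b * b)"
    "l1 = - (b * b) - 2 * a * b * w" "l0 = w * (b * b)"
  have nn: "0 \<le> u" using u by simp
  have L: "ev eL6 u = l6 * r" "ev eL5 u = l5 * r ^ 2" "ev eL4 u = l4 * r ^ 3" "ev eL3 u = l3 * r ^ 4"
    "ev eL2 u = l2 * r ^ 5" "ev eL1 u = l1 * r ^ 6" "ev eL0 u = l0 * r ^ 7"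
    using nn by (simp_all add: eL6_def eL5_def eL4_def eL3_def eL2_def eL1_def eL0_def ev rr l
        algebra_simps eval_nat_numeral)
  have R: "ev eR6 u = (2 * g2 - h) * r" "ev eR5 u = (g2 * g2 + 2 * g1 - 2 * h * g2) * r ^ 2"
    "ev eR4 u = (2 * g0 + 2 * g1 * g2 - h * (g2 * g2 + 2 * g1)) * r ^ 3"
    "ev eR3 u = (g1 * g1 + 2 * g0 * g2 - h * (2 * g0 + 2 * g1 * g2)) * r ^ 4"
    "ev eR2 u = (2 * g0 * g1 - h * (g1 * g1 + 2 * g0 * g2)) * r ^ 5"
    "ev eR1 u = (g0 * g0 - 2 * h * g0 * g1) * r ^ 6" "ev eR0 u = - (h * (g0 * g0)) * r ^ 7"
    using nn by (simp_all add: eR6_def eR5_def eR4_def eR3_def eR2_def eR1_def eR0_def ev rr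
        algebra_simps eval_nat_numeral)
  have LR: "l6 = 2 * g2 - h" "l5 = g2 * g2 + 2 * g1 - 2 * h * g2"
    "l4 = 2 * g0 + 2 * g1 * g2 - h * (g2 * g2 + 2 * g1)"
    "l3 = g1 * g1 + 2 * g0 * g2 - h * (2 * g0 + 2 * g1 * g2)"
    "l2 = 2 * g0 * g1 - h * (g1 * g1 + 2 * g0 * g2)" "l1 = g0 * g0 - 2 * h * g0 * g1"
    using ev_eqI[OF LR6, of u] ev_eqI[OF LR5, of u] ev_eqI[OF LR4, of u] ev_eqI[OF LR3, of u]
      ev_eqI[OF LR2, of u] ev_eqI[OF LR1, of u] r
    unfolding L R by simp_all
  have rr2: "(r\<^sup>2)\<^sup>2 = r ^ 4" and rr3: "(r\<^sup>2) ^ 3 = r ^ 6" by simp_all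
  \<comment> \<open>The gap between the constant terms, which n scales to 2.\<close>
  have "ev eN7 u * (l0 * r ^ 7 - - (h * (g0 * g0)) * r ^ 7) = (M + M) * r ^ 6"
    using ev_eqI[OF LR0, of u] nn
    by (simp only: ev_mult ev_power ev_add ev_diff L R rr rr2 rr3 defs(1))
  then have "r ^ 6 * (ev eN7 u * r * (l0 + h * (g0 * g0))) = r ^ 6 * (2 * M)"
    by (simp add: algebra_simps eval_nat_numeral)
  then have "ev eN7 u * r * (l0 + h * (g0 * g0)) = 2 * M"
    by (rule mult_left_cancel[THEN iffD1, rotated]) (use r in simp)
  then have "n * (l0 + h * (g0 * g0)) = 2" using M by (simp add: n_def)
  then have const: "n * l0 = 2 - n * (h * (g0 * g0))" by (simp only: distrib_left)
  have P: "ev eP6 u / M = n * l6" "ev eN5 u * r / M = n * l5" "ev eP4 u / M = n * l4"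
    "ev eN3 u / u\<^sup>2 * r / M = n * l3" "ev eP2 u / M = n * l2" "ev eN1 u / u\<^sup>2 * r / M = n * l1"
    "ev eP0 u / M = n * l0 - 1"
  proof -
    have 6: "ev eP6 u = ev eN7 u * r * l6"
      using ev_eqI[OF PL6, of u] nn by (simp add: L)
    have "ev eN5 u * r\<^sup>2 = ev eN7 u * (l5 * r ^ 2)"
      using ev_eqI[OF PL5, of u] nn by (simp only: ev_mult ev_power ev_add L rr rr2 rr3 U)
    then have "ev eN5 u * r ^ 2 = (ev eN7 u * l5) * r ^ 2"
      by (simp add: algebra_simps eval_nat_numeral)
    then have 5: "ev eN5 u = ev eN7 u * l5" using r by simp
    have "ev eP4 u * r\<^sup>2 = ev eN7 u * (l4 * r ^ 3)"
      using ev_eqI[OF PL4, of u] nn by (simp only: ev_mult ev_power ev_add L rr rr2 rr3 U)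
    then have "ev eP4 u * r ^ 2 = (ev eN7 u * r * l4) * r ^ 2"
      by (simp add: algebra_simps eval_nat_numeral)
    then have 4: "ev eP4 u = ev eN7 u * r * l4" using r by simp
    have "ev eN3 u * r ^ 4 = ev eN7 u * (l3 * r ^ 4) * u\<^sup>2"
      using ev_eqI[OF PL3, of u] nn by (simp only: ev_mult ev_power ev_add L rr rr2 rr3 U)
    then have "ev eN3 u * r ^ 4 = (ev eN7 u * l3 * u\<^sup>2) * r ^ 4"
      by (simp add: algebra_simps eval_nat_numeral)
    then have 3: "ev eN3 u = ev eN7 u * l3 * u\<^sup>2" using r by simp
    have "ev eP2 u * r ^ 4 = ev eN7 u * (l2 * r ^ 5)"
      using ev_eqI[OF PL2, of u] nn by (simp only: ev_mult ev_power ev_add L rr rr2 rr3 U)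
    then have "ev eP2 u * r ^ 4 = (ev eN7 u * r * l2) * r ^ 4"
      by (simp add: algebra_simps eval_nat_numeral)
    then have 2: "ev eP2 u = ev eN7 u * r * l2" using r by simp
    have "ev eN1 u * r ^ 6 = ev eN7 u * (l1 * r ^ 6) * u\<^sup>2"
      using ev_eqI[OF PL1, of u] nn by (simp only: ev_mult ev_power ev_add L rr rr2 rr3 U)
    then have "ev eN1 u * r ^ 6 = (ev eN7 u * l1 * u\<^sup>2) * r ^ 6"
      by (simp add: algebra_simps eval_nat_numeral)
    then have 1: "ev eN1 u = ev eN7 u * l1 * u\<^sup>2" using r by simp
    have "(ev eP0 u + M) * r ^ 6 = ev eN7 u * (l0 * r ^ 7)"
      using ev_eqI[OF PL0, of u] nn by (simp only: ev_mult ev_power ev_add L rr rr2 rr3 U defs(1))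
    then have "(ev eP0 u + M) * r ^ 6 = (ev eN7 u * r * l0) * r ^ 6"
      by (simp add: algebra_simps eval_nat_numeral)
    then have 0: "ev eP0 u = ev eN7 u * r * l0 - M" using r by simp
    show "ev eP6 u / M = n * l6" "ev eN5 u * r / M = n * l5" "ev eP4 u / M = n * l4"
      "ev eN3 u / u\<^sup>2 * r / M = n * l3" "ev eP2 u / M = n * l2" "ev eN1 u / u\<^sup>2 * r / M = n * l1"
      "ev eP0 u / M = n * l0 - 1"
      using u M unfolding 0 1 2 3 4 5 6 n_def by (simp_all add: diff_divide_distrib)
  qed
  have "zol_Z t = [:ev eP0 u / M, ev eN1 u / u\<^sup>2 * r / M, ev eP2 u / M, ev eN3 u / u\<^sup>2 * r / M,
      ev eP4 u / M, ev eN5 u * r / M, ev eP6 u / M, ev eN7 u * r / M:]"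
    unfolding zol_Z_u[OF ok t] by (simp add: r_def defs(1))
  then have Z: "zol_Z t = [:n * l0 - 1, n * l1, n * l2, n * l3, n * l4, n * l5, n * l6, n:]"
    unfolding P by (simp add: n_def)
  have F2: "[:b, - a, 1:] ^ 2 = [:b * b, - (2 * a * b), 2 * b + a * a, - (2 * a), 1:]"
    by (simp add: power2_eq_square)
  have G2: "[:g0, g1, g2, 1:] ^ 2
      = [:g0 * g0, 2 * g0 * g1, g1 * g1 + 2 * g0 * g2, 2 * g0 + 2 * g1 * g2, g2 * g2 + 2 * g1, 2 * g2, 1:]"
    by (simp add: power2_eq_square)
  have "zol_Z t + 1 = smult n ([:- 1, 0, 1:] * [:- w, 1:] * [:b, - a, 1:] ^ 2)"
    unfolding Z F2 l by (simp add: one_pCons algebra_simps)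
  then show "zol_Z t + 1
      = smult n ([:- 1, 0, 1:] * [:- zol_\<alpha> u, 1:] * [:ev eB u / r\<^sup>2, - (ev eA u / r), 1:] ^ 2)"
    by (simp only: defs zol_\<alpha>_def r_def)
  have "zol_Z t - 1 = smult n ([:- h, 1:] * [:g0, g1, g2, 1:] ^ 2)"
    unfolding Z G2 const by (simp add: one_pCons LR algebra_simps)
  then show "zol_Z t - 1
      = smult n ([:- zol_\<beta> u, 1:] * [:ev eG0 u / r ^ 3, ev eG1 u / r\<^sup>2, ev eG2 u / r, 1:] ^ 2)"
    by (simp only: defs zol_\<beta>_def r_def)
qed

lemma zolotarev_poly_u:
  assumes cub: "u ^ 3 + u\<^sup>2 - 2 * u - 1 < 0" and u0: "0 < u" and t: "t = -13 - 12 * u"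
  defines "r \<equiv> sqrt (ev eD u)"
  shows "zolotarev_poly (zol_Z t)
    [:ev eB u / r\<^sup>2, - (ev eA u / r), 1:] [:ev eG0 u / r ^ 3, ev eG1 u / r\<^sup>2, ev eG2 u / r, 1:]
    (ev eN7 u * r / ev eM u) (zol_\<alpha> u) (zol_\<beta> u)
    (ev eB u / r\<^sup>2) (- (ev eA u / r)) (ev eG0 u / r ^ 3) (ev eG1 u / r\<^sup>2) (ev eG2 u / r)"
proof
  have u: "0 < u" "u \<le> 5 / 4" using u_bound[OF less_imp_le[OF cub] u0] u0 by auto
  then have ok: "u_ok u" by (simp add: u_ok_def)
  show "zol_Z t + 1 = smult (ev eN7 u * r / ev eM u)
      ([:- 1, 0, 1:] * [:- zol_\<alpha> u, 1:] * [:ev eB u / r\<^sup>2, - (ev eA u / r), 1:] ^ 2)"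
    unfolding r_def by (rule zol_Z_factor(1)[OF ok t])
  show "zol_Z t - 1 = smult (ev eN7 u * r / ev eM u)
      ([:- zol_\<beta> u, 1:] * [:ev eG0 u / r ^ 3, ev eG1 u / r\<^sup>2, ev eG2 u / r, 1:] ^ 2)"
    unfolding r_def by (rule zol_Z_factor(2)[OF ok t])
  have D: "0 < ev eD u" using pos_eD u by (rule ell_pos_imp)
  then have r: "0 < r" and rr: "ev eD u = r\<^sup>2" by (simp_all add: r_def)
  show "0 < ev eN7 u * r / ev eM u"
    using ell_pos_imp[OF pos_eN7 u] r eM_pos[OF ok] by simp
  have W: "0 < ev eW u" using pos_eW u by (rule ell_pos_imp)
  have "r\<^sup>2 < (ev eW u)\<^sup>2" using pos_eWD[OF u0 cub] by (simp only: rr)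
  from power2_less_imp_less[OF this less_imp_le[OF W]] have "r < ev eW u" .
  then show "1 < zol_\<alpha> u" using r by (simp add: zol_\<alpha>_def flip: r_def)
  have "ev eW u < ev eH u" using u by (simp add: eH_def ev_def[of "Ell _ _"] add_pos_pos)
  then show "zol_\<alpha> u < zol_\<beta> u"
    using r by (simp add: zol_\<alpha>_def zol_\<beta>_def divide_strict_right_mono flip: r_def)
  have "ev eB u < 0" using ell_pos_imp[OF neg_eB u] by simp
  then show "poly [:ev eB u / r\<^sup>2, - (ev eA u / r), 1:] 0 < 0"
    using r by (simp add: divide_neg_pos)
  define a b where a: "a = ev eA u / r" and b: "b = ev eB u / r\<^sup>2"
  have ab: "ev eA u * r = a * r\<^sup>2" "ev eB u = b * r\<^sup>2"
    using r by (simp_all add: a b power2_eq_square)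
  have DB: "0 < r\<^sup>2 + ev eB u" using ell_pos_imp[OF pos_eDB u] by (simp add: rr)
  have "(ev eA u * r)\<^sup>2 < (r\<^sup>2 + ev eB u)\<^sup>2"
    using ell_pos_imp[OF pos_eF u] u0 by (simp add: rr power_mult_distrib)
  then have "\<bar>ev eA u * r\<bar>\<^sup>2 < (r\<^sup>2 + ev eB u)\<^sup>2"
    by (simp only: power2_abs)
  from power2_less_imp_less[OF this less_imp_le[OF DB]]
  have "\<bar>a\<bar> * r\<^sup>2 < (1 + b) * r\<^sup>2"
    unfolding ab by (simp add: abs_mult algebra_simps)
  then have "\<bar>a\<bar> < 1 + b" by (rule mult_right_less_imp_less) simp
  then show "0 < poly [:ev eB u / r\<^sup>2, - (ev eA u / r), 1:] 1"
    "0 < poly [:ev eB u / r\<^sup>2, - (ev eA u / r), 1:] (-1)"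
    unfolding a[symmetric] b[symmetric] by auto
qed (rule refl)+
subsection \<open>The endpoint \<open>\<theta>\<close>\<close>

text \<open>This is 2 cos (2 \<pi> / 7). Written through 2 cos (\<pi> / 7), its cubic follows by
  algebra from the one below.\<close>

definition u_end :: real where "u_end = (2 * cos (pi / 7))\<^sup>2 - 2"

text \<open>Since 4 \<pi> / 7 = \<pi> - 3 \<pi> / 7, the double and triple angle formulas give a
  quartic in cos (\<pi> / 7); its factor c + 1 belongs to the angle \<pi> and is cancelled.\<close>

lemma cos_pi_7: "(2 * cos (pi / 7)) ^ 3 - (2 * cos (pi / 7))\<^sup>2 - 2 * (2 * cos (pi / 7)) + 1 = 0"
proof -
  define c where "c = cos (pi / 7)"
  have "cos (4 * (pi / 7)) = cos (pi - 3 * (pi / 7))" by (rule arg_cong[of _ _ cos]) simp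
  also have "\<dots> = - cos (3 * (pi / 7))" by (rule cos_pi_minus)
  also have "cos (3 * (pi / 7)) = 4 * c ^ 3 - 3 * c" unfolding c_def by (rule cos_treble_cos)
  also have "cos (4 * (pi / 7)) = cos (2 * (2 * (pi / 7)))" by simp
  also have "\<dots> = 2 * (2 * c\<^sup>2 - 1)\<^sup>2 - 1" unfolding c_def cos_double_cos ..
  finally have "(c + 1) * ((2 * c) ^ 3 - (2 * c)\<^sup>2 - 2 * (2 * c) + 1) = 0"
    by (simp add: algebra_simps power2_eq_square power3_eq_cube)
  moreover have "0 < c" unfolding c_def by (rule cos_gt_zero) auto
  ultimately show ?thesis by (simp add: c_def)
qed

text \<open>On (1, 9/5] the cubic of \<open>cos_pi_7\<close> is at most -1/125, so its root above 1
  lies beyond 9/5. This keeps \<open>u_end\<close> above 6/5.\<close>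

lemma cos_pi_7_gt: "9 / 5 < 2 * cos (pi / 7)"
proof (rule ccontr)
  define g where "g = 2 * cos (pi / 7)"
  assume "\<not> 9 / 5 < 2 * cos (pi / 7)"
  then have "g \<le> 9 / 5" by (simp add: g_def)
  moreover have "cos (pi / 3) < cos (pi / 7)" by (rule cos_monotone_0_pi) auto
  then have g1: "1 < g" by (simp add: g_def cos_60)
  moreover have "0 \<le> g\<^sup>2 + 4 / 5 * g - 14 / 25"
  proof -
    have "1 \<le> g\<^sup>2" using g1 by (simp add: one_le_power)
    then show ?thesis using g1 by linarith
  qed
  ultimately have "(g - 9 / 5) * (g\<^sup>2 + 4 / 5 * g - 14 / 25) \<le> 0"
    by (intro mult_nonpos_nonneg) auto
  moreover have "(g - 9 / 5) * (g\<^sup>2 + 4 / 5 * g - 14 / 25) = (g ^ 3 - g\<^sup>2 - 2 * g + 1) + 1 / 125"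
    by (simp add: field_simps power2_eq_square power3_eq_cube)
  ultimately show False using cos_pi_7 unfolding g_def by linarith
qed

lemma u_end_cubic: "u_end ^ 3 + u_end\<^sup>2 - 2 * u_end - 1 = 0"
  and two_cos_pi_7: "2 * cos (pi / 7) = u_end\<^sup>2 + u_end - 1"
  and u_end_gt: "6 / 5 < u_end"
proof -
  define g where "g = 2 * cos (pi / 7)"
  have g: "g ^ 3 - g\<^sup>2 - 2 * g + 1 = 0" and u: "u_end = g\<^sup>2 - 2"
    unfolding g_def u_end_def by (rule cos_pi_7) simp
  \<comment> \<open>The map g to g^2 - 2 doubles the angle. The second factor is the first with g
    replaced by -g, up to sign.\<close>
  have "u_end ^ 3 + u_end\<^sup>2 - 2 * u_end - 1 = (g ^ 3 - g\<^sup>2 - 2 * g + 1) * (g ^ 3 + g\<^sup>2 - 2 * g - 1)"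
    unfolding u by (simp add: algebra_simps eval_nat_numeral)
  then show "u_end ^ 3 + u_end\<^sup>2 - 2 * u_end - 1 = 0" by (simp add: g)
  have "u_end\<^sup>2 + u_end - 1 - g = (g ^ 3 - g\<^sup>2 - 2 * g + 1) * (g + 1)"
    unfolding u by (simp add: algebra_simps eval_nat_numeral)
  then show "2 * cos (pi / 7) = u_end\<^sup>2 + u_end - 1" by (simp add: g flip: g_def)
  have "(9 / 5)\<^sup>2 < g\<^sup>2"
    unfolding g_def using cos_pi_7_gt by (intro power_strict_mono) auto
  then show "6 / 5 < u_end" unfolding u by (simp add: power2_eq_square)
qed

text \<open>After division by u - \<open>u_end\<close> a quotient remains that is positive for u >
  0, so \<open>u_end\<close> is the only positive root.\<close>

lemma cubic_sign:
  fixes u :: real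
  assumes "0 < u"
  shows "u ^ 3 + u\<^sup>2 - 2 * u - 1 < 0 \<longleftrightarrow> u < u_end" "u ^ 3 + u\<^sup>2 - 2 * u - 1 = 0 \<longleftrightarrow> u = u_end"
proof -
  define k where "k = u\<^sup>2 + u * u_end + u_end\<^sup>2 + u + u_end - 2"
  have "(6 / 5)\<^sup>2 < u_end\<^sup>2" using u_end_gt by (intro power_strict_mono) auto
  then have "1 < u_end\<^sup>2" by (simp add: power2_eq_square)
  moreover have "0 < u * u_end" "0 \<le> u\<^sup>2" using assms u_end_gt by auto
  ultimately have k: "0 < k" using assms u_end_gt unfolding k_def by linarith
  have "u ^ 3 + u\<^sup>2 - 2 * u - 1 = (u ^ 3 + u\<^sup>2 - 2 * u - 1) - (u_end ^ 3 + u_end\<^sup>2 - 2 * u_end - 1)"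
    using u_end_cubic by simp
  also have "\<dots> = (u - u_end) * k"
    by (simp add: k_def algebra_simps power2_eq_square power3_eq_cube)
  finally have eq: "u ^ 3 + u\<^sup>2 - 2 * u - 1 = (u - u_end) * k" .
  show "u ^ 3 + u\<^sup>2 - 2 * u - 1 < 0 \<longleftrightarrow> u < u_end" "u ^ 3 + u\<^sup>2 - 2 * u - 1 = 0 \<longleftrightarrow> u = u_end"
    unfolding eq using k by (auto simp: mult_less_0_iff)
qed

lemma u_end_ok: "u_ok u_end"
  using u_bound[of u_end] u_end_cubic u_end_gt by (simp add: u_ok_def)

lemma theta_cubic:
  "(-13 - 12 * u) ^ 3 + 27 * (-13 - 12 * u)\<^sup>2 - 93 * (-13 - 12 * u) - 1847
    = - 1728 * (u ^ 3 + u\<^sup>2 - 2 * u - (1::real))"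
  by (simp add: algebra_simps power2_eq_square power3_eq_cube)

text \<open>The substitution reverses the order, so the smallest root in x corresponds to the
  largest in u, which is the positive one.\<close>

lemma zol_theta_eq: "zol_theta = -13 - 12 * u_end"
  unfolding zol_theta_def
proof (rule Least_equality)
  show "(-13 - 12 * u_end) ^ 3 + 27 * (-13 - 12 * u_end)\<^sup>2 - 93 * (-13 - 12 * u_end) - 1847 = 0"
    unfolding theta_cubic by (simp add: u_end_cubic)
  fix x :: real
  assume x: "x ^ 3 + 27 * x\<^sup>2 - 93 * x - 1847 = 0"
  define u where "u = - (x + 13) / 12"
  have xu: "x = -13 - 12 * u" by (simp add: u_def field_simps)
  have "u ^ 3 + u\<^sup>2 - 2 * u - 1 = 0" using x unfolding xu theta_cubic by simp
  then have "u = u_end" if "0 < u" using cubic_sign(2)[OF that] by simp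
  then show "-13 - 12 * u_end \<le> x" using u_end_gt unfolding xu by (cases "0 < u") auto
qed

lemma zol_theta_bounds: "zol_theta \<in> {-27.963756<..<-27.963755}"
proof -
  have "(14963755 / 12000000 :: real) < u_end"
    by (subst cubic_sign(1)[symmetric]) (simp_all add: power2_eq_square power3_eq_cube)
  moreover have "\<not> (14963756 / 12000000 :: real) \<le> u_end"
  proof
    assume "(14963756 / 12000000 :: real) \<le> u_end"
    then show False
      using cubic_sign[of "14963756 / 12000000"] by (simp add: le_less power2_eq_square power3_eq_cube)
  qed
  ultimately show ?thesis unfolding zol_theta_eq by simp
qed

lemma zol_I_iff: "t \<in> zol_I \<longleftrightarrow> (\<exists>u. t = -13 - 12 * u \<and> 0 < u \<and> u < u_end)"
proof
  assume "t \<in> zol_I"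
  then show "\<exists>u. t = -13 - 12 * u \<and> 0 < u \<and> u < u_end"
    by (intro exI[of _ "- (t + 13) / 12"]) (auto simp: zol_I_def zol_theta_eq field_simps)
qed (auto simp: zol_I_def zol_theta_eq)

text \<open>Values at \<open>u_end\<close> of elements of \<open>\<int>[u, y]\<close>, where \<open>y = 3 u + 2 u\<^sup>2\<close>, reduced modulo
  \<open>u\<^sup>3 = 1 + 2 u - u\<^sup>2\<close>.\<close>

fun cred :: "int list \<Rightarrow> int \<times> int \<times> int" where
  "cred [] = (0, 0, 0)"
| "cred (c # cs) = (case cred cs of (p, q, r) \<Rightarrow> (c + r, p + 2 * r, q - r))"

lemma cred: "cred cs = (p, q, r) \<Longrightarrow> peval cs u_end = of_int p + of_int q * u_end + of_int r * u_end\<^sup>2"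
proof (induction cs arbitrary: p q r)
  case (Cons c cs)
  obtain p' q' r' where c: "cred cs = (p', q', r')" by (cases "cred cs")
  then have e: "p = c + r'" "q = p' + 2 * r'" "r = q' - r'" using Cons.prems by auto
  have "u_end * (of_int r' * u_end\<^sup>2) = of_int r' * (1 + 2 * u_end - u_end\<^sup>2)"
  proof -
    have "u_end * u_end\<^sup>2 = 1 + 2 * u_end - u_end\<^sup>2"
      using u_end_cubic by (simp add: power2_eq_square power3_eq_cube)
    then show ?thesis by (metis mult.left_commute)
  qed
  then show ?case
    by (simp add: Cons.IH[OF c] e algebra_simps power2_eq_square)
qed auto

definition end_zero :: "ell \<Rightarrow> bool" where
  "end_zero e \<longleftrightarrow> cred (padd (ell_a e) (pmul [0, 3, 2] (ell_b e))) = (0, 0, 0)"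

lemma yval_end: "yval u_end = peval [0, 3, 2] u_end"
  unfolding yval_def
proof (rule real_sqrt_unique)
  have "(peval [0, 3, 2] u_end)\<^sup>2 - (4 + 12 * u_end + 13 * u_end\<^sup>2 + 4 * u_end ^ 3)
      = 4 * (u_end + 1) * (u_end ^ 3 + u_end\<^sup>2 - 2 * u_end - 1)"
    by (simp add: algebra_simps eval_nat_numeral)
  then show "(peval [0, 3, 2] u_end)\<^sup>2 = 4 + 12 * u_end + 13 * u_end\<^sup>2 + 4 * u_end ^ 3"
    using u_end_cubic by simp
  show "0 \<le> peval [0, 3, 2] u_end" using u_end_gt by simp
qed

lemma end_zero_imp:
  assumes "end_zero (e - f)"
  shows "ev e u_end = ev f u_end"
proof -
  have "ev (e - f) u_end = peval (padd (ell_a (e - f)) (pmul [0, 3, 2] (ell_b (e - f)))) u_end"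
    by (simp only: ev_def yval_end peval_padd peval_pmul mult.commute)
  also have "\<dots> = 0"
    using cred[OF assms[unfolded end_zero_def]] by (simp only: of_int_0 mult_zero_left add_0)
  finally show ?thesis by simp
qed

text \<open>At \<open>u_end\<close> this is 2 cos (\<pi> / 7) + 2 = 4 c with c = cos^2 (\<pi> /
  14).\<close>

definition eC :: ell where "eC = Ell [1, 1, 1] []"

text \<open>D = W^2 means \<alpha> = 1. The next three match Z + 1 with T_7(y) + 1 = (y + 1) (8 y^3
  - 4 y^2 - 4 y + 1)^2 for y = c (1 + x) - 1: \<open>end_N\<close> gives the leading coefficient 64
  c^7, \<open>end_A\<close> and \<open>end_B\<close> the coefficients of x^2 and x in the
  cubic.\<close>

lemma end_W: "end_zero (eD - eW ^ 2)" by code_simp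
lemma end_N: "end_zero (ell_const 256 * eN7 * eW - eM * eC ^ 7)" by code_simp
lemma end_A: "end_zero (eC * (eA + eW) - (ell_const 14 - ell_const 3 * eC) * eW)" by code_simp
lemma end_B: "end_zero (eC ^ 2 * (eA * eW + eB) -
    eW ^ 2 * (ell_const 3 * (eC - ell_const 4) ^ 2 - ell_const 4 * (eC - ell_const 4) - ell_const 8))"
  by code_simp
lemma zol_end:
  defines "c \<equiv> (cos (pi / 14))\<^sup>2" and "a \<equiv> ev eA u_end / ev eW u_end"
  shows "zol_Z zol_theta + 1 = smult (64 * c ^ 7)
      ([:- 1, 0, 1:] * [:- 1, 1:] * [:ev eB u_end / (ev eW u_end)\<^sup>2, - a, 1:] ^ 2)"
    and "c * (a + 1) = 7 / 2 - 3 * c"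
    and "c\<^sup>2 * (a + ev eB u_end / (ev eW u_end)\<^sup>2) = 3 * (c - 1)\<^sup>2 - (c - 1) - 1 / 2"
    and "8 * (2 * c - 1) ^ 3 - 4 * (2 * c - 1)\<^sup>2 - 4 * (2 * c - 1) + 1 = 0"
proof -
  define W where "W = ev eW u_end"
  have u: "0 < u_end" "u_end \<le> 5 / 4" and nn: "0 \<le> u_end"
    using u_end_ok by (auto simp: u_ok_def)
  have W: "0 < W" unfolding W_def using pos_eW u by (rule ell_pos_imp)
  have D: "ev eD u_end = W\<^sup>2"
    using end_zero_imp[OF end_W] by (simp only: W_def ev_power[OF nn])
  then have r: "sqrt (ev eD u_end) = W" using W by simp
  have "cos (2 * (pi / 14)) = 2 * c - 1" unfolding c_def by (rule cos_double_cos)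
  then have cos7: "cos (pi / 7) = 2 * c - 1" by simp
  then show "8 * (2 * c - 1) ^ 3 - 4 * (2 * c - 1)\<^sup>2 - 4 * (2 * c - 1) + 1 = 0"
    using cos_pi_7 unfolding cos7 by (simp add: algebra_simps power2_eq_square power3_eq_cube)
  have eC: "ev eC u_end = 4 * c"
    using two_cos_pi_7 cos7 by (simp add: eC_def ev_def power2_eq_square algebra_simps)
  have c: "0 < c"
    unfolding c_def using cos_gt_zero[of "pi / 14"] by simp
  have "256 * ev eN7 u_end * W = ev eM u_end * (4 * c) ^ 7"
    using end_zero_imp[OF end_N] by (simp add: ev_mult[OF nn] ev_power[OF nn] eC W_def)
  then have n: "ev eN7 u_end * W / ev eM u_end = 64 * c ^ 7"
    using eM_pos[OF u_end_ok] by (simp add: field_simps)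
  have \<alpha>: "zol_\<alpha> u_end = 1" unfolding zol_\<alpha>_def r using W by (simp add: W_def)
  show "zol_Z zol_theta + 1 = smult (64 * c ^ 7)
      ([:- 1, 0, 1:] * [:- 1, 1:] * [:ev eB u_end / (ev eW u_end)\<^sup>2, - a, 1:] ^ 2)"
    using zol_Z_factor(1)[OF u_end_ok zol_theta_eq]
    unfolding r n \<alpha> unfolding a_def W_def .
  have A: "ev eA u_end = a * W" using W by (simp add: a_def W_def)
  have "4 * c * (ev eA u_end + W) = (14 - 3 * (4 * c)) * W"
    using end_zero_imp[OF end_A] by (simp add: ev_mult[OF nn] eC W_def)
  then have "W * (4 * (c * (a + 1))) = W * (4 * (7 / 2 - 3 * c))" by (simp add: A algebra_simps)
  then show "c * (a + 1) = 7 / 2 - 3 * c" using W by simp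
  define b where "b = ev eB u_end / W\<^sup>2"
  have B: "ev eB u_end = b * W\<^sup>2" using W by (simp add: b_def)
  have "(4 * c)\<^sup>2 * (ev eA u_end * W + ev eB u_end) = W\<^sup>2 * (3 * (4 * c - 4)\<^sup>2 - 4 * (4 * c - 4) - 8)"
    using end_zero_imp[OF end_B] by (simp add: ev_mult[OF nn] ev_power[OF nn] eC W_def)
  then have "W\<^sup>2 * (16 * (c\<^sup>2 * (a + b))) = W\<^sup>2 * (16 * (3 * (c - 1)\<^sup>2 - (c - 1) - 1 / 2))"
    by (simp add: A B algebra_simps power2_eq_square)
  then have "16 * (c\<^sup>2 * (a + b)) = 16 * (3 * (c - 1)\<^sup>2 - (c - 1) - 1 / 2)"
    by (rule mult_left_cancel[THEN iffD1, rotated]) (use W in simp)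
  then show "c\<^sup>2 * (a + ev eB u_end / (ev eW u_end)\<^sup>2) = 3 * (c - 1)\<^sup>2 - (c - 1) - 1 / 2"
    unfolding b_def W_def by simp
qed

lemma zol_end_eval:
  assumes y: "y = (1 + x) * (cos (pi / 14))\<^sup>2 - 1"
  shows "poly (zol_Z zol_theta) x = - 7 * y + 56 * y ^ 3 - 112 * y ^ 5 + 64 * y ^ 7"
proof -
  define c a b where c: "c = (cos (pi / 14))\<^sup>2" and a: "a = ev eA u_end / ev eW u_end"
    and b: "b = ev eB u_end / (ev eW u_end)\<^sup>2"
  note end_eqs = zol_end[folded c a b]
  have yc: "y = c * (1 + x) - 1" using y by (simp add: c)
  \<comment> \<open>The constant coefficient is settled by evaluation at x = 1, where both sides
    vanish: there y = 2 c - 1 = cos (\<pi> / 7) is a root of the cubic in y.\<close>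
  have "8 * (c ^ 3 * ((x - 1) * (x\<^sup>2 - a * x + b)))
      = 8 * c ^ 3 * x ^ 3 - 8 * c\<^sup>2 * (c * (a + 1)) * x\<^sup>2 + 8 * c * (c\<^sup>2 * (a + b)) * (x - 1)
        + 8 * c\<^sup>2 * (c * (a + 1)) - 8 * c ^ 3"
    by (simp add: algebra_simps power2_eq_square power3_eq_cube)
  also have "\<dots> = 8 * y ^ 3 - 4 * y\<^sup>2 - 4 * y + 1
      - (8 * (2 * c - 1) ^ 3 - 4 * (2 * c - 1)\<^sup>2 - 4 * (2 * c - 1) + 1)"
    unfolding end_eqs(2,3) yc by (simp add: field_simps power2_eq_square power3_eq_cube)
  finally have Q: "8 * (c ^ 3 * ((x - 1) * (x\<^sup>2 - a * x + b))) = 8 * y ^ 3 - 4 * y\<^sup>2 - 4 * y + 1"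
    using end_eqs(4) by simp
  have "poly (zol_Z zol_theta) x + 1 = 64 * c ^ 7 * ((x\<^sup>2 - 1) * (x - 1) * (x\<^sup>2 - a * x + b)\<^sup>2)"
    using arg_cong[OF end_eqs(1), of "\<lambda>p. poly p x"] by (simp add: power2_eq_square algebra_simps)
  also have "\<dots> = c * (1 + x) * (8 * (c ^ 3 * ((x - 1) * (x\<^sup>2 - a * x + b))))\<^sup>2"
    by (simp add: algebra_simps eval_nat_numeral)
  also have "\<dots> = (y + 1) * (8 * y ^ 3 - 4 * y\<^sup>2 - 4 * y + 1)\<^sup>2"
    unfolding Q by (simp add: yc)
  also have "\<dots> = (- 7 * y + 56 * y ^ 3 - 112 * y ^ 5 + 64 * y ^ 7) + 1"
    by (simp add: algebra_simps eval_nat_numeral)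
  finally show ?thesis by simp
qed

text \<open>The value of s is a seventh of the sum of the roots of Z + 1, which are -1, 1, 1 and
  those of F taken twice; hence 1 + 2 a. With c (1 + 2 a) = 7 - 7 c this becomes (1 - c) /
  c.\<close>

lemma zol_s_end: "zol_b 7 zol_theta \<noteq> 0" "zol_s zol_theta = (tan (pi / 14))\<^sup>2"
proof -
  define c a b where c: "c = (cos (pi / 14))\<^sup>2" and a: "a = ev eA u_end / ev eW u_end"
    and b: "b = ev eB u_end / (ev eW u_end)\<^sup>2"
  note end_eqs = zol_end[folded c a b]
  have cos: "0 < cos (pi / 14)" by (rule cos_gt_zero) auto
  then have c_pos: "0 < c" by (simp add: c)
  have F2: "[:b, - a, 1:] ^ 2 = [:b * b, - (2 * a * b), 2 * b + a * a, - (2 * a), 1:]"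
    by (simp add: power2_eq_square)
  have Z: "zol_Z zol_theta = smult (64 * c ^ 7) ([:- 1, 0, 1:] * [:- 1, 1:] * [:b, - a, 1:] ^ 2) - 1"
    using end_eqs(1) by (metis add_diff_cancel_right')
  have 7: "zol_b 7 zol_theta = 64 * c ^ 7" and 6: "zol_b 6 zol_theta = - (64 * c ^ 7 * (1 + 2 * a))"
    unfolding zol_b_def Z F2 by (simp_all add: one_pCons eval_nat_numeral algebra_simps)
  show "zol_b 7 zol_theta \<noteq> 0" using c_pos by (simp add: 7)
  have "zol_s zol_theta = (1 + 2 * a) / 7"
    using c_pos unfolding zol_s_def 6 7 by simp
  also have "c * (1 + 2 * a) = 7 - 7 * c" using end_eqs(2) by (simp add: algebra_simps)
  then have "(1 + 2 * a) / 7 = (1 - c) / c" using c_pos by (simp add: field_simps)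
  also have "1 - c = (sin (pi / 14))\<^sup>2" by (simp add: c sin_squared_eq)
  finally show "zol_s zol_theta = (tan (pi / 14))\<^sup>2" by (simp add: c tan_def power_divide)
qed

text \<open>At u = 0 also D = 0, so the factorization breaks down and the defining formula is
  evaluated directly. The odd coefficients vanish through their factor 13 + t.\<close>

lemma zol_start_eval: "poly (zol_Z (-13)) x = 1 - 18 * x\<^sup>2 + 48 * x ^ 4 - 32 * x ^ 6"
proof -
  have "(-13 :: real) = -13 - 12 * 0" by simp
  note even = p_even_u[OF order_refl this]
  have odd: "p11 (-13) = 0" "p12 (-13) = 0" "p31 (-13) = 0" "p32 (-13) = 0" "p51 (-13) = 0" "p52 (-13) = 0"
    "p71 (-13) = 0" "p72 (-13) = 0"
    by (simp_all only: p11_def p12_def p31_def p32_def p51_def p52_def p71_def p72_def) simp_all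
  have y: "yval 0 = 2" by (simp add: yval_def)
  have P: "ev eP0 0 = 512" "ev eP2 0 = - 9216" "ev eP4 0 = 24576" "ev eP6 0 = - 16384" "ev eM 0 = 512"
    by (simp_all add: ev_def eP0_def eP2_def eP4_def eP6_def eM_def y)
  have q: "zol_q (-13) = pscale * 512" using q_u[of 0] by (simp add: P)
  show ?thesis
    unfolding zol_Z_def even odd q P using pscale_pos
    by (simp add: field_simps eval_nat_numeral)
qed

subsection \<open>Injectivity\<close>

text \<open>The ratio \<open>\<alpha> / (\<beta> - \<alpha>)\<close>, which the polynomial determines, is a decreasing function of \<open>u\<close>:
  in \<open>p = 1 / u\<close> and \<open>q = 1 / (u + 2)\<close> it is given by an expression with positive coefficients.\<close>

lemma ratio_eq:
  assumes "0 < u"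
  defines "p \<equiv> 1 / u" and "q \<equiv> 1 / (u + 2)"
  shows "ev eW u / (2 * u ^ 3 * (u + 2)) = (4 * p ^ 3 * q + 14 * p\<^sup>2 * q + 16 * p * q
    + 2 * (1 + p)\<^sup>2 * sqrt (4 * q + 5 * (p * q) + 2 * (p\<^sup>2 * q)) + 6 * q) / 2 - 1 / 2"
proof -
  define s where "s = sqrt (4 * q + 5 * (p * q) + 2 * (p\<^sup>2 * q))"
  \<comment> \<open>The radicand of y factors as (u + 2) (4 u^2 + 5 u + 2); dividing by (u (u +
    2))^2 leaves q (4 + 5 p + 2 p^2).\<close>
  have "yval u = u * (u + 2) * s"
    unfolding yval_def
  proof (rule real_sqrt_unique)
    have "0 \<le> 4 * q + 5 * (p * q) + 2 * (p\<^sup>2 * q)" using assms by (simp add: p_def q_def)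
    then have "s\<^sup>2 = 4 * q + 5 * (p * q) + 2 * (p\<^sup>2 * q)" by (simp add: s_def)
    then have "(u * (u + 2) * s)\<^sup>2 = (u * (u + 2))\<^sup>2 * (4 * q + 5 * (p * q) + 2 * (p\<^sup>2 * q))"
      by (simp add: power_mult_distrib)
    also have "\<dots> = 4 + 12 * u + 13 * u\<^sup>2 + 4 * u ^ 3"
      using assms(1) unfolding p_def q_def
      by (simp add: divide_simps) (simp add: algebra_simps eval_nat_numeral)
    finally show "(u * (u + 2) * s)\<^sup>2 = 4 + 12 * u + 13 * u\<^sup>2 + 4 * u ^ 3" .
    show "0 \<le> u * (u + 2) * s" using assms by (simp add: s_def p_def q_def)
  qed
  \<comment> \<open>The only negative term, -u^4, contributes -1/2 + q to the ratio. The constant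
    splits off, and q joins the 2 q coming from 4 u^3.\<close>
  then have W: "ev eW u = 4 + 14 * u + 16 * u\<^sup>2 + 4 * u ^ 3 - u ^ 4 + 2 * (1 + u)\<^sup>2 * (u * (u + 2) * s)"
    by (simp add: ev_def eW_def algebra_simps eval_nat_numeral)
  show ?thesis
    unfolding W s_def[symmetric] using assms(1) unfolding p_def q_def
    by (simp add: divide_simps) (simp add: algebra_simps eval_nat_numeral)
qed

lemma ratio_decreasing:
  assumes "0 < u" "u < v"
  shows "ev eW v / (2 * v ^ 3 * (v + 2)) < ev eW u / (2 * u ^ 3 * (u + 2))"
proof -
  define p q p' q' where defs: "p = 1 / u" "q = 1 / (u + 2)" "p' = 1 / v" "q' = 1 / (v + 2)"
  have pq: "0 \<le> p'" "p' \<le> p" "0 \<le> q'" "q' < q"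
    using assms by (auto simp: defs divide_simps)
  then have "q' \<le> q" "0 \<le> p" "0 \<le> q" by auto
  \<comment> \<open>Every summand is weakly monotone in p and q; strictness comes from 6 q.\<close>
  then have "4 * p' ^ 3 * q' + 14 * p'\<^sup>2 * q' + 16 * p' * q'
      + 2 * (1 + p')\<^sup>2 * sqrt (4 * q' + 5 * (p' * q') + 2 * (p'\<^sup>2 * q')) + 6 * q'
    < 4 * p ^ 3 * q + 14 * p\<^sup>2 * q + 16 * p * q
      + 2 * (1 + p)\<^sup>2 * sqrt (4 * q + 5 * (p * q) + 2 * (p\<^sup>2 * q)) + 6 * q"
    using pq
    by (intro add_le_less_mono add_mono mult_mono power_mono real_sqrt_le_mono order_refl
        mult_strict_left_mono) auto
  then show ?thesis
    using assms by (simp add: ratio_eq defs)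
qed

lemma ratio_\<alpha>\<beta>:
  assumes "0 < u" "u \<le> 5 / 4"
  shows "zol_\<alpha> u / (zol_\<beta> u - zol_\<alpha> u) = ev eW u / (2 * u ^ 3 * (u + 2))"
proof -
  have r: "sqrt (ev eD u) \<noteq> 0" using ell_pos_imp[OF pos_eD assms] by simp
  have "ev eH u - ev eW u = 2 * u ^ 3 * (u + 2)"
    by (simp add: eH_def ev_def[of "Ell _ _"] algebra_simps eval_nat_numeral)
  then have "zol_\<beta> u - zol_\<alpha> u = 2 * u ^ 3 * (u + 2) / sqrt (ev eD u)"
    by (simp add: zol_\<alpha>_def zol_\<beta>_def flip: diff_divide_distrib)
  then show ?thesis using r by (simp add: zol_\<alpha>_def)
qed

lemma greater_one_eqI:
  fixes a b :: real
  assumes "1 < a" "1 < b" "\<And>x. 1 < x \<Longrightarrow> a < x \<longleftrightarrow> b < x"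
  shows "a = b"
  using assms(3)[of a] assms(3)[of b] assms(1,2) by linarith

lemma zol_Z_inj: "inj_on zol_Z zol_I"
proof (rule inj_onI)
  fix t t' assume "t \<in> zol_I" "t' \<in> zol_I" and Z: "zol_Z t = zol_Z t'"
  then obtain u v where u: "t = -13 - 12 * u" "0 < u" "u < u_end" and v: "t' = -13 - 12 * v" "0 < v" "v < u_end"
    by (auto simp: zol_I_iff)
  have cu: "u ^ 3 + u\<^sup>2 - 2 * u - 1 < 0" and cv: "v ^ 3 + v\<^sup>2 - 2 * v - 1 < 0"
    using cubic_sign(1) u v by blast+
  note zu = zolotarev_poly_u[OF cu u(2,1)] and zv = zolotarev_poly_u[OF cv v(2,1)]
  have b: "u \<le> 5 / 4" "v \<le> 5 / 4" using u v u_end_ok by (auto simp: u_ok_def)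
  have "zol_\<alpha> u = zol_\<alpha> v"
    using zolotarev_poly.\<alpha>_iff[OF zu] zolotarev_poly.\<alpha>_iff[OF zv] Z
    by (intro greater_one_eqI zolotarev_poly.\<alpha>[OF zu] zolotarev_poly.\<alpha>[OF zv]) metis
  moreover have "zol_\<beta> u = zol_\<beta> v"
    using zolotarev_poly.\<beta>_iff[OF zu] zolotarev_poly.\<beta>_iff[OF zv] Z
      zolotarev_poly.\<alpha>[OF zu] zolotarev_poly.\<alpha>\<beta>[OF zu] zolotarev_poly.\<alpha>[OF zv] zolotarev_poly.\<alpha>\<beta>[OF zv]
    by (intro greater_one_eqI) (linarith, linarith, metis)
  ultimately have "ev eW u / (2 * u ^ 3 * (u + 2)) = ev eW v / (2 * v ^ 3 * (v + 2))"
    using ratio_\<alpha>\<beta>[OF u(2) b(1)] ratio_\<alpha>\<beta>[OF v(2) b(2)] by simp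
  then have "u = v"
    using ratio_decreasing[of u v] ratio_decreasing[of v u] u(2) v(2) by (cases u v rule: linorder_cases) auto
  then show "t = t'" using u v by simp
qed
subsection \<open>Continuity and the bijection\<close>

lemma isCont_tendsto_within: "isCont f a \<Longrightarrow> (f \<longlongrightarrow> f a) (at a within S)"
  unfolding isCont_def by (rule tendsto_within_subset[OF _ subset_UNIV])

lemma isCont_peval: "isCont (peval cs) t"
  by (induction cs) (auto intro!: continuous_intros)

lemma isCont_smult_pCons8:
  fixes c a0 a1 a2 a3 a4 a5 a6 a7 :: "real \<Rightarrow> real" and t :: real
  defines "P \<equiv> \<lambda>t. smult (c t) [:a0 t, a1 t, a2 t, a3 t, a4 t, a5 t, a6 t, a7 t:]"
  assumes cont: "isCont c t" "isCont a0 t" "isCont a1 t" "isCont a2 t" "isCont a3 t" "isCont a4 t"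
    "isCont a5 t" "isCont a6 t" "isCont a7 t"
  shows "isCont (\<lambda>t. poly (P t) x) t" "isCont (\<lambda>t. coeff (P t) 6) t" "isCont (\<lambda>t. coeff (P t) 7) t"
proof -
  show "isCont (\<lambda>t. poly (P t) x) t"
    unfolding P_def poly_smult poly_pCons poly_0 by (intro continuous_intros cont)
  show "isCont (\<lambda>t. coeff (P t) 6) t" "isCont (\<lambda>t. coeff (P t) 7) t"
    unfolding P_def using continuous_mult[OF cont(1) cont(8)] continuous_mult[OF cont(1) cont(9)]
    by (simp_all add: eval_nat_numeral)
qed

text \<open>\<open>sqrt\<close> is continuous on all reals and q vanishes only at -1. So Z is
  continuous at both endpoints of the interval, and its limits there are its values.\<close>

lemma isCont_Z:
  assumes "t \<noteq> -1"
  shows "isCont (\<lambda>t. poly (zol_Z t) x) t" "isCont (zol_b 6) t" "isCont (zol_b 7) t"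
proof -
  have "isCont zol_q t" unfolding zol_q_def by (intro continuous_intros)
  moreover have "zol_q t \<noteq> 0" using assms by (simp add: zol_q_def)
  ultimately have q: "isCont (\<lambda>t. 1 / zol_q t) t"
    by (intro isCont_divide continuous_const)
  have om: "isCont zol_omega t" unfolding zol_omega_def by (intro continuous_intros)
  have even: "isCont (\<lambda>t. peval c t + zol_omega t * peval d t) t" for c d
    by (intro continuous_add continuous_mult isCont_peval om)
  have odd: "isCont (\<lambda>t. sqrt (peval c t + zol_omega t * peval d t)) t" for c d
    by (rule continuous_real_sqrt[OF even])
  note cont = isCont_smult_pCons8[OF q even continuous_minus[OF odd] even odd even continuous_minus[OF odd] even odd]
  show "isCont (\<lambda>t. poly (zol_Z t) x) t" "isCont (zol_b 6) t" "isCont (zol_b 7) t"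
    unfolding zol_b_def zol_Z_def p_eqs by (rule cont)+
qed

text \<open>A continuous injective function is strictly monotone, and divergence to infinity at b
  makes it increasing; the range then follows from the intermediate value theorem.\<close>

lemma Ioo_bij_betw_greaterThan:
  fixes f :: "real \<Rightarrow> real"
  assumes "a < b" and cont: "continuous_on {a<..<b} f" and inj: "inj_on f {a<..<b}"
    and lim: "(f \<longlongrightarrow> l) (at a within {a<..<b})"
    and top: "filterlim f at_top (at b within {a<..<b})"
  shows "bij_betw f {a<..<b} {l<..}"
proof -
  have right: "at a within {a<..<b} = at_right a"
    using \<open>a < b\<close> by (intro at_within_nhd[of _ "{..<b}"]) auto
  have left: "at b within {a<..<b} = at_left b"
    using \<open>a < b\<close> by (intro at_within_nhd[of _ "{a<..}"]) auto
  have big: "\<exists>z. y < z \<and> z < b \<and> v < f z" if "y < b" for y v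
  proof -
    have "eventually (\<lambda>z. v < f z) (at_left b)"
      using top unfolding left by (simp add: filterlim_at_top_dense)
    moreover have "eventually (\<lambda>z. z \<in> {y<..<b}) (at_left b)"
      using that by (rule eventually_at_left_real)
    ultimately have "eventually (\<lambda>z. z \<in> {y<..<b} \<and> v < f z) (at_left b)" by eventually_elim auto
    then show ?thesis using eventually_happens trivial_limit_at_left_real by fastforce
  qed
  have mono: "f x < f y" if xy: "a < x" "x < y" "y < b" for x y
  proof -
    \<comment> \<open>A later point with a larger value rules out the decreasing case.\<close>
    obtain z where z: "y < z" "z < b" "f x < f z" using big[OF xy(3)] by blast
    have "{x..z} \<subseteq> {a<..<b}" using xy z by auto
    then have "(f x < f y \<and> f y < f z) \<or> (f z < f y \<and> f y < f x)"
      using xy z continuous_on_subset[OF cont] inj_on_subset[OF inj]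
      by (intro continuous_inj_imp_mono) auto
    then show ?thesis using z by auto
  qed
  have lower: "l < f t" if t: "a < t" "t < b" for t
  proof -
    \<comment> \<open>The limit gives only the weak bound at t1; passing on to t makes it
      strict.\<close>
    obtain t1 where t1: "a < t1" "t1 < t" using dense[OF t(1)] by blast
    have "eventually (\<lambda>x. x \<in> {a<..<t1}) (at_right a)"
      using t1(1) by (rule eventually_at_right_real)
    then have "eventually (\<lambda>x. f x \<le> f t1) (at_right a)"
      by eventually_elim (use t t1 mono in \<open>auto intro: less_imp_le\<close>)
    then have "l \<le> f t1"
      using lim unfolding right by (intro tendsto_upperbound) auto
    also have "\<dots> < f t" using t1 t by (intro mono) auto
    finally show ?thesis .
  qed
  have onto: "\<exists>t\<in>{a<..<b}. f t = v" if "l < v" for v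
  proof -
    have "eventually (\<lambda>x. f x < v) (at_right a)"
      using lim that unfolding right by (rule order_tendstoD(2))
    moreover have "eventually (\<lambda>x. x \<in> {a<..<b}) (at_right a)"
      using \<open>a < b\<close> by (rule eventually_at_right_real)
    ultimately have "eventually (\<lambda>x. x \<in> {a<..<b} \<and> f x < v) (at_right a)" by eventually_elim auto
    then obtain t1 where t1: "a < t1" "t1 < b" "f t1 < v"
      using eventually_happens trivial_limit_at_right_real by fastforce
    obtain t2 where t2: "t1 < t2" "t2 < b" "v < f t2" using big[OF t1(2)] by blast
    have "{t1..t2} \<subseteq> {a<..<b}" using t1 t2 by auto
    then obtain t where "t1 \<le> t" "t \<le> t2" "f t = v"
      using IVT'[of f t1 v t2] t1 t2 continuous_on_subset[OF cont] by force
    then show ?thesis using t1 t2 by (intro bexI[of _ t]) auto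
  qed
  show ?thesis
    unfolding bij_betw_def using inj lower onto by (auto simp: image_iff)
qed

section \<open>The Chebyshev polynomials of degrees 6 and 7\<close>

lemma cheb_eqI: "(\<And>\<phi>. poly p (cos \<phi>) = cos (real n * \<phi>)) \<Longrightarrow> cheb n = p"
  unfolding cheb_def using cheb_ex1[of n] by (intro the1_equality) auto

lemma cheb_6: "cheb 6 = [:-1, 0, 18, 0, -48, 0, 32:]"
proof (rule cheb_eqI)
  fix \<phi> :: real
  have "cos (real 6 * \<phi>) = cos (2 * (3 * \<phi>))" by simp
  also have "\<dots> = 2 * (4 * cos \<phi> ^ 3 - 3 * cos \<phi>)\<^sup>2 - 1"
    by (simp only: cos_double_cos cos_treble_cos)
  finally show "poly [:-1, 0, 18, 0, -48, 0, 32:] (cos \<phi>) = cos (real 6 * \<phi>)"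
    by (simp add: algebra_simps eval_nat_numeral)
qed

lemma cheb_7: "cheb 7 = [:0, -7, 0, 56, 0, -112, 0, 64:]"
proof (rule cheb_eqI)
  fix \<phi> :: real
  have "cos (7 * \<phi>) = 2 * cos (4 * \<phi>) * cos (3 * \<phi>) - cos \<phi>"
    using cos_add[of "4 * \<phi>" "3 * \<phi>"] cos_diff[of "4 * \<phi>" "3 * \<phi>"] by simp
  moreover have "cos (4 * \<phi>) = cos (2 * (2 * \<phi>))" by simp
  ultimately have "cos (real 7 * \<phi>) = 2 * (2 * (2 * (cos \<phi>)\<^sup>2 - 1)\<^sup>2 - 1) * (4 * cos \<phi> ^ 3 - 3 * cos \<phi>) - cos \<phi>"
    by (simp only: cos_double_cos cos_treble_cos of_nat_numeral)
  then show "poly [:0, -7, 0, 56, 0, -112, 0, 64:] (cos \<phi>) = cos (real 7 * \<phi>)"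
    by (simp add: algebra_simps eval_nat_numeral)
qed

section \<open>Optimality for every parameter and the bijection onto the values of s\<close>

lemma zol_main:
  assumes "t \<in> zol_I"
  shows "zol_well_defined t" "0 < zol_b 7 t" "zol_Z t = normalized_zol (zol_s t)"
    "monic_zol (zol_s t) = smult (1 / zol_b 7 t) (zol_Z t)"
proof -
  obtain u where u: "t = -13 - 12 * u" "0 < u" "u < u_end"
    using assms by (auto simp: zol_I_iff)
  then have "u_ok u" using u_end_ok by (simp add: u_ok_def)
  then show "zol_well_defined t" using u(1) by (rule well_defined_u)
  have cub: "u ^ 3 + u\<^sup>2 - 2 * u - 1 < 0" using cubic_sign(1) u by blast
  interpret zolotarev_poly "zol_Z t" "[:ev eB u / (sqrt (ev eD u))\<^sup>2, - (ev eA u / sqrt (ev eD u)), 1:]"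
    "[:ev eG0 u / sqrt (ev eD u) ^ 3, ev eG1 u / (sqrt (ev eD u))\<^sup>2, ev eG2 u / sqrt (ev eD u), 1:]"
    "ev eN7 u * sqrt (ev eD u) / ev eM u" "zol_\<alpha> u" "zol_\<beta> u"
    "ev eB u / (sqrt (ev eD u))\<^sup>2" "- (ev eA u / sqrt (ev eD u))" "ev eG0 u / sqrt (ev eD u) ^ 3"
    "ev eG1 u / (sqrt (ev eD u))\<^sup>2" "ev eG2 u / sqrt (ev eD u)"
    by (rule zolotarev_poly_u[OF cub u(2,1)])
  show "0 < zol_b 7 t" using b by (simp add: zol_b_def coeff_Z_7)
  have s: "zol_s t = - coeff (zol_Z t) 6 / (7 * (ev eN7 u * sqrt (ev eD u) / ev eM u))"
    by (simp only: zol_s_def zol_b_def coeff_Z_7)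
  show "zol_Z t = normalized_zol (zol_s t)" unfolding s by (rule optimal(3)[symmetric])
  show "monic_zol (zol_s t) = smult (1 / zol_b 7 t) (zol_Z t)"
    unfolding s zol_b_def coeff_Z_7 by (rule optimal(2))
qed

lemma theta_less: "zol_theta < -13"
  using zol_theta_bounds by simp

lemma zol_s_bij: "bij_betw zol_s zol_I {(tan (pi / 14))\<^sup>2<..}"
  unfolding zol_I_def
proof (rule Ioo_bij_betw_greaterThan[OF theta_less], fold zol_I_def)
  have s_cont: "isCont zol_s t" if "t \<le> -13" "zol_b 7 t \<noteq> 0" for t
  proof -
    have "t \<noteq> -1" "7 * zol_b 7 t \<noteq> 0" using that by simp_all
    then show ?thesis
      unfolding zol_s_def by (intro isCont_divide isCont_minus isCont_mult continuous_const isCont_Z)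
  qed
  show "continuous_on zol_I zol_s"
  proof (intro continuous_at_imp_continuous_on ballI s_cont)
    fix t assume "t \<in> zol_I"
    then show "t \<le> -13" "zol_b 7 t \<noteq> 0" using zol_main(2)[of t] by (auto simp: zol_I_def)
  qed
  show "inj_on zol_s zol_I"
  proof (rule inj_onI)
    fix t t' assume "t \<in> zol_I" "t' \<in> zol_I" "zol_s t = zol_s t'"
    then have "zol_Z t = zol_Z t'" using zol_main(3)[of t] zol_main(3)[of t'] by metis
    then show "t = t'"
      using \<open>t \<in> zol_I\<close> \<open>t' \<in> zol_I\<close> by (rule inj_onD[OF zol_Z_inj])
  qed
  have "isCont zol_s zol_theta" using theta_less zol_s_end(1) by (intro s_cont) auto
  from isCont_tendsto_within[OF this]
  show "(zol_s \<longlongrightarrow> (tan (pi / 14))\<^sup>2) (at zol_theta within zol_I)"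
    unfolding zol_s_end(2) .
  have "(-13 :: real) \<noteq> -1" by simp
  note b = isCont_Z(2,3)[OF this, THEN isCont_tendsto_within[of _ _ zol_I]]
  have start: "zol_Z (-13) = [:1, 0, -18, 0, 48, 0, -32:]"
    unfolding poly_eq_poly_eq_iff[symmetric] by (rule ext) (simp add: zol_start_eval algebra_simps eval_nat_numeral)
  \<comment> \<open>At -13 the degree drops to 6: \<open>zol_b 7\<close> tends to 0 from above while
    \<open>- zol_b 6 / 7\<close> tends to 32/7, so s diverges. The value \<open>zol_s (-13)\<close>
    itself is the default 0 of a division by zero, so here the limit cannot come from continuity of
    s.\<close>
  have 7: "zol_b 7 (-13) = 0" and 6: "zol_b 6 (-13) = -32"
    unfolding zol_b_def start by (simp_all add: eval_nat_numeral)
  have "eventually (\<lambda>t. 0 < zol_b 7 t) (at (-13) within zol_I)"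
    unfolding eventually_at_filter by (intro always_eventually allI impI zol_main(2))
  with b(2) have inv: "filterlim (\<lambda>t. inverse (zol_b 7 t)) at_top (at (-13) within zol_I)"
    unfolding 7 by (rule filterlim_inverse_at_top)
  have lim6: "((\<lambda>t. - zol_b 6 t / 7) \<longlongrightarrow> 32 / 7) (at (-13) within zol_I)"
  proof -
    have "((\<lambda>t. - zol_b 6 t / 7) \<longlongrightarrow> - zol_b 6 (-13) / 7) (at (-13) within zol_I)"
      by (intro tendsto_intros b(1)) simp
    then show ?thesis unfolding 6 by simp
  qed
  have "(0::real) < 32 / 7" by simp
  from filterlim_tendsto_pos_mult_at_top[OF lim6 this inv]
  have "filterlim (\<lambda>t. - zol_b 6 t / 7 * inverse (zol_b 7 t)) at_top (at (-13) within zol_I)" .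
  also have "(\<lambda>t. - zol_b 6 t / 7 * inverse (zol_b 7 t)) = zol_s"
    by (rule ext) (simp only: zol_s_def divide_inverse inverse_mult_distrib mult.assoc)
  finally show "filterlim zol_s at_top (at (-13) within zol_I)" .
qed

theorem theorem1:
  shows "zol_theta \<in> {-27.963756<..-27.963755}
    \<and> (\<forall>t\<in>zol_I. zol_well_defined t \<and> zol_b 7 t \<noteq> 0)
    \<and> bij_betw zol_s zol_I {(tan (pi / 14))\<^sup>2<..}
    \<and> (\<forall>t\<in>zol_I. zol_Z t = normalized_zol (zol_s t))
    \<and> (\<forall>x. ((\<lambda>t. poly (zol_Z t) x) \<longlongrightarrow> - poly (cheb 6) x) (at (-13) within zol_I))
    \<and> (\<forall>x. - poly (cheb 6) x = 1 - 18 * x^2 + 48 * x^4 - 32 * x^6)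
    \<and> (\<forall>x y. y = (1 + x) * (cos (pi / 14))\<^sup>2 - 1 \<longrightarrow>
         ((\<lambda>t. poly (zol_Z t) x) \<longlongrightarrow> poly (cheb 7) y) (at zol_theta within zol_I)
         \<and> poly (cheb 7) y = - 7 * y + 56 * y^3 - 112 * y^5 + 64 * y^7)
    \<and> (\<forall>t\<in>zol_I. \<forall>k\<le>7. coeff (monic_zol (zol_s t)) k = zol_b k t / zol_b 7 t)"
proof (intro conjI ballI allI impI)
  have lim: "((\<lambda>t. poly (zol_Z t) x) \<longlongrightarrow> poly (zol_Z t0) x) (at t0 within zol_I)" if "t0 \<le> -13" for x t0
  proof -
    have "t0 \<noteq> -1" using that by linarith
    from isCont_tendsto_within[OF isCont_Z(1)[OF this]] show ?thesis .
  qed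
  show "zol_theta \<in> {-27.963756<..-27.963755}" using zol_theta_bounds by simp
  show "bij_betw zol_s zol_I {(tan (pi / 14))\<^sup>2<..}" by (rule zol_s_bij)
  show c6: "- poly (cheb 6) x = 1 - 18 * x^2 + 48 * x^4 - 32 * x^6" for x
    unfolding cheb_6 by (simp add: algebra_simps eval_nat_numeral)
  show "((\<lambda>t. poly (zol_Z t) x) \<longlongrightarrow> - poly (cheb 6) x) (at (-13) within zol_I)" for x
    unfolding c6 zol_start_eval[symmetric] by (rule lim) simp
  show c7: "poly (cheb 7) y = - 7 * y + 56 * y^3 - 112 * y^5 + 64 * y^7" for y
    unfolding cheb_7 by (simp add: algebra_simps eval_nat_numeral)
  show "((\<lambda>t. poly (zol_Z t) x) \<longlongrightarrow> poly (cheb 7) y) (at zol_theta within zol_I)"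
    if "y = (1 + x) * (cos (pi / 14))\<^sup>2 - 1" for x y
    unfolding c7 zol_end_eval[OF that, symmetric] using theta_less by (intro lim) simp
  show "zol_well_defined t" "zol_b 7 t \<noteq> 0" "zol_Z t = normalized_zol (zol_s t)" if "t \<in> zol_I" for t
    using zol_main(1-3)[OF that] by auto
  show "coeff (monic_zol (zol_s t)) k = zol_b k t / zol_b 7 t" if "t \<in> zol_I" for t k
    unfolding zol_main(4)[OF that] by (simp add: zol_b_def)
qed

end
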